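(* Let $m\ge 2$, $q>1$, $T_1>0$, $T_j>(q-1)T_1$ for $j=2,\dots,m$, $a_j,b_j,c_j\in\mathbb{R}$ and $\alpha_j>0$ for $j=1,\dots,m$. Suppose that $|a_1|\ne q^{-1/2}$ and $|a_2|+\dots+|a_m|>0$. Then for every $y_0\in\mathbb{R}$ the boundary value problem $\mathcal{B}$ has a unique generalized solution $y\in W_2^1(\Gamma_m)$. Moreover, there exists a constant $C$, independent of $y_0$, such that $$\|y\|_{W_2^1(\Gamma_m)}\le C|y_0|.$$
   Context: Function spaces. All functions are real-valued. $W_2^k[a,b]$ is the Sobolev space of functions on $[a,b]$ with (weak) derivatives up to order $k$ in $L_2(a,b)$; for $k\ge1$ its elements are identified with their continuous representatives. A function on the star graph $\Gamma_m$ is a tuple $y=[y_1,\dots,y_m]$ with $y_j$ defined on $[0,T_j]$. $W_2^k(\Gamma_m)=\bigoplus_{j=1}^m W_2^k[0,T_j]$ with $(y,z)_{W_2^k(\Gamma_m)}=\sum_{j=1}^m (y_j,z_j)_{W_2^k[0,T_j]}$, where $(f,g)_{W_2^k[a,b]}=\sum_{\nu=0}^k (f^{(\nu)},g^{(\nu)})_{L_2(a,b)}$. Set $l_1:=T_1$ and $l_j:=q^{-1}(T_j-(q-1)T_1)$ for $j=2,\dots,m$. Global delay convention: for any function $y$ on $\Gamma_m$, the components with $j=2,\dots,m$ are always extended to negative arguments by $y_j(t)=y_1(t+T_1)$ for $(q^{-1}-1)T_1<t<0$ (and likewise for derivatives). Expressions: $\ell_1y(t)=y_1'(t)+a_1y_1'(q^{-1}t)+b_1y_1(t)+c_1y_1(q^{-1}t)$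 for $0<t<T_1$, and $\ell_jy(t)=y_j'(t)+a_jy_j'(q^{-1}(t-(q-1)T_1))+b_jy_j(t)+c_jy_j(q^{-1}(t-(q-1)T_1))$ for $0<t<T_j$, $j=2,\dots,m$. Conditions: (I) $y_1(0)=y_0$; (C) $y_j(0)=y_1(T_1)$, $j=2,\dots,m$; (E) $y_j(t)=0$ for $l_j\le t\le T_j$, $j=2,\dots,m$. Boundary value problem $\mathcal{B}$. For $\nu\in\{0,1\}$ put $\theta_{1,j}=a_j$, $\theta_{0,j}=c_j$, $j=1,\dots,m$, and $\widetilde\ell_{\nu,1}y(t)=q\alpha_1\theta_{\nu,1}\,\ell_1y(qt)$ for $0<t<q^{-1}T_1$, $\widetilde\ell_{\nu,1}y(t)=q\sum_{k=2}^m\alpha_k\theta_{\nu,k}\,\ell_ky(qt-T_1)$ for $q^{-1}T_1<t<T_1$; for $j=2,\dots,m$: $\widetilde\ell_{\nu,j}y(t)=q\alpha_j\theta_{\nu,j}\,\ell_jy(qt+(q-1)T_1)$ for $0<t<l_j$, $\widetilde\ell_{\nu,j}y(t)=0$ for $l_j<t<T_j$. Let $\widehat\ell_jy(t):=\alpha_j\ell_jy(t)+\widetilde\ell_{1,j}y(t)$, $j=1,\dots,m$. Problem $\mathcal{B}$ consists of the equations $$\mathcal{L}_jy(t):=-\big(\widehat\ell_jy(t)\big)'+\alpha_jb_j\ell_jy(t)+\widetilde\ell_{0,j}y(t)=0,\quad 0<t<l_j,\quad j=1,\dots,m,$$ together with (I), (C), (E), the global delay convention, and the Kirchhoff-type condition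 $$\widehat\ell_1y(T_1)=\sum_{j=2}^m\widehat\ell_jy(0).$$ A generalized solution of $\mathcal{B}$ is a function $y=[y_1,\dots,y_m]\in W_2^1(\Gamma_m)$ such that $\widehat\ell_jy\in W_2^1[0,l_j]$ for $j=1,\dots,m$ and all the equations (almost everywhere) and conditions of $\mathcal{B}$ hold. *)

theory Defs
  imports "HOL-Analysis.Analysis"
begin

text \<open>Elements of \<open>L\<^sub>2(a,b)\<close> and of the Sobolev space are represented by functions on the reals;
  only their classes modulo almost everywhere equality on \<open>(a,b)\<close> matter.\<close>

definition L2 :: "real \<Rightarrow> real \<Rightarrow> (real \<Rightarrow> real) set" where
  "L2 a b = {f \<in> borel_measurable (lebesgue_on {a<..<b}).
     integrable (lebesgue_on {a<..<b}) (\<lambda>t. (f t)\<^sup>2)}"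

text \<open>Test functions are the \<open>C\<^sup>1\<close> functions with compact support in \<open>(a,b)\<close>, as in Brezis,
  Functional Analysis, Sobolev Spaces and PDEs, Section 8.2; \<open>\<phi>'\<close> is the derivative of \<open>\<phi>\<close>.\<close>

definition test_function :: "real \<Rightarrow> real \<Rightarrow> (real \<Rightarrow> real) \<Rightarrow> (real \<Rightarrow> real) \<Rightarrow> bool" where
  "test_function a b \<phi> \<phi>' \<longleftrightarrow>
     (\<forall>t. (\<phi> has_real_derivative \<phi>' t) (at t)) \<and> continuous_on UNIV \<phi>' \<and>
     (\<exists>c d. a < c \<and> d < b \<and> (\<forall>t. t \<notin> {c..d} \<longrightarrow> \<phi> t = 0))"

definition has_weak_deriv :: "real \<Rightarrow> real \<Rightarrow> (real \<Rightarrow> real) \<Rightarrow> (real \<Rightarrow> real) \<Rightarrow> bool" where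
  "has_weak_deriv a b f g \<longleftrightarrow> (\<forall>\<phi> \<phi>'. test_function a b \<phi> \<phi>' \<longrightarrow>
     (LINT t|lebesgue_on {a<..<b}. f t * \<phi>' t) = - (LINT t|lebesgue_on {a<..<b}. g t * \<phi> t))"

definition W21 :: "real \<Rightarrow> real \<Rightarrow> (real \<Rightarrow> real) set" where
  "W21 a b = {f \<in> L2 a b. \<exists>g \<in> L2 a b. has_weak_deriv a b f g}"

text \<open>A representative of the weak derivative; unique almost everywhere on \<open>(a,b)\<close>.\<close>

definition weak_deriv :: "real \<Rightarrow> real \<Rightarrow> (real \<Rightarrow> real) \<Rightarrow> real \<Rightarrow> real" where
  "weak_deriv a b f = (SOME g. g \<in> L2 a b \<and> has_weak_deriv a b f g)"

text \<open>For \<open>a < b\<close> the continuous representative is unique on \<open>[a,b]\<close>; it gives meaning to the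
  value at an end point of an element of \<open>W\<^sub>2\<^sup>1[a,b]\<close> that is only given almost everywhere.\<close>

definition cont_rep :: "real \<Rightarrow> real \<Rightarrow> (real \<Rightarrow> real) \<Rightarrow> real \<Rightarrow> real" where
  "cont_rep a b f =
     (SOME h. continuous_on {a..b} h \<and> (AE t in lebesgue_on {a<..<b}. h t = f t))"

definition W21_inner :: "real \<Rightarrow> real \<Rightarrow> (real \<Rightarrow> real) \<Rightarrow> (real \<Rightarrow> real) \<Rightarrow> real" where
  "W21_inner a b f g =
     (LINT t|lebesgue_on {a<..<b}. f t * g t) +
     (LINT t|lebesgue_on {a<..<b}. weak_deriv a b f t * weak_deriv a b g t)"

text \<open>A function on the star graph with edges \<open>[0, T j]\<close>, \<open>j = 1,\<dots>,m\<close>, is a family \<open>y\<close> of which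
  only the values \<open>y j t\<close> with \<open>j \<in> {1..m}\<close> and \<open>t \<in> {0..T j}\<close> are meaningful. Here the
  components are the continuous representatives themselves.\<close>

definition W21_star :: "nat \<Rightarrow> (nat \<Rightarrow> real) \<Rightarrow> (nat \<Rightarrow> real \<Rightarrow> real) set" where
  "W21_star m T = {y. \<forall>j\<in>{1..m}. y j \<in> W21 0 (T j) \<and> continuous_on {0..T j} (y j)}"

definition W21_star_inner ::
    "nat \<Rightarrow> (nat \<Rightarrow> real) \<Rightarrow> (nat \<Rightarrow> real \<Rightarrow> real) \<Rightarrow> (nat \<Rightarrow> real \<Rightarrow> real) \<Rightarrow> real" where
  "W21_star_inner m T y z = (\<Sum>j=1..m. W21_inner 0 (T j) (y j) (z j))"

definition W21_star_norm :: "nat \<Rightarrow> (nat \<Rightarrow> real) \<Rightarrow> (nat \<Rightarrow> real \<Rightarrow> real) \<Rightarrow> real" where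
  "W21_star_norm m T y = sqrt (W21_star_inner m T y y)"

context
  fixes m :: nat and q :: real and T a b c \<alpha> :: "nat \<Rightarrow> real"
begin

definition edge_l :: "nat \<Rightarrow> real" where
  "edge_l j = (if j = 1 then T 1 else (T j - (q - 1) * T 1) / q)"

text \<open>The global delay convention, to be applied to \<open>y\<close> and to its derivative.\<close>

definition delay_ext :: "(nat \<Rightarrow> real \<Rightarrow> real) \<Rightarrow> nat \<Rightarrow> real \<Rightarrow> real" where
  "delay_ext f j t = (if j \<noteq> 1 \<and> t < 0 then f 1 (t + T 1) else f j t)"

definition delayed_arg :: "nat \<Rightarrow> real \<Rightarrow> real" where
  "delayed_arg j t = (if j = 1 then t / q else (t - (q - 1) * T 1) / q)"

definition star_deriv :: "(nat \<Rightarrow> real \<Rightarrow> real) \<Rightarrow> nat \<Rightarrow> real \<Rightarrow> real" where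
  "star_deriv y j = weak_deriv 0 (T j) (y j)"

definition ell :: "(nat \<Rightarrow> real \<Rightarrow> real) \<Rightarrow> nat \<Rightarrow> real \<Rightarrow> real" where
  "ell y j t = star_deriv y j t + a j * delay_ext (star_deriv y) j (delayed_arg j t)
     + b j * y j t + c j * delay_ext y j (delayed_arg j t)"

definition theta :: "nat \<Rightarrow> nat \<Rightarrow> real" where
  "theta \<nu> j = (if \<nu> = 1 then a j else c j)"

definition ell_tilde :: "nat \<Rightarrow> (nat \<Rightarrow> real \<Rightarrow> real) \<Rightarrow> nat \<Rightarrow> real \<Rightarrow> real" where
  "ell_tilde \<nu> y j t =
     (if j = 1 then
        if t < T 1 / q then q * \<alpha> 1 * theta \<nu> 1 * ell y 1 (q * t)
        else q * (\<Sum>k=2..m. \<alpha> k * theta \<nu> k * ell y k (q * t - T 1))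
      else
        if t < edge_l j then q * \<alpha> j * theta \<nu> j * ell y j (q * t + (q - 1) * T 1)
        else 0)"

definition ell_hat :: "(nat \<Rightarrow> real \<Rightarrow> real) \<Rightarrow> nat \<Rightarrow> real \<Rightarrow> real" where
  "ell_hat y j t = \<alpha> j * ell y j t + ell_tilde 1 y j t"

definition op_L :: "(nat \<Rightarrow> real \<Rightarrow> real) \<Rightarrow> nat \<Rightarrow> real \<Rightarrow> real" where
  "op_L y j t = - weak_deriv 0 (edge_l j) (ell_hat y j) t
     + \<alpha> j * b j * ell y j t + ell_tilde 0 y j t"

definition generalized_solution :: "real \<Rightarrow> (nat \<Rightarrow> real \<Rightarrow> real) \<Rightarrow> bool" where
  "generalized_solution y0 y \<longleftrightarrow>
     y \<in> W21_star m T \<and>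
     (\<forall>j\<in>{1..m}. ell_hat y j \<in> W21 0 (edge_l j)) \<and>
     (\<forall>j\<in>{1..m}. AE t in lebesgue_on {0<..<edge_l j}. op_L y j t = 0) \<and>
     y 1 0 = y0 \<and>
     (\<forall>j\<in>{2..m}. y j 0 = y 1 (T 1)) \<and>
     (\<forall>j\<in>{2..m}. \<forall>t\<in>{edge_l j..T j}. y j t = 0) \<and>
     cont_rep 0 (edge_l 1) (ell_hat y 1) (T 1)
       = (\<Sum>j=2..m. cont_rep 0 (edge_l j) (ell_hat y j) 0)"

end

end

theory Submission imports Defs begin

text \<open>Problem \<open>B\<close> is the Euler--Lagrange problem of the functional
  \<open>J y = (\<Sum>j. \<alpha> j * \<integral> (ell y j)\<^sup>2)\<close> under (I), (C), (E). On the concatenation of the first edge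
  with another one, in the variable \<open>s = t + T 1\<close> on the latter, the expressions become one
  pantograph expression \<open>Y' s + a Y' (s / q) + b Y s + c Y (s / q)\<close> with piecewise constant
  coefficients. The operator \<open>U \<mapsto> a U (\<cdot> / q)\<close> has norm \<open>\<bar>a 1\<bar> sqrt q\<close> near \<open>0\<close>; away from \<open>0\<close>
  the delay is bounded below, so an exponential weight makes it (or its inverse) and the lower order
  terms small. If \<open>\<bar>a 1\<bar> sqrt q < 1\<close>, this bounds \<open>Y'\<close> by the expression starting from
  \<open>Y 0 = 0\<close>; if \<open>\<bar>a 1\<bar> sqrt q > 1\<close>, it does so backwards from (E) along an edge with
  \<open>a j \<noteq> 0\<close>, and then forwards on the other edges. Hence \<open>J\<close> is coercive, so it has a
  minimizer. Changing variables in the delayed terms and integrating by parts translates the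
  vanishing of the first variation into \<open>B\<close>, and the solution depends linearly on \<open>y0\<close>.\<close>

section \<open>Square integrable functions\<close>

text \<open>The formulation of the problem shapes the proof. \<open>weak_deriv\<close> is a choice
  of one representative, so \<open>ell\<close> respects linear combinations only almost everywhere.
  The linear algebra is therefore done with explicit pairs: \<open>adm k u y\<close> records u as a
  derivative of y, \<open>lop u y\<close> is the expression formed from both, and these are linear
  pointwise. \<open>star_deriv\<close> comes back only at the end, through almost everywhere
  arguments. Nothing makes \<open>ell_hat y j\<close> regular in advance: it is only square
  integrable. That it belongs to the Sobolev space is read off from the vanishing of the first
  variation on functions supported in one edge, which exhibits its weak derivative. The limit of the
  minimizing sequence enters through orthogonality and not through its value of J: elements with J
  close to the infimum are almost orthogonal to all variations, and this relation passes to the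
  limit. The constant C of the theorem is the norm of the solution for y0 = 1.\<close>

definition sq_int :: "'a measure \<Rightarrow> ('a \<Rightarrow> real) \<Rightarrow> bool" where
  "sq_int M f \<longleftrightarrow> f \<in> borel_measurable M \<and> integrable M (\<lambda>x. (f x)\<^sup>2)"

definition nrm2 :: "'a measure \<Rightarrow> ('a \<Rightarrow> real) \<Rightarrow> real" where
  "nrm2 M f = sqrt (LINT x|M. (f x)\<^sup>2)"

lemma sq_int_measurable [measurable_dest]: "sq_int M f \<Longrightarrow> f \<in> borel_measurable M"
  by (simp add: sq_int_def)

lemma sq_int_integrable: "sq_int M f \<Longrightarrow> integrable M (\<lambda>x. (f x)\<^sup>2)"
  by (simp add: sq_int_def)

lemma L2_iff: "f \<in> L2 a b \<longleftrightarrow> sq_int (lebesgue_on {a<..<b}) f"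
  by (simp add: L2_def sq_int_def)

lemma nrm2_nonneg [simp]: "0 \<le> nrm2 M f"
  by (simp add: nrm2_def)

lemma nrm2_sq: "(nrm2 M f)\<^sup>2 = (LINT x|M. (f x)\<^sup>2)"
  by (simp add: nrm2_def)

lemma sq_int_mult:
  assumes "sq_int M f" "sq_int M g"
  shows "integrable M (\<lambda>x. f x * g x)"
proof (rule Bochner_Integration.integrable_bound)
  show "integrable M (\<lambda>x. (f x)\<^sup>2 + (g x)\<^sup>2)"
    using assms by (auto intro: sq_int_integrable)
  show "(\<lambda>x. f x * g x) \<in> borel_measurable M"
    using assms by (auto simp: sq_int_def)
  have "\<bar>u * v\<bar> \<le> u\<^sup>2 + v\<^sup>2" for u v :: real
  proof -
    have "0 \<le> (\<bar>u\<bar> - \<bar>v\<bar>)\<^sup>2" "0 \<le> \<bar>u\<bar> * \<bar>v\<bar>" by auto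
    then have "2 * (\<bar>u\<bar> * \<bar>v\<bar>) \<le> u\<^sup>2 + v\<^sup>2" by (simp add: power2_diff mult.assoc)
    with \<open>0 \<le> \<bar>u\<bar> * \<bar>v\<bar>\<close> show ?thesis unfolding abs_mult by linarith
  qed
  then show "AE x in M. norm (f x * g x) \<le> norm ((f x)\<^sup>2 + (g x)\<^sup>2)"
    by (auto intro!: AE_I2)
qed

lemma sq_int_cong_AE:
  assumes "sq_int M f" "g \<in> borel_measurable M" "AE x in M. f x = g x"
  shows "sq_int M g"
  using assms unfolding sq_int_def
  by (auto intro: integrable_cong_AE_imp[where g = "\<lambda>x. (f x)\<^sup>2"])

lemma sq_int_bound:
  assumes "sq_int M f" "g \<in> borel_measurable M" "AE x in M. \<bar>g x\<bar> \<le> \<bar>f x\<bar>"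
  shows "sq_int M g"
  unfolding sq_int_def
proof
  show "integrable M (\<lambda>x. (g x)\<^sup>2)"
  proof (rule Bochner_Integration.integrable_bound)
    show "integrable M (\<lambda>x. (f x)\<^sup>2)" using assms by (simp add: sq_int_def)
    show "(\<lambda>x. (g x)\<^sup>2) \<in> borel_measurable M" using assms by simp
    show "AE x in M. norm ((g x)\<^sup>2) \<le> norm ((f x)\<^sup>2)"
      using assms(3) by eventually_elim (simp add: abs_le_square_iff)
  qed
qed (fact assms)

lemma sq_int_cmult:
  assumes "sq_int M f" shows "sq_int M (\<lambda>x. k * f x)"
  using assms unfolding sq_int_def power_mult_distrib by (auto intro: borel_measurable_times)

lemma sq_int_zero [simp]: "sq_int M (\<lambda>x. 0)"
  by (simp add: sq_int_def)

lemma sq_int_add: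
  assumes "sq_int M f" "sq_int M g" shows "sq_int M (\<lambda>x. f x + g x)"
proof -
  have "integrable M (\<lambda>x. (f x)\<^sup>2 + (g x)\<^sup>2 + 2 * (f x * g x))"
    using assms sq_int_mult[OF assms]
    by (auto intro!: Bochner_Integration.integrable_add intro: sq_int_integrable)
  then have "integrable M (\<lambda>x. (f x + g x)\<^sup>2)"
    by (simp add: power2_sum mult.assoc)
  then show ?thesis using assms unfolding sq_int_def by (auto intro: borel_measurable_add)
qed

lemma sq_int_diff:
  assumes "sq_int M f" "sq_int M g" shows "sq_int M (\<lambda>x. f x - g x)"
  using sq_int_add[OF assms(1) sq_int_cmult[OF assms(2), of "-1"]] by simp

lemma sq_int_sum:
  assumes "\<And>i. i \<in> I \<Longrightarrow> sq_int M (f i)" shows "sq_int M (\<lambda>x. \<Sum>i\<in>I. f i x)"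
  using assms by (induction I rule: infinite_finite_induct) (auto intro: sq_int_add)

lemma sq_int_mult_bounded:
  assumes "sq_int M f" "h \<in> borel_measurable M" "AE x in M. \<bar>h x\<bar> \<le> K"
  shows "sq_int M (\<lambda>x. h x * f x)"
proof (rule sq_int_bound[OF sq_int_cmult[OF assms(1), of K]])
  show "(\<lambda>x. h x * f x) \<in> borel_measurable M" using assms by (auto simp: sq_int_def)
  show "AE x in M. \<bar>h x * f x\<bar> \<le> \<bar>K * f x\<bar>"
    using assms(3) by eventually_elim (auto simp: abs_mult intro!: mult_right_mono)
qed

lemma (in finite_measure) sq_int_bounded:
  assumes "f \<in> borel_measurable M" "AE x in M. \<bar>f x\<bar> \<le> K"
  shows "sq_int M f"
  using sq_int_mult_bounded[of M "\<lambda>x. 1" f K] assms by (simp add: sq_int_def)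

lemma (in finite_measure) sq_int_imp_integrable:
  assumes "sq_int M f" shows "integrable M f"
  using sq_int_mult[OF assms sq_int_bounded[of "\<lambda>x. 1" 1]] by simp

text \<open>For B > 0 insert the minimizer t = - P / B. For B = 0 the expression is affine in t, and
  at t = - (A + 1) / (2 * P) it would be -1. The degenerate case is included because the lemma
  serves the Cauchy-Schwarz inequality, where g may vanish almost everywhere, and later bounds the
  pairing of a nearly minimal element with an arbitrary variation.\<close>

lemma quadratic_nonneg_discriminant:
  fixes A B P :: real
  assumes Q: "\<And>t. 0 \<le> A + 2 * t * P + t\<^sup>2 * B" and "0 \<le> A" "0 \<le> B"
  shows "P\<^sup>2 \<le> A * B"
proof (cases "B = 0")
  case True
  have "P = 0"
  proof (rule ccontr)
    assume "P \<noteq> 0"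
    then show False using Q[of "- (A + 1) / (2 * P)"] True \<open>A \<ge> 0\<close>
      by (simp add: field_simps)
  qed
  then show ?thesis using True by simp
next
  case False
  then have "0 < B" using \<open>B \<ge> 0\<close> by simp
  then show ?thesis using Q[of "- P / B"]
    by (simp add: field_simps power2_eq_square)
qed

lemma LINT_Cauchy_Schwarz:
  assumes "sq_int M f" "sq_int M g"
  shows "\<bar>LINT x|M. f x * g x\<bar> \<le> nrm2 M f * nrm2 M g"
proof -
  define A B P where "A = (LINT x|M. (f x)\<^sup>2)" and "B = (LINT x|M. (g x)\<^sup>2)"
    and "P = (LINT x|M. f x * g x)"
  have I: "integrable M (\<lambda>x. (f x)\<^sup>2)" "integrable M (\<lambda>x. (g x)\<^sup>2)"
    "integrable M (\<lambda>x. f x * g x)"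
    using assms sq_int_mult[OF assms] by (auto intro: sq_int_integrable)
  have "0 \<le> A" "0 \<le> B" by (auto simp: A_def B_def)
  have Q: "0 \<le> A + 2 * t * P + t\<^sup>2 * B" for t
  proof -
    have "0 \<le> (LINT x|M. (f x + t * g x)\<^sup>2)" by simp
    also have "\<dots> = (LINT x|M. (f x)\<^sup>2 + (2 * t) * (f x * g x) + t\<^sup>2 * (g x)\<^sup>2)"
      by (simp add: power2_sum power_mult_distrib algebra_simps)
    also have "\<dots> = A + 2 * t * P + t\<^sup>2 * B"
      using I by (simp add: A_def B_def P_def)
    finally show ?thesis .
  qed
  have "P\<^sup>2 \<le> A * B"
    by (rule quadratic_nonneg_discriminant[OF Q \<open>0 \<le> A\<close> \<open>0 \<le> B\<close>])
  then have "\<bar>P\<bar> \<le> sqrt (A * B)"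
    using real_le_rsqrt[of "\<bar>P\<bar>" "A * B"] by simp
  then show ?thesis by (simp add: P_def A_def B_def nrm2_def real_sqrt_mult)
qed

lemma nrm2_triangle:
  assumes "sq_int M f" "sq_int M g"
  shows "nrm2 M (\<lambda>x. f x + g x) \<le> nrm2 M f + nrm2 M g"
proof (rule power2_le_imp_le)
  have I: "integrable M (\<lambda>x. (f x)\<^sup>2)" "integrable M (\<lambda>x. (g x)\<^sup>2)"
    "integrable M (\<lambda>x. f x * g x)"
    using assms sq_int_mult[OF assms] by (auto intro: sq_int_integrable)
  have "(nrm2 M (\<lambda>x. f x + g x))\<^sup>2 = (LINT x|M. (f x)\<^sup>2 + (g x)\<^sup>2 + 2 * (f x * g x))"
    by (simp add: nrm2_sq power2_sum mult.assoc)
  also have "\<dots> = (nrm2 M f)\<^sup>2 + (nrm2 M g)\<^sup>2 + 2 * (LINT x|M. f x * g x)"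
    using I by (simp add: nrm2_sq)
  also have "\<dots> \<le> (nrm2 M f)\<^sup>2 + (nrm2 M g)\<^sup>2 + 2 * (nrm2 M f * nrm2 M g)"
    using LINT_Cauchy_Schwarz[OF assms] by simp
  also have "\<dots> = (nrm2 M f + nrm2 M g)\<^sup>2" by (simp add: power2_sum)
  finally show "(nrm2 M (\<lambda>x. f x + g x))\<^sup>2 \<le> (nrm2 M f + nrm2 M g)\<^sup>2" .
qed simp

lemma nrm2_cmult: "nrm2 M (\<lambda>x. k * f x) = \<bar>k\<bar> * nrm2 M f"
  by (simp add: nrm2_def power_mult_distrib real_sqrt_mult)

lemma nrm2_minus [simp]: "nrm2 M (\<lambda>x. - f x) = nrm2 M f"
  by (simp add: nrm2_def)

lemma nrm2_mono_AE:
  assumes "sq_int M f" "sq_int M g" "AE x in M. \<bar>f x\<bar> \<le> \<bar>g x\<bar>"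
  shows "nrm2 M f \<le> nrm2 M g"
  unfolding nrm2_def real_sqrt_le_iff
proof (rule integral_mono_AE)
  show "AE x in M. (f x)\<^sup>2 \<le> (g x)\<^sup>2"
    using assms(3) by eventually_elim (simp add: abs_le_square_iff)
qed (use assms in \<open>auto intro: sq_int_integrable\<close>)

lemma (in finite_measure) nrm2_bounded:
  assumes "f \<in> borel_measurable M" "AE x in M. \<bar>f x\<bar> \<le> K" "0 \<le> K"
  shows "nrm2 M f \<le> K * sqrt (measure M (space M))"
proof -
  have "nrm2 M f \<le> nrm2 M (\<lambda>x. K)"
    using assms by (intro nrm2_mono_AE sq_int_bounded[where K = K]) auto
  also have "\<dots> = K * sqrt (measure M (space M))"
    using assms by (simp add: nrm2_def real_sqrt_mult mult.commute)
  finally show ?thesis .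
qed

lemma nrm2_eq_0_imp:
  assumes "sq_int M f" "nrm2 M f = 0" shows "AE x in M. f x = 0"
  using integral_nonneg_eq_0_iff_AE[OF sq_int_integrable[OF assms(1)]] assms(2)
  by (simp add: nrm2_def)

lemma (in finite_measure) integral_abs_le_nrm2:
  assumes "sq_int M f"
  shows "(LINT x|M. \<bar>f x\<bar>) \<le> nrm2 M f * sqrt (measure M (space M))"
proof -
  have a: "sq_int M (\<lambda>x. \<bar>f x\<bar>)" using assms by (auto simp: sq_int_def)
  have "(LINT x|M. \<bar>f x\<bar> * 1) \<le> nrm2 M (\<lambda>x. \<bar>f x\<bar>) * nrm2 M (\<lambda>x. 1)"
    using LINT_Cauchy_Schwarz[OF a sq_int_bounded[of "\<lambda>x. 1" 1]] by simp
  then show ?thesis by (simp add: nrm2_def)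
qed

text \<open>Riesz--Fischer: a subsequence with summable increments converges almost everywhere, and its
  limit is the limit in \<open>L\<^sub>2\<close> by Fatou's lemma.\<close>

lemma (in finite_measure) sq_int_complete:
  fixes f :: "nat \<Rightarrow> 'a \<Rightarrow> real"
  assumes f: "\<And>n. sq_int M (f n)"
    and Cauchy: "\<And>e. e > 0 \<Longrightarrow> \<exists>N. \<forall>k\<ge>N. \<forall>n\<ge>N. nrm2 M (\<lambda>x. f k x - f n x) < e"
  obtains g where "sq_int M g" "(\<lambda>n. nrm2 M (\<lambda>x. f n x - g x)) \<longlonglongrightarrow> 0"
proof -
  have "\<exists>N. \<forall>k\<ge>N. \<forall>n\<ge>N. nrm2 M (\<lambda>x. f k x - f n x) < (1/2)^i" for i
    using Cauchy[of "(1/2)^i"] by simp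
  then obtain N where N: "\<And>i k n. k \<ge> N i \<Longrightarrow> n \<ge> N i \<Longrightarrow> nrm2 M (\<lambda>x. f k x - f n x) < (1/2)^i"
    by metis
  \<comment> \<open>The sum makes \<open>r\<close> increase and dominate \<open>N\<close>; the extra
    summand \<open>i\<close> makes it tend to infinity, so that \<open>r i\<close> eventually
    exceeds any K in the Fatou argument below.\<close>
  define r where "r i = (\<Sum>k\<le>i. N k) + i" for i
  have rN: "r i \<ge> N i" for i
    unfolding r_def by (meson atMost_iff finite_atMost le_add1 le_trans member_le_sum order_refl zero_le)
  have rmono: "r i \<le> r (Suc i)" for i by (simp add: r_def)
  have r_ge: "r i \<ge> i" for i by (simp add: r_def)
  define d where "d i x = f (r (Suc i)) x - f (r i) x" for i x
  have d: "sq_int M (d i)" for i unfolding d_def by (intro sq_int_diff f)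
  have dn: "nrm2 M (d i) < (1/2)^i" for i
    unfolding d_def using rN[of i] rmono[of i] by (intro N) auto
  \<comment> \<open>Finiteness of the measure turns the L2 bound of the increments into an L1 bound.
    The sum of these bounds is finite, so the increments are absolutely summable almost
    everywhere.\<close>
  have dL1: "(LINT x|M. \<bar>d i x\<bar>) \<le> (1/2)^i * sqrt (measure M (space M))" for i
    using integral_abs_le_nrm2[OF d[of i]] dn[of i]
    by (smt (verit) mult_right_mono real_sqrt_ge_0_iff measure_nonneg)
  have [measurable]: "d i \<in> borel_measurable M" "f i \<in> borel_measurable M" for i
    using d f by (auto simp: sq_int_def)
  have di: "integrable M (d i)" for i by (rule sq_int_imp_integrable[OF d])
  have "(\<integral>\<^sup>+x. (\<Sum>i. ennreal \<bar>d i x\<bar>) \<partial>M) = (\<Sum>i. \<integral>\<^sup>+x. ennreal \<bar>d i x\<bar> \<partial>M)"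
    by (rule nn_integral_suminf) measurable
  also have "\<dots> = (\<Sum>i. ennreal (LINT x|M. \<bar>d i x\<bar>))"
    using di by (simp add: nn_integral_eq_integral)
  also have "\<dots> \<le> (\<Sum>i. ennreal ((1/2)^i * sqrt (measure M (space M))))"
    by (intro suminf_le ennreal_leI dL1) auto
  also have "\<dots> < \<infinity>"
    by (subst suminf_ennreal2)
      (auto intro!: summable_mult2 summable_geometric)
  finally have "AE x in M. (\<Sum>i. ennreal \<bar>d i x\<bar>) \<noteq> \<infinity>"
    by (intro nn_integral_PInf_AE) auto
  then have conv: "AE x in M. convergent (\<lambda>i. f (r i) x)"
  proof eventually_elim
    case (elim x)
    then have "summable (\<lambda>i. \<bar>d i x\<bar>)"
      by (intro summable_suminf_not_top) auto
    then have "summable (\<lambda>i. d i x)" by (rule summable_rabs_cancel)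
    then have "summable (\<lambda>i. f (r (Suc i)) x - f (r i) x)" by (simp add: d_def)
    then have "convergent (\<lambda>n. \<Sum>i<n. f (r (Suc i)) x - f (r i) x)"
      by (simp add: summable_iff_convergent)
    then have "convergent (\<lambda>n. f (r n) x - f (r 0) x)"
      by (simp add: sum_lessThan_telescope[of "\<lambda>i. f (r i) x"])
    then show ?case by (simp add: convergent_diff_const_right_iff)
  qed
  define g where "g x = lim (\<lambda>i. f (r i) x)" for x
  have gm [measurable]: "g \<in> borel_measurable M"
    unfolding g_def by (rule borel_measurable_lim_metric) measurable
  have lim: "AE x in M. (\<lambda>i. f (r i) x) \<longlonglongrightarrow> g x"
    using conv by eventually_elim (simp add: g_def convergent_LIMSEQ_iff)
  \<comment> \<open>Fatou in the index of the subsequence, with \<open>n\<close> kept fixed: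
    closeness of \<open>f n\<close> to all late terms becomes closeness to \<open>g\<close>. It
    yields integrability as well, so that \<open>g\<close> is recovered below as
    \<open>f N1 - (f N1 - g)\<close>.\<close>
  have bound: "integrable M (\<lambda>x. (f n x - g x)\<^sup>2) \<and> nrm2 M (\<lambda>x. f n x - g x) \<le> e"
    if e: "e > 0" and K: "\<And>k. k \<ge> K \<Longrightarrow> nrm2 M (\<lambda>x. f n x - f k x) < e" for n e K
  proof -
    have "(\<integral>\<^sup>+x. ennreal ((f n x - g x)\<^sup>2) \<partial>M)
        = (\<integral>\<^sup>+x. liminf (\<lambda>i. ennreal ((f n x - f (r i) x)\<^sup>2)) \<partial>M)"
    proof (rule nn_integral_cong_AE, use lim in eventually_elim)
      case (elim x)
      then have "(\<lambda>i. ennreal ((f n x - f (r i) x)\<^sup>2)) \<longlonglongrightarrow> ennreal ((f n x - g x)\<^sup>2)"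
        by (intro tendsto_intros)
      then show ?case by (intro lim_imp_Liminf[symmetric]) auto
    qed
    also have "\<dots> \<le> liminf (\<lambda>i. \<integral>\<^sup>+x. ennreal ((f n x - f (r i) x)\<^sup>2) \<partial>M)"
      by (intro nn_integral_liminf) measurable
    also have "\<dots> \<le> ennreal (e\<^sup>2)"
    proof (rule Liminf_le)
      show "\<forall>\<^sub>F i in sequentially. (\<integral>\<^sup>+x. ennreal ((f n x - f (r i) x)\<^sup>2) \<partial>M) \<le> ennreal (e\<^sup>2)"
        using eventually_ge_at_top[of K]
      proof eventually_elim
        case (elim i)
        then have "nrm2 M (\<lambda>x. f n x - f (r i) x) < e" using K[of "r i"] r_ge[of i] by simp
        then have "(nrm2 M (\<lambda>x. f n x - f (r i) x))\<^sup>2 \<le> e\<^sup>2"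
          by (intro power_mono) auto
        then show ?case
          by (subst nn_integral_eq_integral)
            (auto intro!: ennreal_leI sq_int_integrable sq_int_diff f simp: nrm2_sq)
      qed
    qed auto
    finally have le: "(\<integral>\<^sup>+x. ennreal ((f n x - g x)\<^sup>2) \<partial>M) \<le> ennreal (e\<^sup>2)" .
    then have int: "integrable M (\<lambda>x. (f n x - g x)\<^sup>2)"
      by (intro integrableI_bounded) (auto simp: le_less_trans)
    have "ennreal (LINT x|M. (f n x - g x)\<^sup>2) \<le> ennreal (e\<^sup>2)"
      using le by (subst (asm) nn_integral_eq_integral[OF int]) auto
    then have "(LINT x|M. (f n x - g x)\<^sup>2) \<le> e\<^sup>2" by simp
    then have "nrm2 M (\<lambda>x. f n x - g x) \<le> sqrt (e\<^sup>2)"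
      unfolding nrm2_def by (rule real_sqrt_le_mono)
    then show ?thesis using int e by simp
  qed
  obtain N1 where N1: "\<And>k n. k \<ge> N1 \<Longrightarrow> n \<ge> N1 \<Longrightarrow> nrm2 M (\<lambda>x. f k x - f n x) < 1"
    using Cauchy[of 1] by auto
  have "sq_int M (\<lambda>x. f N1 x - g x)"
    using bound[of 1 N1 N1] N1 by (auto simp: sq_int_def)
  from sq_int_diff[OF f[of N1] this] have "sq_int M (\<lambda>x. f N1 x - (f N1 x - g x))" .
  then have "sq_int M g" by simp
  moreover have "(\<lambda>n. nrm2 M (\<lambda>x. f n x - g x)) \<longlonglongrightarrow> 0"
  proof (rule LIMSEQ_I)
    fix e :: real assume e: "e > 0"
    then obtain N2 where N2: "\<And>k n. k \<ge> N2 \<Longrightarrow> n \<ge> N2 \<Longrightarrow> nrm2 M (\<lambda>x. f k x - f n x) < e / 2"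
      using Cauchy[of "e/2"] by auto
    have "nrm2 M (\<lambda>x. f n x - g x) \<le> e / 2" if "n \<ge> N2" for n
      using bound[of "e/2" N2 n] N2 that e by auto
    then show "\<exists>no. \<forall>n\<ge>no. norm (nrm2 M (\<lambda>x. f n x - g x) - 0) < e"
      using e by (intro exI[of _ N2]) force
  qed
  ultimately show thesis by (rule that)
qed

section \<open>Functions on an interval\<close>

abbreviation leb :: "real \<Rightarrow> real \<Rightarrow> real measure" where
  "leb a b \<equiv> lebesgue_on {a<..<b}"

lemma finite_measure_leb: "finite_measure (leb a b)"
  by (intro finite_measure_lebesgue_on) (auto intro: bounded_set_imp_lmeasurable)

interpretation leb: finite_measure "leb a b" for a b
  by (rule finite_measure_leb)

lemma measure_leb: "a \<le> b \<Longrightarrow> measure (leb a b) {a<..<b} = b - a"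
  by (simp add: measure_restrict_space)

lemma AE_leb_iff: "(AE t in leb a b. P t) \<longleftrightarrow> (AE t in lebesgue. t \<in> {a<..<b} \<longrightarrow> P t)"
  by (rule AE_restrict_space_iff) simp

lemma AE_leb_I: "(\<And>t. a < t \<Longrightarrow> t < b \<Longrightarrow> P t) \<Longrightarrow> AE t in leb a b. P t"
  by (rule AE_I2) simp

lemma AE_leb_mono: "AE t in leb a b. P t \<Longrightarrow> a \<le> p \<Longrightarrow> r \<le> b \<Longrightarrow> AE t in leb p r. P t"
  unfolding AE_leb_iff by (erule eventually_mono) auto

lemma integrable_leb_mono:
  fixes f :: "real \<Rightarrow> real"
  assumes "integrable (leb a b) f" "a \<le> p" "r \<le> b"
  shows "integrable (leb p r) f"
proof -
  have "set_integrable lebesgue {a<..<b} f"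
    using assms by (simp add: set_integrable_def integrable_restrict_space)
  then have "set_integrable lebesgue {p<..<r} f"
    by (rule set_integrable_subset) (use assms in auto)
  then show ?thesis by (simp add: set_integrable_def integrable_restrict_space)
qed

lemma measurable_leb_mono:
  assumes "f \<in> borel_measurable (leb a b)" "a \<le> p" "r \<le> b"
  shows "f \<in> borel_measurable (leb p r)"
  using assms by (auto intro: measurable_restrict_mono)

lemma sq_int_leb_mono:
  assumes "sq_int (leb a b) f" "a \<le> p" "r \<le> b"
  shows "sq_int (leb p r) f"
  using assms unfolding sq_int_def
  by (auto intro: measurable_leb_mono[of f a b] integrable_leb_mono[of a b])

text \<open>The common point b lies in neither interval. Its value is put in by hand, so that the
  function assembled from the two zero extensions equals f at every point of (a, c) and plain
  congruence applies.\<close>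

lemma measurable_leb_glue:
  fixes f :: "real \<Rightarrow> real"
  assumes "f \<in> borel_measurable (leb a b)" "f \<in> borel_measurable (leb b c)"
  shows "f \<in> borel_measurable (leb a c)"
proof -
  let ?E = "\<lambda>a b t. if t \<in> {a<..<b} then f t else 0 :: real"
  have 1: "?E a b \<in> borel_measurable lebesgue" "?E b c \<in> borel_measurable lebesgue"
    using assms by (simp_all add: borel_measurable_if del: greaterThanLessThan_iff)
  have "(\<lambda>t. if t \<le> b then if t < b then ?E a b t else f b else ?E b c t) \<in> borel_measurable lebesgue"
    by (intro measurable_If 1) (auto intro: borel_measurable_AE)
  then have "(\<lambda>t. if t \<le> b then if t < b then ?E a b t else f b else ?E b c t) \<in> borel_measurable (leb a c)"
    by (rule measurable_restrict_space1)
  then show ?thesis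
    by (rule measurable_lebesgue_cong[THEN iffD1, rotated]) auto
qed

lemma integrable_leb_glue:
  fixes f :: "real \<Rightarrow> real"
  assumes "integrable (leb a b) f" "integrable (leb b c) f" "a \<le> b" "b \<le> c"
  shows "integrable (leb a c) f" "(LINT t|leb a c. f t) = (LINT t|leb a b. f t) + (LINT t|leb b c. f t)"
proof -
  have m: "f \<in> borel_measurable (leb a c)"
    by (rule measurable_leb_glue) (use assms in auto)
  let ?f = "\<lambda>S x. indicator S x *\<^sub>R f x"
  have 1: "integrable lebesgue (?f {a<..<b})" "integrable lebesgue (?f {b<..<c})"
    using assms by (simp_all add: integrable_restrict_space)
  have eq: "AE x in lebesgue. ?f {a<..<b} x + ?f {b<..<c} x = ?f {a<..<c} x"
  proof -
    have "AE t in lebesgue. t \<notin> {b}" by (rule AE_not_in) auto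
    then show ?thesis
      by eventually_elim (use assms in \<open>auto simp: indicator_def\<close>)
  qed
  have m2: "?f {a<..<c} \<in> borel_measurable lebesgue"
    using m by (subst (asm) borel_measurable_restrict_space_iff) auto
  have 2: "integrable lebesgue (?f {a<..<c})"
    by (rule integrable_cong_AE_imp[OF Bochner_Integration.integrable_add[OF 1] m2])
      (use eq in \<open>eventually_elim, simp\<close>)
  then show "integrable (leb a c) f"
    by (simp add: integrable_restrict_space)
  have "(LINT x|lebesgue. ?f {a<..<c} x) = (LINT x|lebesgue. ?f {a<..<b} x + ?f {b<..<c} x)"
    by (rule integral_cong_AE) (use m2 1 eq in \<open>auto elim: eventually_mono\<close>)
  also have "\<dots> = (LINT x|lebesgue. ?f {a<..<b} x) + (LINT x|lebesgue. ?f {b<..<c} x)"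
    by (rule Bochner_Integration.integral_add[OF 1])
  finally show "(LINT t|leb a c. f t) = (LINT t|leb a b. f t) + (LINT t|leb b c. f t)"
    by (simp add: integral_restrict_space)
qed

lemma integral_leb_split:
  fixes f :: "real \<Rightarrow> real"
  assumes "integrable (leb a c) f" "a \<le> b" "b \<le> c"
  shows "(LINT t|leb a c. f t) = (LINT t|leb a b. f t) + (LINT t|leb b c. f t)"
  by (rule integrable_leb_glue) (use assms in \<open>auto intro: integrable_leb_mono\<close>)

lemma sq_int_leb_glue:
  assumes "sq_int (leb a b) f" "sq_int (leb b c) f" "a \<le> b" "b \<le> c"
  shows "sq_int (leb a c) f"
  using assms unfolding sq_int_def by (auto intro: measurable_leb_glue integrable_leb_glue)

lemma leb_cong:
  assumes "\<And>t. a < t \<Longrightarrow> t < b \<Longrightarrow> f t = g t"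
  shows "f \<in> borel_measurable (leb a b) \<longleftrightarrow> g \<in> borel_measurable (leb a b)"
    and "integrable (leb a b) f \<longleftrightarrow> integrable (leb a b) g"
    and "integral\<^sup>L (leb a b) f = integral\<^sup>L (leb a b) (g :: real \<Rightarrow> real)"
  using assms by (auto intro!: measurable_lebesgue_cong Bochner_Integration.integrable_cong
      Bochner_Integration.integral_cong)

lemma sq_int_leb_cong:
  assumes "\<And>t. a < t \<Longrightarrow> t < b \<Longrightarrow> f t = g t"
  shows "sq_int (leb a b) f \<longleftrightarrow> sq_int (leb a b) g"
  unfolding sq_int_def using leb_cong[of a b f g] leb_cong[of a b "\<lambda>t. (f t)\<^sup>2" "\<lambda>t. (g t)\<^sup>2"] assms
  by simp

lemma continuous_measurable_leb:
  "continuous_on {a..b} f \<Longrightarrow> f \<in> borel_measurable (leb a b)"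
  by (rule continuous_imp_measurable_on_sets_lebesgue)
    (auto intro: continuous_on_subset[OF _ greaterThanLessThan_subseteq_atLeastAtMost_iff[THEN iffD2]])

lemma continuous_bounded_leb:
  fixes f :: "real \<Rightarrow> real"
  assumes "continuous_on {a..b} f"
  obtains K where "\<forall>t\<in>{a..b}. \<bar>f t\<bar> \<le> K"
proof -
  have "bounded (f ` {a..b})"
    using assms by (intro compact_imp_bounded compact_continuous_image) auto
  then show thesis using that by (auto simp: bounded_iff)
qed

lemma continuous_sq_int_leb:
  assumes "continuous_on {a..b} f" shows "sq_int (leb a b) f"
proof -
  obtain K where "\<forall>t\<in>{a..b}. \<bar>f t\<bar> \<le> K"
    using continuous_bounded_leb[OF assms] .
  then show ?thesis
    by (intro leb.sq_int_bounded[where K = K] continuous_measurable_leb assms AE_leb_I) auto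
qed

lemma continuous_integrable_leb:
  "continuous_on {a..b} f \<Longrightarrow> integrable (leb a b) f" for f :: "real \<Rightarrow> real"
  by (rule leb.sq_int_imp_integrable[OF continuous_sq_int_leb])

lemma leb_eq_integral:
  fixes f :: "real \<Rightarrow> real"
  assumes "integrable (leb a b) f"
  shows "(LINT t|leb a b. f t) = integral {a..b} f"
  using lebesgue_integral_eq_integral[OF assms] by (simp add: integral_open_interval_real)

lemma leb_FTC:
  fixes F :: "real \<Rightarrow> real"
  assumes "a \<le> b" "\<And>t. t \<in> {a..b} \<Longrightarrow> (F has_real_derivative f t) (at t within {a..b})"
    and "continuous_on {a..b} f"
  shows "(LINT t|leb a b. f t) = F b - F a"
proof -
  have "(f has_integral (F b - F a)) {a..b}"
    by (rule fundamental_theorem_of_calculus)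
      (use assms in \<open>auto simp: has_real_derivative_iff_has_vector_derivative\<close>)
  then show ?thesis
    using leb_eq_integral[OF continuous_integrable_leb[OF assms(3)]] by (simp add: integral_unique)
qed

lemma continuous_on_leb_integral:
  fixes f :: "real \<Rightarrow> real"
  assumes "integrable (leb a b) f"
  shows "continuous_on {a..b} (\<lambda>x. LINT t|leb a x. f t)"
proof -
  have "f integrable_on {a<..<b}"
    using assms by (intro integrable_on_lebesgue_on) auto
  then have "f integrable_on {a..b}"
    by (simp add: integrable_on_Icc_iff_Ioo)
  then have "continuous_on {a..b} (\<lambda>x. integral {a..x} f)"
    by (rule indefinite_integral_continuous_1)
  then show ?thesis
    by (rule continuous_on_eq) (use assms in \<open>auto intro!: leb_eq_integral[symmetric] intro: integrable_leb_mono\<close>)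
qed

subsection \<open>Affine substitutions\<close>

lemma affine_measurable_leb:
  assumes "c > 0"
  shows "(\<lambda>s. c * s + d) \<in> leb p r \<rightarrow>\<^sub>M leb (c * p + d) (c * r + d)"
proof (rule measurable_restrict_space3)
  show "(\<lambda>s. c * s + d) \<in> lebesgue \<rightarrow>\<^sub>M lebesgue"
    using lebesgue_affine_measurable[of "\<lambda>_. c" d] assms by (simp add: add.commute)
qed (use assms in auto)

text \<open>Stated as an identity of measures: integrability and the value of the integral then
  follow together from the rules for \<open>density\<close> and \<open>distr\<close>. The scaling
  formula of Lebesgue measure restricts to intervals because the preimage of a subset of the image
  interval lies in (p, r).\<close>

lemma leb_affine:
  assumes c: "c > 0"
  shows "leb (c * p + d) (c * r + d) =
    density (distr (leb p r) (leb (c * p + d) (c * r + d)) (\<lambda>s. c * s + d)) (\<lambda>_. ennreal c)"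
proof (rule measure_eqI)
  let ?g = "\<lambda>s. c * s + d"
  fix A assume A: "A \<in> sets (leb (c * p + d) (c * r + d))"
  then have A': "A \<in> sets lebesgue" "A \<subseteq> {c * p + d<..<c * r + d}"
    by (auto simp: sets_restrict_space)
  have m: "?g \<in> lebesgue \<rightarrow>\<^sub>M lebesgue"
    using lebesgue_affine_measurable[of "\<lambda>_. c" d] assms by (simp add: add.commute)
  have sub: "?g -` A \<subseteq> {p<..<r}"
    using A'(2) c by auto
  have "emeasure (leb (c * p + d) (c * r + d)) A = emeasure lebesgue A"
    using A' by (intro emeasure_restrict_space) auto
  also have "\<dots> = emeasure (density (distr lebesgue lebesgue ?g) (\<lambda>_. ennreal c)) A"
    using lebesgue_real_affine[of c d] c by (simp add: add.commute)
  also have "\<dots> = c * emeasure lebesgue (?g -` A)"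
    using A' m by (simp add: emeasure_density_const emeasure_distr)
  also have "emeasure lebesgue (?g -` A) = emeasure (leb p r) (?g -` A)"
    using sub by (intro emeasure_restrict_space[symmetric]) auto
  also have "?g -` A = ?g -` A \<inter> space (leb p r)"
    using sub by auto
  also have "emeasure (leb p r) \<dots> = emeasure (distr (leb p r) (leb (c * p + d) (c * r + d)) ?g) A"
    using A by (intro emeasure_distr[symmetric] affine_measurable_leb c)
  also have "ennreal c * \<dots>
      = emeasure (density (distr (leb p r) (leb (c * p + d) (c * r + d)) ?g) (\<lambda>_. ennreal c)) A"
    using A by (simp add: emeasure_density_const)
  finally show "emeasure (leb (c * p + d) (c * r + d)) A = \<dots>" .
qed simp

lemma leb_affine_subst:
  fixes f :: "real \<Rightarrow> real"
  assumes c: "c > 0" and f: "f \<in> borel_measurable (leb (c * p + d) (c * r + d))"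
  shows "(\<lambda>s. f (c * s + d)) \<in> borel_measurable (leb p r)"
    and "integrable (leb (c * p + d) (c * r + d)) f \<longleftrightarrow> integrable (leb p r) (\<lambda>s. f (c * s + d))"
    and "(LINT t|leb (c * p + d) (c * r + d). f t) = c * (LINT s|leb p r. f (c * s + d))"
proof -
  let ?D = "distr (leb p r) (leb (c * p + d) (c * r + d)) (\<lambda>s. c * s + d)"
  note m = affine_measurable_leb[OF c, of d p r]
  show "(\<lambda>s. f (c * s + d)) \<in> borel_measurable (leb p r)"
    by (rule measurable_compose[OF m f])
  have fD: "f \<in> borel_measurable ?D" using f by simp
  have "integrable (leb (c * p + d) (c * r + d)) f \<longleftrightarrow> integrable ?D (\<lambda>t. c *\<^sub>R f t)"
    by (subst leb_affine[OF c]) (use c fD in \<open>simp add: integrable_density\<close>)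
  also have "\<dots> \<longleftrightarrow> integrable ?D f" using c by simp
  also have "\<dots> \<longleftrightarrow> integrable (leb p r) (\<lambda>s. f (c * s + d))"
    by (rule integrable_distr_eq[OF m f])
  finally show "integrable (leb (c * p + d) (c * r + d)) f \<longleftrightarrow> integrable (leb p r) (\<lambda>s. f (c * s + d))" .
  have "(LINT t|leb (c * p + d) (c * r + d). f t) = (LINT t|?D. c *\<^sub>R f t)"
    by (subst leb_affine[OF c]) (use c fD in \<open>simp add: integral_density\<close>)
  also have "\<dots> = c * (LINT t|?D. f t)" by simp
  also have "(LINT t|?D. f t) = (LINT s|leb p r. f (c * s + d))"
    by (rule integral_distr[OF m f])
  finally show "(LINT t|leb (c * p + d) (c * r + d). f t) = c * (LINT s|leb p r. f (c * s + d))" .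
qed

lemma sq_int_leb_affine:
  assumes c: "c > 0" and f: "sq_int (leb (c * p + d) (c * r + d)) f"
  shows "sq_int (leb p r) (\<lambda>s. f (c * s + d))"
  using leb_affine_subst(1)[OF c, of f p d r] leb_affine_subst(2)[OF c, of "\<lambda>t. (f t)\<^sup>2" p d r] f
  by (auto simp: sq_int_def)

section \<open>Absolutely continuous functions with square integrable derivative\<close>

text \<open>The integral formula describes the continuous representative f of an element of the
  Sobolev space together with any representative g of its derivative. Keeping g as an argument makes
  the relation stable under linear combinations, restriction, shifts and gluing, with no choice of
  representative involved.\<close>

definition ac_deriv :: "real \<Rightarrow> real \<Rightarrow> (real \<Rightarrow> real) \<Rightarrow> (real \<Rightarrow> real) \<Rightarrow> bool" where
  "ac_deriv a b f g \<longleftrightarrow> sq_int (leb a b) g \<and> (\<forall>t\<in>{a..b}. f t - f a = (LINT s|leb a t. g s))"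

lemma ac_deriv_sq_int: "ac_deriv a b f g \<Longrightarrow> sq_int (leb a b) g"
  unfolding ac_deriv_def by (rule conjunct1)

lemma ac_deriv_eq:
  assumes "ac_deriv a b f g" "a \<le> t" "t \<le> b"
  shows "f t = f a + (LINT s|leb a t. g s)"
proof -
  have "f t - f a = (LINT s|leb a t. g s)" using assms unfolding ac_deriv_def by auto
  then show ?thesis by linarith
qed

lemma ac_deriv_integrable: "ac_deriv a b f g \<Longrightarrow> integrable (leb a b) g"
  by (intro leb.sq_int_imp_integrable ac_deriv_sq_int)

lemma ac_deriv_continuous:
  assumes "ac_deriv a b f g" shows "continuous_on {a..b} f"
proof -
  have "continuous_on {a..b} (\<lambda>t. f a + (LINT s|leb a t. g s))"
    by (intro continuous_intros continuous_on_leb_integral ac_deriv_integrable[OF assms])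
  then show ?thesis
    by (rule continuous_on_eq) (auto intro: ac_deriv_eq[OF assms, symmetric])
qed

lemma ac_deriv_sq_int': "ac_deriv a b f g \<Longrightarrow> sq_int (leb a b) f"
  by (intro continuous_sq_int_leb ac_deriv_continuous)

lemma ac_deriv_diff_eq:
  assumes "ac_deriv a b f g" "a \<le> s" "s \<le> t" "t \<le> b"
  shows "f t - f s = (LINT r|leb s t. g r)"
proof -
  have "integrable (leb a t) g"
    using ac_deriv_integrable[OF assms(1)] assms by (auto intro: integrable_leb_mono)
  from integral_leb_split[OF this assms(2,3)]
  show ?thesis using ac_deriv_eq[OF assms(1), of t] ac_deriv_eq[OF assms(1), of s] assms by simp
qed

lemma ac_derivI:
  assumes "sq_int (leb a b) g" and eq: "\<And>t. a \<le> t \<Longrightarrow> t \<le> b \<Longrightarrow> f t = f a + (LINT s|leb a t. g s)"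
  shows "ac_deriv a b f g"
  unfolding ac_deriv_def
proof (intro conjI ballI assms(1))
  fix t assume "t \<in> {a..b}"
  then show "f t - f a = (LINT s|leb a t. g s)" using eq[of t] by (simp only: atLeastAtMost_iff)
qed

lemma ac_deriv_lincomb:
  assumes "ac_deriv a b f g" "ac_deriv a b h k"
  shows "ac_deriv a b (\<lambda>t. x * f t + y * h t) (\<lambda>t. x * g t + y * k t)"
proof (rule ac_derivI)
  show "sq_int (leb a b) (\<lambda>t. x * g t + y * k t)"
    using assms by (intro sq_int_add sq_int_cmult ac_deriv_sq_int)
  fix t assume t: "a \<le> t" "t \<le> b"
  have "integrable (leb a t) g" "integrable (leb a t) k"
    using assms t by (auto intro!: integrable_leb_mono[OF ac_deriv_integrable])
  then show "x * f t + y * h t = x * f a + y * h a + (LINT s|leb a t. x * g s + y * k s)"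
    using ac_deriv_eq[OF assms(1) t] ac_deriv_eq[OF assms(2) t] by (simp add: algebra_simps)
qed

lemma ac_deriv_cong_AE:
  assumes "ac_deriv a b f g" "h \<in> borel_measurable (leb a b)" "AE t in leb a b. g t = h t"
  shows "ac_deriv a b f h"
proof (rule ac_derivI)
  show "sq_int (leb a b) h" using assms by (auto intro: sq_int_cong_AE ac_deriv_sq_int)
  fix t assume t: "a \<le> t" "t \<le> b"
  have "(LINT s|leb a t. g s) = (LINT s|leb a t. h s)"
  proof (rule integral_cong_AE)
    show "g \<in> borel_measurable (leb a t)" "h \<in> borel_measurable (leb a t)"
      using assms t ac_deriv_sq_int[OF assms(1)]
      by (auto intro: measurable_leb_mono simp: sq_int_def)
    show "AE s in leb a t. g s = h s" using assms(3) t by (auto intro: AE_leb_mono)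
  qed
  then show "f t = f a + (LINT s|leb a t. h s)" using ac_deriv_eq[OF assms(1) t] by simp
qed

lemma ac_deriv_cong:
  assumes "ac_deriv a b f g" "\<And>t. a \<le> t \<Longrightarrow> t \<le> b \<Longrightarrow> f t = h t" "\<And>t. a < t \<Longrightarrow> t < b \<Longrightarrow> g t = k t"
  shows "ac_deriv a b h k"
proof (rule ac_derivI)
  show "sq_int (leb a b) k"
    using ac_deriv_sq_int[OF assms(1)] sq_int_leb_cong[of a b g k, OF assms(3)] by simp
  fix t assume t: "a \<le> t" "t \<le> b"
  have "(LINT s|leb a t. g s) = (LINT s|leb a t. k s)"
    using assms(3) t by (intro leb_cong(3)) auto
  then show "h t = h a + (LINT s|leb a t. k s)"
    using ac_deriv_eq[OF assms(1) t] assms(2)[OF t] assms(2)[of a] t by linarith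
qed

lemma ac_deriv_mono:
  assumes "ac_deriv a b f g" "a \<le> p" "r \<le> b" shows "ac_deriv p r f g"
proof (rule ac_derivI)
  show "sq_int (leb p r) g" using assms by (auto intro: sq_int_leb_mono ac_deriv_sq_int)
  show "f t = f p + (LINT s|leb p t. g s)" if "p \<le> t" "t \<le> r" for t
    using ac_deriv_diff_eq[OF assms(1), of p t] that assms by simp
qed

lemma ac_deriv_glue:
  assumes "ac_deriv a b f g" "ac_deriv b c f g" "a \<le> b" "b \<le> c"
  shows "ac_deriv a c f g"
proof (rule ac_derivI)
  show sq: "sq_int (leb a c) g" using assms by (auto intro: sq_int_leb_glue ac_deriv_sq_int)
  fix t assume t: "a \<le> t" "t \<le> c"
  show "f t = f a + (LINT s|leb a t. g s)"
  proof (cases "t \<le> b")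
    case True then show ?thesis using ac_deriv_eq[OF assms(1), of t] t by simp
  next
    case False
    have "integrable (leb a t) g"
      using t by (intro integrable_leb_mono[OF leb.sq_int_imp_integrable[OF sq]]) auto
    from integral_leb_split[OF this, of b] show ?thesis
      using ac_deriv_eq[OF assms(1), of b] ac_deriv_eq[OF assms(2), of t] t False assms by simp
  qed
qed

lemma ac_deriv_shift:
  assumes "ac_deriv a b f g"
  shows "ac_deriv (a - d) (b - d) (\<lambda>t. f (t + d)) (\<lambda>t. g (t + d))"
proof (rule ac_derivI)
  show "sq_int (leb (a - d) (b - d)) (\<lambda>t. g (t + d))"
    using sq_int_leb_affine[of 1 "a - d" d "b - d" g] ac_deriv_sq_int[OF assms] by simp
  fix t assume t: "a - d \<le> t" "t \<le> b - d"
  have "g \<in> borel_measurable (leb a (t + d))"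
    using ac_deriv_sq_int[OF assms] t by (auto simp: sq_int_def intro: measurable_leb_mono)
  then have "(LINT s|leb a (t + d). g s) = (LINT s|leb (a - d) t. g (s + d))"
    using leb_affine_subst(3)[of 1 g "a - d" d t] by simp
  then show "f (t + d) = f (a - d + d) + (LINT s|leb (a - d) t. g (s + d))"
    using ac_deriv_eq[OF assms, of "t + d"] t by simp
qed

lemma ac_deriv_C1:
  assumes "\<And>t. t \<in> {a..b} \<Longrightarrow> (f has_real_derivative g t) (at t within {a..b})"
    and "continuous_on {a..b} g"
  shows "ac_deriv a b f g"
proof (rule ac_derivI)
  show "sq_int (leb a b) g" by (rule continuous_sq_int_leb[OF assms(2)])
  fix t assume t: "a \<le> t" "t \<le> b"
  have "(LINT s|leb a t. g s) = f t - f a"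
  proof (rule leb_FTC)
    show "(f has_real_derivative g s) (at s within {a..t})" if "s \<in> {a..t}" for s
      using assms(1)[of s] that t by (auto intro: DERIV_subset)
    show "continuous_on {a..t} g" using assms(2) by (rule continuous_on_subset) (use t in auto)
  qed (use t in auto)
  then show "f t = f a + (LINT s|leb a t. g s)" by simp
qed

lemma ac_deriv_zero [simp]: "ac_deriv a b (\<lambda>t. 0) (\<lambda>t. 0)"
  by (simp add: ac_deriv_def)

subsection \<open>Integration by parts\<close>

lemma leb_integral_restrict:
  fixes g :: "real \<Rightarrow> real"
  assumes "a \<le> t" "t \<le> b"
  shows "(LINT s|leb a t. g s) = (LINT s|leb a b. (if s < t then g s else 0))"
proof -
  have "(LINT s|leb a t. g s) = (LINT s|lebesgue. indicator {a<..<t} s *\<^sub>R g s)"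
    by (simp add: integral_restrict_space)
  also have "\<dots> = (LINT s|lebesgue. indicator {a<..<b} s *\<^sub>R (if s < t then g s else 0))"
    using assms by (intro Bochner_Integration.integral_cong) (auto simp: indicator_def)
  finally show ?thesis by (simp add: integral_restrict_space)
qed

lemma leb_integral_restrict':
  fixes g :: "real \<Rightarrow> real"
  assumes "a \<le> t" "t \<le> b"
  shows "(LINT s|leb t b. g s) = (LINT s|leb a b. (if t < s then g s else 0))"
proof -
  have "(LINT s|leb t b. g s) = (LINT s|lebesgue. indicator {t<..<b} s *\<^sub>R g s)"
    by (simp add: integral_restrict_space)
  also have "\<dots> = (LINT s|lebesgue. indicator {a<..<b} s *\<^sub>R (if t < s then g s else 0))"
    using assms by (intro Bochner_Integration.integral_cong) (auto simp: indicator_def)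
  finally show ?thesis by (simp add: integral_restrict_space)
qed

text \<open>Fubini on the triangle \<open>s < t\<close>.\<close>

lemma leb_by_parts:
  fixes g k :: "real \<Rightarrow> real"
  assumes g: "integrable (leb a b) g" and k: "integrable (leb a b) k"
  shows "(LINT t|leb a b. (LINT s|leb a t. g s) * k t) + (LINT s|leb a b. g s * (LINT t|leb a s. k t))
    = (LINT s|leb a b. g s) * (LINT t|leb a b. k t)"
proof -
  let ?M = "leb a b"
  interpret P: pair_sigma_finite ?M ?M
    by (intro pair_sigma_finite.intro finite_measure.axioms(1) finite_measure_leb)
  have [measurable]: "(\<lambda>x. x) \<in> borel_measurable ?M"
    by (intro continuous_measurable_leb continuous_intros)
  have gm [measurable]: "g \<in> borel_measurable ?M" and km [measurable]: "k \<in> borel_measurable ?M"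
    using g k by auto
  have gk: "integrable (?M \<Otimes>\<^sub>M ?M) (\<lambda>z. g (snd z) * k (fst z))"
  proof (rule P.Fubini_integrable)
    show "integrable ?M (\<lambda>x. LINT y|?M. norm (g (snd (x, y)) * k (fst (x, y))))"
      using g k by (simp add: abs_mult)
    show "AE x in ?M. integrable ?M (\<lambda>y. g (snd (x, y)) * k (fst (x, y)))"
      using g by simp
  qed measurable
  let ?f = "\<lambda>t s. (if s < t then g s else 0) * k t"
  have f: "integrable (?M \<Otimes>\<^sub>M ?M) (case_prod ?f)"
  proof (rule Bochner_Integration.integrable_bound[OF gk])
    show "AE z in ?M \<Otimes>\<^sub>M ?M. norm (case_prod ?f z) \<le> norm (g (snd z) * k (fst z))"
      by (rule AE_I2) auto
  qed measurable
  have "(LINT t|?M. (LINT s|leb a t. g s) * k t) = (LINT t|?M. (LINT s|?M. ?f t s))"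
  proof (intro Bochner_Integration.integral_cong refl)
    fix t assume "t \<in> space ?M"
    then have "(LINT s|leb a t. g s) = (LINT s|?M. (if s < t then g s else 0))"
      by (intro leb_integral_restrict) auto
    then show "(LINT s|leb a t. g s) * k t = (LINT s|?M. ?f t s)" by simp
  qed
  also have "\<dots> = (LINT s|?M. (LINT t|?M. ?f t s))"
    by (rule P.Fubini_integral[OF f, symmetric])
  also have "\<dots> = (LINT s|?M. g s * (LINT t|leb s b. k t))"
  proof (rule Bochner_Integration.integral_cong)
    fix s assume "s \<in> space ?M"
    then have s: "a \<le> s" "s \<le> b" by auto
    have "(LINT t|?M. ?f t s) = (LINT t|?M. g s * (if s < t then k t else 0))"
      by (intro Bochner_Integration.integral_cong) auto
    then show "(LINT t|?M. ?f t s) = g s * (LINT t|leb s b. k t)"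
      by (simp add: leb_integral_restrict'[OF s])
  qed simp
  also have "\<dots> = (LINT s|?M. g s * (LINT t|leb a b. k t) - g s * (LINT t|leb a s. k t))"
  proof (intro Bochner_Integration.integral_cong refl)
    fix s assume "s \<in> space ?M"
    then have "(LINT t|leb s b. k t) = (LINT t|leb a b. k t) - (LINT t|leb a s. k t)"
      using integral_leb_split[OF k, of s] by simp
    then show "g s * (LINT t|leb s b. k t) = g s * (LINT t|leb a b. k t) - g s * (LINT t|leb a s. k t)"
      by (simp only: right_diff_distrib)
  qed
  also have "\<dots> = (LINT s|?M. g s * (LINT t|leb a b. k t)) - (LINT s|?M. g s * (LINT t|leb a s. k t))"
  proof (rule Bochner_Integration.integral_diff)
    obtain K where K: "\<forall>t\<in>{a..b}. \<bar>LINT s|leb a t. k s\<bar> \<le> K"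
      using continuous_bounded_leb[OF continuous_on_leb_integral[OF k]] .
    show "integrable ?M (\<lambda>s. g s * (LINT t|leb a s. k t))"
    proof (rule Bochner_Integration.integrable_bound)
      show "integrable ?M (\<lambda>s. K * g s)" using g by simp
      show "(\<lambda>s. g s * (LINT t|leb a s. k t)) \<in> borel_measurable ?M"
        by (intro borel_measurable_times gm continuous_measurable_leb continuous_on_leb_integral k)
      have "norm (g s * (LINT t|leb a s. k t)) \<le> norm (K * g s)" if "a < s" "s < b" for s
        using K that by (auto simp: abs_mult mult.commute[of "\<bar>g s\<bar>"] intro!: mult_right_mono
            intro: order_trans[OF _ abs_ge_self])
      then show "AE s in ?M. norm (g s * (LINT t|leb a s. k t)) \<le> norm (K * g s)"
        by (rule AE_leb_I)
    qed
  qed (use g in simp)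
  finally show ?thesis by simp
qed

text \<open>Write f = f a + G and h = h a + K, where G and K are the primitives vanishing at a, and
  expand. The mixed term in G and K is Fubini on the triangle; the rest integrates directly.\<close>

lemma ac_deriv_by_parts:
  assumes f: "ac_deriv a b f g" and h: "ac_deriv a b h k" and ab: "a \<le> b"
  shows "(LINT t|leb a b. f t * k t) + (LINT t|leb a b. g t * h t) = f b * h b - f a * h a"
proof -
  let ?G = "\<lambda>t. LINT s|leb a t. g s" and ?K = "\<lambda>t. LINT s|leb a t. k s"
  have gi: "integrable (leb a b) g" "integrable (leb a b) k"
    using f h by (auto intro: ac_deriv_integrable)
  have sq: "sq_int (leb a b) ?G" "sq_int (leb a b) ?K"
    using gi by (auto intro!: continuous_sq_int_leb continuous_on_leb_integral)
  have i: "integrable (leb a b) (\<lambda>t. ?G t * k t)" "integrable (leb a b) (\<lambda>t. g t * ?K t)"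
    by (intro sq_int_mult sq ac_deriv_sq_int[OF f] ac_deriv_sq_int[OF h])+
  have "(LINT t|leb a b. f t * k t) = (LINT t|leb a b. f a * k t + ?G t * k t)"
  proof (intro Bochner_Integration.integral_cong refl)
    fix t assume "t \<in> space (leb a b)"
    then have "f t = f a + ?G t" by (intro ac_deriv_eq[OF f]) auto
    then show "f t * k t = f a * k t + ?G t * k t" by (simp add: distrib_right)
  qed
  moreover have "(LINT t|leb a b. g t * h t) = (LINT t|leb a b. h a * g t + g t * ?K t)"
  proof (intro Bochner_Integration.integral_cong refl)
    fix t assume "t \<in> space (leb a b)"
    then have "h t = h a + ?K t" by (intro ac_deriv_eq[OF h]) auto
    then show "g t * h t = h a * g t + g t * ?K t" by (simp add: distrib_left)
  qed
  ultimately have "(LINT t|leb a b. f t * k t) + (LINT t|leb a b. g t * h t)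
      = f a * ?K b + h a * ?G b + ?G b * ?K b"
    using gi i leb_by_parts[OF gi] by simp
  also have "\<dots> = f b * h b - f a * h a"
    using ac_deriv_eq[OF f, of b] ac_deriv_eq[OF h, of b] ab by (simp add: algebra_simps)
  finally show ?thesis .
qed

subsection \<open>Weak derivatives\<close>

lemma test_function_ac_deriv:
  assumes "test_function a b \<phi> \<phi>'"
  shows "ac_deriv a b \<phi> \<phi>'" "\<phi> a = 0" "\<phi> b = 0"
proof -
  show "ac_deriv a b \<phi> \<phi>'"
    using assms by (intro ac_deriv_C1)
      (auto simp: test_function_def intro: has_field_derivative_at_within continuous_on_subset)
  show "\<phi> a = 0" "\<phi> b = 0" using assms by (auto simp: test_function_def)
qed

lemma ac_deriv_imp_weak:
  assumes "ac_deriv a b f g" "a \<le> b" shows "has_weak_deriv a b f g"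
  unfolding has_weak_deriv_def
proof (intro allI impI)
  fix \<phi> \<phi>' assume t: "test_function a b \<phi> \<phi>'"
  show "(LINT t|leb a b. f t * \<phi>' t) = - (LINT t|leb a b. g t * \<phi> t)"
    using ac_deriv_by_parts[OF assms(1) test_function_ac_deriv(1)[OF t] assms(2)]
      test_function_ac_deriv(2,3)[OF t] by simp
qed

text \<open>Lusin: approximate \<open>sgn F\<close> almost everywhere by continuous functions.\<close>

lemma AE_eq_0_if_orthogonal_continuous:
  fixes F :: "real \<Rightarrow> real"
  assumes F: "integrable (leb a b) F" and ab: "a < b"
    and orth: "\<And>\<psi> c d. continuous_on UNIV \<psi> \<Longrightarrow> a < c \<Longrightarrow> d < b \<Longrightarrow> (\<And>t. t \<notin> {c..d} \<Longrightarrow> \<psi> t = 0)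
      \<Longrightarrow> (LINT t|leb a b. F t * \<psi> t) = 0"
  shows "AE t in leb a b. F t = 0"
proof -
  have "(\<lambda>t. sgn (F t)) \<in> borel_measurable (leb a b)"
    using F by (auto intro: borel_measurable_sgn)
  then have "(\<lambda>t. sgn (F t)) measurable_on {a<..<b}"
    by (subst measurable_on_iff_borel_measurable) auto
  then obtain N G where N: "negligible N" and G: "\<And>n. continuous_on UNIV (G n)"
    and lim: "\<And>t. t \<notin> N \<Longrightarrow> (\<lambda>n. G n t) \<longlonglongrightarrow> (if t \<in> {a<..<b} then sgn (F t) else 0)"
    unfolding measurable_on_def by blast
  \<comment> \<open>A plateau: it vanishes within distance 1 / (n + 1) of the end points, which
    gives \<open>\<psi> n\<close> compact support in the open interval, and at each interior point
    it equals 1 for large n because the slope n tends to infinity.\<close>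
  define cut where "cut n t = max 0 (min 1 (real n * min (t - a - 1 / real (Suc n)) (b - t - 1 / real (Suc n))))" for n t
  \<comment> \<open>Clipping \<open>G n\<close> to [-1, 1] keeps the limit \<open>sgn (F t)\<close>
    and makes |F| a dominating function.\<close>
  define \<psi> where "\<psi> n t = max (-1) (min 1 (G n t)) * cut n t" for n t
  have cont: "continuous_on UNIV (\<psi> n)" for n
    unfolding \<psi>_def cut_def by (intro continuous_intros G)
  have z: "\<psi> n t = 0" if "t \<notin> {a + 1 / real (Suc n)..b - 1 / real (Suc n)}" for n t
  proof -
    have "min (t - a - 1 / real (Suc n)) (b - t - 1 / real (Suc n)) \<le> 0"
      using that by (auto simp: min_def)
    then have "real n * min (t - a - 1 / real (Suc n)) (b - t - 1 / real (Suc n)) \<le> 0"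
      by (intro mult_nonneg_nonpos) auto
    then show ?thesis by (simp add: \<psi>_def cut_def)
  qed
  have int0: "(LINT t|leb a b. F t * \<psi> n t) = 0" for n
    by (rule orth[OF cont _ _ z]) auto
  have AE_N: "AE t in leb a b. t \<notin> N"
    using N by (auto simp: AE_leb_iff negligible_iff_null_sets intro: AE_mp[OF AE_not_in])
  have "(\<lambda>n. LINT t|leb a b. F t * \<psi> n t) \<longlonglongrightarrow> (LINT t|leb a b. \<bar>F t\<bar>)"
  proof (rule integral_dominated_convergence)
    show "(\<lambda>t. \<bar>F t\<bar>) \<in> borel_measurable (leb a b)" using F by auto
    show "(\<lambda>t. F t * \<psi> n t) \<in> borel_measurable (leb a b)" for n
      using F by (intro borel_measurable_times[OF _ continuous_measurable_leb]
        continuous_on_subset[OF cont]) auto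
    show "integrable (leb a b) (\<lambda>t. \<bar>F t\<bar>)" using F by simp
    have "\<bar>\<psi> n t\<bar> \<le> 1" for n t
    proof -
      have "\<bar>max (-1) (min 1 (G n t))\<bar> \<le> 1" "\<bar>cut n t\<bar> \<le> 1" by (auto simp: cut_def)
      then have "\<bar>max (-1) (min 1 (G n t))\<bar> * \<bar>cut n t\<bar> \<le> 1 * 1" by (intro mult_mono) auto
      then show ?thesis by (simp add: \<psi>_def abs_mult)
    qed
    then show "AE t in leb a b. norm (F t * \<psi> n t) \<le> \<bar>F t\<bar>" for n
      by (auto simp: abs_mult intro!: AE_I2 mult_left_le)
    have "AE t in leb a b. a < t \<and> t < b" by (auto intro: AE_leb_I)
    with AE_N show "AE t in leb a b. (\<lambda>n. F t * \<psi> n t) \<longlonglongrightarrow> \<bar>F t\<bar>"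
    proof eventually_elim
      case (elim t)
      have "(\<lambda>n. G n t) \<longlonglongrightarrow> sgn (F t)" using lim[of t] elim by simp
      then have "(\<lambda>n. max (-1) (min 1 (G n t))) \<longlonglongrightarrow> max (-1) (min 1 (sgn (F t)))"
        by (intro tendsto_intros)
      moreover have "max (-1) (min 1 (sgn (F t))) = sgn (F t)" by (auto simp: sgn_real_def)
      moreover have "(\<lambda>n. cut n t) \<longlonglongrightarrow> 1"
      proof -
        define \<delta> where "\<delta> = min (t - a) (b - t)"
        have \<delta>: "\<delta> > 0" using elim by (simp add: \<delta>_def)
        have "eventually (\<lambda>n. 1 / real (Suc n) < \<delta> / 2) sequentially"
          using LIMSEQ_inverse_real_of_nat \<delta>
          by (auto dest!: order_tendstoD(2)[where a = "\<delta> / 2"] simp: inverse_eq_divide)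
        moreover have "eventually (\<lambda>n. real n \<ge> 2 / \<delta>) sequentially"
          by (rule eventually_at_top_linorderI[of "nat \<lceil>2 / \<delta>\<rceil>"]) linarith
        ultimately have "eventually (\<lambda>n. cut n t = 1) sequentially"
        proof eventually_elim
          case (elim n)
          have "\<delta> \<le> t - a" "\<delta> \<le> b - t" by (auto simp: \<delta>_def)
          then have "min (t - a - 1 / real (Suc n)) (b - t - 1 / real (Suc n)) \<ge> \<delta> / 2"
            using elim(1) unfolding min_def by (simp only: split: if_split) linarith
          then have "real n * min (t - a - 1 / real (Suc n)) (b - t - 1 / real (Suc n)) \<ge> (2 / \<delta>) * (\<delta> / 2)"
            using elim(2) \<delta> by (intro mult_mono) auto
          then show ?case using \<delta> by (simp add: cut_def)
        qed
        then show ?thesis by (rule tendsto_eventually)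
      qed
      ultimately have "(\<lambda>n. F t * (max (-1) (min 1 (G n t)) * cut n t)) \<longlonglongrightarrow> F t * (sgn (F t) * 1)"
        by (intro tendsto_intros) auto
      moreover have "F t * (sgn (F t) * 1) = \<bar>F t\<bar>" by (simp add: abs_sgn)
      ultimately show ?case by (simp only: \<psi>_def)
    qed
  qed
  then have "(\<lambda>n :: nat. 0) \<longlonglongrightarrow> (LINT t|leb a b. \<bar>F t\<bar>)"
    by (simp only: int0)
  then have "(LINT t|leb a b. \<bar>F t\<bar>) = 0"
    by (rule LIMSEQ_unique[OF _ tendsto_const])
  then show ?thesis
    using F by (subst (asm) integral_nonneg_eq_0_iff_AE) auto
qed

text \<open>Take the primitive of \<theta> that vanishes at a. It is constant to the left of c and
  to the right of d. The zero integral makes the two constants equal, so it vanishes outside [c, d]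
  on the whole line, as a test function must.\<close>

lemma ex_test_function:
  assumes cont: "continuous_on UNIV \<theta>" and cd: "a < c" "d < b" "a < b"
    and z: "\<And>t. t \<notin> {c..d} \<Longrightarrow> \<theta> t = 0" and int0: "(LINT t|leb a b. \<theta> t) = 0"
  shows "\<exists>\<phi>. test_function a b \<phi> \<theta>"
proof -
  have "\<exists>F. \<forall>x :: real. -\<infinity> < ereal x \<longrightarrow> ereal x < \<infinity> \<longrightarrow> (F has_vector_derivative \<theta> x) (at x)"
    by (rule einterval_antiderivative) (use cont in \<open>auto simp: continuous_on_eq_continuous_at\<close>)
  then obtain F where F: "\<And>x. (F has_real_derivative \<theta> x) (at x)"
    by (auto simp: has_real_derivative_iff_has_vector_derivative)
  have FTC: "F y - F x = (LINT t|leb x y. \<theta> t)" if "x \<le> y" for x y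
    by (rule leb_FTC[symmetric])
      (use that F cont in \<open>auto intro: has_field_derivative_at_within continuous_on_subset\<close>)
  have const: "F y = F x" if "x \<le> y" "\<And>t. x < t \<Longrightarrow> t < y \<Longrightarrow> \<theta> t = 0" for x y
  proof -
    have "(LINT t|leb x y. \<theta> t) = (LINT t|leb x y. 0)"
      using that by (intro leb_cong(3)) auto
    then show ?thesis using FTC[OF that(1)] by simp
  qed
  have Fab: "F b = F a" using FTC[of a b] cd int0 by simp
  have "F t - F a = 0" if "t \<notin> {c..d}" for t
  proof -
    have "t < c \<or> t > d" using that by auto
    then consider "t < c" | "t > d" by blast
    then have "F t = F a"
    proof cases
      case 1
      show ?thesis
      proof (cases "t \<le> a")
        case True show ?thesis by (rule const[symmetric]) (use True cd z in auto)
      next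
        case False show ?thesis by (rule const) (use False 1 z in auto)
      qed
    next
      case 2
      have "F t = F b"
      proof (cases "t \<le> b")
        case True show ?thesis by (rule const[symmetric]) (use True 2 z in auto)
      next
        case False show ?thesis by (rule const) (use False cd z in auto)
      qed
      then show ?thesis using Fab by simp
    qed
    then show ?thesis by simp
  qed
  moreover have "((\<lambda>t. F t - F a) has_real_derivative \<theta> t) (at t)" for t
    using F[of t] by (auto intro!: derivative_eq_intros)
  ultimately have "test_function a b (\<lambda>t. F t - F a) \<theta>"
    unfolding test_function_def using cont cd(1,2) by blast
  then show ?thesis by blast
qed

text \<open>The lemma of du Bois-Reymond. Only functions with integral zero are derivatives of test
  functions, so an arbitrary continuous \<psi> is corrected by a multiple of a fixed bump
  \<open>\<rho>\<close>; this forces the constant to be the mean of F weighted by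
  \<open>\<rho>\<close>.\<close>

lemma AE_const_if_weak_deriv_0:
  fixes F :: "real \<Rightarrow> real"
  assumes F: "integrable (leb a b) F" and ab: "a < b"
    and orth: "\<And>\<phi> \<phi>'. test_function a b \<phi> \<phi>' \<Longrightarrow> (LINT t|leb a b. F t * \<phi>' t) = 0"
  shows "\<exists>k. AE t in leb a b. F t = k"
proof -
  \<comment> \<open>A tent supported in the middle half of the interval. Its integral is nonzero, so
    that it can serve as a denominator.\<close>
  define \<rho> where "\<rho> t = max 0 ((b - a) / 4 - \<bar>t - (a + b) / 2\<bar>)" for t :: real
  have \<rho>c: "continuous_on S \<rho>" for S unfolding \<rho>_def by (intro continuous_intros)
  have \<rho>z: "\<rho> t = 0" if "t \<notin> {a + (b - a) / 4..b - (b - a) / 4}" for t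
    using that by (auto simp: \<rho>_def max_def abs_if field_simps split: if_splits)
  define I where "I = (LINT t|leb a b. \<rho> t)"
  have "I = integral {a..b} \<rho>"
    unfolding I_def by (rule leb_eq_integral[OF continuous_integrable_leb[OF \<rho>c]])
  moreover have "integral {a..b} \<rho> \<noteq> 0"
  proof -
    have "\<rho> ((a + b) / 2) \<noteq> 0" using ab by (simp add: \<rho>_def)
    moreover have "(a + b) / 2 \<in> {a..b}" using ab by simp
    moreover have "\<rho> t \<ge> 0" for t by (simp add: \<rho>_def)
    ultimately show ?thesis
      using integral_eq_0_iff[OF \<rho>c ab] by blast
  qed
  ultimately have I: "I \<noteq> 0" by simp
  define k where "k = (LINT t|leb a b. F t * \<rho> t) / I"
  have Fc: "integrable (leb a b) (\<lambda>t. F t * \<psi> t)" if \<psi>: "continuous_on {a..b} \<psi>" for \<psi>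
  proof -
    obtain K where K: "\<forall>t\<in>{a..b}. \<bar>\<psi> t\<bar> \<le> K" using continuous_bounded_leb[OF \<psi>] .
    show ?thesis
    proof (rule Bochner_Integration.integrable_bound)
      show "integrable (leb a b) (\<lambda>t. K * F t)" using F by simp
      show "(\<lambda>t. F t * \<psi> t) \<in> borel_measurable (leb a b)"
        using F by (intro borel_measurable_times[OF _ continuous_measurable_leb[OF \<psi>]]) auto
      have "norm (F t * \<psi> t) \<le> norm (K * F t)" if "a < t" "t < b" for t
        using K that by (auto simp: abs_mult mult.commute[of "\<bar>F t\<bar>"] intro!: mult_right_mono
            intro: order_trans[OF _ abs_ge_self])
      then show "AE t in leb a b. norm (F t * \<psi> t) \<le> norm (K * F t)" by (rule AE_leb_I)
    qed
  qed
  have "AE t in leb a b. F t - k = 0"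
  proof (rule AE_eq_0_if_orthogonal_continuous[OF _ ab])
    show "integrable (leb a b) (\<lambda>t. F t - k)" using F by simp
    fix \<psi> :: "real \<Rightarrow> real" and c d
    assume \<psi>: "continuous_on UNIV \<psi>" and cd: "a < c" "d < b" and z: "\<And>t. t \<notin> {c..d} \<Longrightarrow> \<psi> t = 0"
    define J where "J = (LINT t|leb a b. \<psi> t)"
    define \<theta> where "\<theta> t = \<psi> t - J / I * \<rho> t" for t
    have \<psi>c: "continuous_on S \<psi>" for S using \<psi> by (rule continuous_on_subset) auto
    have "\<exists>\<phi>. test_function a b \<phi> \<theta>"
    proof (rule ex_test_function)
      show "continuous_on UNIV \<theta>" unfolding \<theta>_def by (intro continuous_intros \<psi> \<rho>c)
      show "a < min c (a + (b - a) / 4)" "max d (b - (b - a) / 4) < b" using cd ab by auto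
      show "\<theta> t = 0" if "t \<notin> {min c (a + (b - a) / 4)..max d (b - (b - a) / 4)}" for t
      proof -
        have "t \<notin> {c..d}" "t \<notin> {a + (b - a) / 4..b - (b - a) / 4}" using that by auto
        then show ?thesis using z[of t] \<rho>z[of t] by (simp add: \<theta>_def)
      qed
      show "(LINT t|leb a b. \<theta> t) = 0"
        using I continuous_integrable_leb[OF \<psi>c] continuous_integrable_leb[OF \<rho>c]
        by (simp add: \<theta>_def J_def[symmetric] I_def[symmetric])
    qed (fact ab)
    then obtain \<phi> where "test_function a b \<phi> \<theta>" by blast
    then have "0 = (LINT t|leb a b. F t * \<theta> t)" using orth by simp
    also have "\<dots> = (LINT t|leb a b. F t * \<psi> t - J / I * (F t * \<rho> t))"
      by (simp add: \<theta>_def algebra_simps)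
    also have "\<dots> = (LINT t|leb a b. F t * \<psi> t) - J * k"
      using Fc[OF \<psi>c] Fc[OF \<rho>c] by (simp add: k_def)
    also have "\<dots> = (LINT t|leb a b. F t * \<psi> t - k * \<psi> t)"
      using Fc[OF \<psi>c] continuous_integrable_leb[OF \<psi>c] by (simp add: J_def)
    finally show "(LINT t|leb a b. (F t - k) * \<psi> t) = 0" by (simp add: algebra_simps)
  qed
  then show ?thesis by auto
qed

lemma continuous_AE_eq_leb:
  fixes f h :: "real \<Rightarrow> real"
  assumes "continuous_on {a..b} f" "continuous_on {a..b} h" "a < b" "AE t in leb a b. f t = h t"
    "t \<in> {a..b}"
  shows "f t = h t"
proof -
  have c: "continuous_on {a..b} (\<lambda>t. \<bar>f t - h t\<bar>)" by (intro continuous_intros assms)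
  have "(LINT t|leb a b. \<bar>f t - h t\<bar>) = (LINT t|leb a b. 0)"
    by (rule integral_cong_AE)
      (use assms(4) continuous_measurable_leb[OF c] in \<open>auto elim: eventually_mono\<close>)
  then have "integral {a..b} (\<lambda>t. \<bar>f t - h t\<bar>) = 0"
    using leb_eq_integral[OF continuous_integrable_leb[OF c]] by simp
  then show ?thesis using integral_eq_0_iff[OF c assms(3)] assms(5) by auto
qed

text \<open>Let G be the primitive of g that vanishes at a. Then f - G has weak derivative 0 and is
  constant almost everywhere; adding this constant to G gives the representative.\<close>

lemma weak_deriv_imp_ac:
  assumes f: "sq_int (leb a b) f" and g: "sq_int (leb a b) g" and w: "has_weak_deriv a b f g" and ab: "a < b"
  obtains h where "ac_deriv a b h g" "AE t in leb a b. h t = f t"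
proof -
  have gi: "integrable (leb a b) g" by (rule leb.sq_int_imp_integrable[OF g])
  define G where "G t = (LINT s|leb a t. g s)" for t
  have "G a = 0" by (simp add: G_def)
  then have G: "ac_deriv a b G g" using g by (simp add: ac_deriv_def G_def)
  note Gs = ac_deriv_sq_int'[OF G]
  have "\<exists>k. AE t in leb a b. f t - G t = k"
  proof (rule AE_const_if_weak_deriv_0[OF _ ab])
    show "integrable (leb a b) (\<lambda>t. f t - G t)"
      by (intro leb.sq_int_imp_integrable sq_int_diff f Gs)
    fix \<phi> \<phi>' assume t: "test_function a b \<phi> \<phi>'"
    note \<phi> = ac_deriv_sq_int[OF test_function_ac_deriv(1)[OF t]]
    have "(LINT t|leb a b. (f t - G t) * \<phi>' t) = (LINT t|leb a b. f t * \<phi>' t - G t * \<phi>' t)"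
      by (simp add: algebra_simps)
    also have "\<dots> = (LINT t|leb a b. f t * \<phi>' t) - (LINT t|leb a b. G t * \<phi>' t)"
      by (intro Bochner_Integration.integral_diff sq_int_mult f Gs \<phi>)
    also have "\<dots> = 0"
      using w t ac_deriv_imp_weak[OF G] ab by (simp add: has_weak_deriv_def)
    finally show "(LINT t|leb a b. (f t - G t) * \<phi>' t) = 0" .
  qed
  then obtain k where k: "AE t in leb a b. f t - G t = k" ..
  have "ac_deriv a b (\<lambda>t. k + G t) g" using g \<open>G a = 0\<close> by (simp add: ac_deriv_def G_def)
  moreover have "AE t in leb a b. k + G t = f t" using k by eventually_elim simp
  ultimately show thesis by (rule that)
qed

text \<open>Integration by parts against a polynomial p shows that g is orthogonal to p, because the
  constant k contributes k * (p b - p a) on both sides. By Stone-Weierstrass polynomials approximate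
  \<psi> uniformly on [a, b], hence g is orthogonal to \<psi> too.\<close>

lemma ac_deriv_0_imp_AE_0:
  assumes "ac_deriv a b (\<lambda>t. k) g" "a < b"
  shows "AE t in leb a b. g t = 0"
proof (rule AE_eq_0_if_orthogonal_continuous[OF ac_deriv_integrable[OF assms(1)] assms(2)])
  fix \<psi> :: "real \<Rightarrow> real" and c d
  assume \<psi>: "continuous_on UNIV \<psi>" and cd: "a < c" "d < b" and z: "\<And>t. t \<notin> {c..d} \<Longrightarrow> \<psi> t = 0"
  have gi: "integrable (leb a b) g" by (rule ac_deriv_integrable[OF assms(1)])
  have \<psi>c: "continuous_on S \<psi>" for S using \<psi> by (rule continuous_on_subset) auto
  have "\<bar>LINT t|leb a b. g t * \<psi> t\<bar> \<le> e * (LINT t|leb a b. \<bar>g t\<bar>)" if e: "e > 0" for e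
  proof -
    obtain p where p: "real_polynomial_function p" "\<And>t. t \<in> {a..b} \<Longrightarrow> \<bar>\<psi> t - p t\<bar> < e"
      using Stone_Weierstrass_real_polynomial_function[OF compact_Icc \<psi>c e] by metis
    obtain p' where p': "real_polynomial_function p'" "\<And>t. (p has_real_derivative p' t) (at t)"
      using has_real_derivative_polynomial_function[OF p(1)] by metis
    have p'c: "continuous_on {a..b} p'"
      using p'(1) by (intro continuous_on_polymonial_function) (simp add: real_polynomial_function_eq)
    have pa: "ac_deriv a b p p'"
      by (intro ac_deriv_C1 p'c) (auto intro: p'(2) has_field_derivative_at_within)
    note sq = ac_deriv_sq_int[OF assms(1)]
    have i: "integrable (leb a b) (\<lambda>t. g t * \<psi> t)" "integrable (leb a b) (\<lambda>t. g t * p t)"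
      by (intro sq_int_mult sq continuous_sq_int_leb \<psi>c ac_deriv_sq_int'[OF pa])+
    have "(LINT t|leb a b. g t * p t) = 0"
      using ac_deriv_by_parts[OF assms(1) pa] ac_deriv_eq[OF pa, of b] assms(2)
      by (simp add: algebra_simps)
    then have "(LINT t|leb a b. g t * \<psi> t) = (LINT t|leb a b. g t * \<psi> t - g t * p t)"
      using i by simp
    also have "\<bar>\<dots>\<bar> \<le> (LINT t|leb a b. e * \<bar>g t\<bar>)"
    proof (rule integral_abs_bound[THEN order_trans], rule integral_mono_AE)
      have "\<bar>g t * \<psi> t - g t * p t\<bar> \<le> e * \<bar>g t\<bar>" if "a < t" "t < b" for t
      proof -
        have "\<bar>g t * \<psi> t - g t * p t\<bar> = \<bar>g t\<bar> * \<bar>\<psi> t - p t\<bar>"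
          by (simp add: abs_mult[symmetric] right_diff_distrib)
        also have "\<dots> \<le> \<bar>g t\<bar> * e" using p(2)[of t] that by (intro mult_left_mono) auto
        finally show ?thesis by (simp add: mult.commute)
      qed
      then show "AE t in leb a b. \<bar>g t * \<psi> t - g t * p t\<bar> \<le> e * \<bar>g t\<bar>" by (rule AE_leb_I)
    qed (use i gi in auto)
    finally show ?thesis using gi by simp
  qed
  then have "\<bar>LINT t|leb a b. g t * \<psi> t\<bar> \<le> 0"
  proof -
    let ?N = "LINT t|leb a b. \<bar>g t\<bar>"
    assume *: "\<And>e. e > 0 \<Longrightarrow> \<bar>LINT t|leb a b. g t * \<psi> t\<bar> \<le> e * ?N"
    have N: "?N \<ge> 0" by simp
    show ?thesis
    proof (rule field_le_epsilon)
      fix e :: real assume e: "e > 0"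
      \<comment> \<open>The integral of |g| may be 0, so the tolerance is divided by that integral
        plus 1.\<close>
      have "\<bar>LINT t|leb a b. g t * \<psi> t\<bar> \<le> e / (?N + 1) * ?N"
        by (rule *) (rule divide_pos_pos[OF e], use N in linarith)
      also have "\<dots> = e * (?N / (?N + 1))" by simp
      also have "\<dots> \<le> e * 1"
      proof (rule mult_left_mono)
        have "0 < ?N + 1" using N by linarith
        then show "?N / (?N + 1) \<le> 1" unfolding divide_le_eq_1 by linarith
      qed (use e in simp)
      also have "\<dots> = e" by simp
      finally show "\<bar>LINT t|leb a b. g t * \<psi> t\<bar> \<le> 0 + e" by simp
    qed
  qed
  then show "(LINT t|leb a b. g t * \<psi> t) = 0" by simp
qed

subsection \<open>The Sobolev space on an interval\<close>

lemma has_weak_deriv_cong_AE: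
  assumes w: "has_weak_deriv a b h g" and h: "h \<in> borel_measurable (leb a b)"
    and f: "f \<in> borel_measurable (leb a b)" and eq: "AE t in leb a b. h t = f t"
  shows "has_weak_deriv a b f g"
  unfolding has_weak_deriv_def
proof (intro allI impI)
  fix \<phi> \<phi>' assume t: "test_function a b \<phi> \<phi>'"
  have \<phi>: "\<phi>' \<in> borel_measurable (leb a b)"
    using ac_deriv_sq_int[OF test_function_ac_deriv(1)[OF t]] by (simp add: sq_int_def)
  have "(LINT t|leb a b. f t * \<phi>' t) = (LINT t|leb a b. h t * \<phi>' t)"
  proof (rule integral_cong_AE)
    show "AE t in leb a b. f t * \<phi>' t = h t * \<phi>' t" using eq by eventually_elim simp
  qed (use h f \<phi> in auto)
  then show "(LINT t|leb a b. f t * \<phi>' t) = - (LINT t|leb a b. g t * \<phi> t)"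
    using w t by (simp add: has_weak_deriv_def)
qed

text \<open>The absolutely continuous representatives belonging to g and to g' coincide everywhere
  by continuity, so g - g' is a derivative of the zero function.\<close>

lemma AE_weak_deriv_unique:
  assumes "sq_int (leb a b) f" "sq_int (leb a b) g" "has_weak_deriv a b f g"
    "sq_int (leb a b) g'" "has_weak_deriv a b f g'" "a < b"
  shows "AE t in leb a b. g t = g' t"
proof -
  obtain h where h: "ac_deriv a b h g" "AE t in leb a b. h t = f t"
    using weak_deriv_imp_ac[OF assms(1-3,6)] .
  obtain h' where h': "ac_deriv a b h' g'" "AE t in leb a b. h' t = f t"
    using weak_deriv_imp_ac[OF assms(1,4-6)] .
  have "AE t in leb a b. h t = h' t" using h(2) h'(2) by eventually_elim simp
  then have eq: "h t = h' t" if "t \<in> {a..b}" for t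
    using continuous_AE_eq_leb[OF ac_deriv_continuous[OF h(1)] ac_deriv_continuous[OF h'(1)] assms(6) _ that]
    by simp
  have "ac_deriv a b (\<lambda>t. 0) (\<lambda>t. 1 * g t + (-1) * g' t)"
    by (rule ac_deriv_cong[OF ac_deriv_lincomb[OF h(1) h'(1), of 1 "-1"]]) (use eq in auto)
  from ac_deriv_0_imp_AE_0[OF this assms(6)] show ?thesis by eventually_elim simp
qed

lemma weak_deriv_spec:
  assumes "f \<in> W21 a b"
  shows "sq_int (leb a b) (weak_deriv a b f)" "has_weak_deriv a b f (weak_deriv a b f)"
proof -
  have "\<exists>g. g \<in> L2 a b \<and> has_weak_deriv a b f g" using assms by (auto simp: W21_def)
  from someI_ex[OF this]
  show "sq_int (leb a b) (weak_deriv a b f)" "has_weak_deriv a b f (weak_deriv a b f)"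
    by (auto simp: weak_deriv_def L2_iff)
qed

lemma W21_ac_deriv_rep:
  assumes "f \<in> W21 a b" "a < b"
  obtains h where "ac_deriv a b h (weak_deriv a b f)" "AE t in leb a b. h t = f t"
  using weak_deriv_imp_ac[of a b f "weak_deriv a b f"] weak_deriv_spec[OF assms(1)] assms
  by (auto simp: W21_def L2_iff)

lemma W21_continuous_ac_deriv:
  assumes "f \<in> W21 a b" "a < b" "continuous_on {a..b} f"
  shows "ac_deriv a b f (weak_deriv a b f)"
proof -
  obtain h where h: "ac_deriv a b h (weak_deriv a b f)" "AE t in leb a b. h t = f t"
    using W21_ac_deriv_rep[OF assms(1,2)] .
  have "h t = f t" if "t \<in> {a..b}" for t
    by (rule continuous_AE_eq_leb[OF ac_deriv_continuous[OF h(1)] assms(3,2) h(2) that])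
  then show ?thesis by (intro ac_deriv_cong[OF h(1)]) auto
qed

text \<open>Meant for an f that is known only up to null sets, as \<open>ell_hat y j\<close> is,
  being composed of weak derivatives; h is its continuous representative.\<close>

lemma ac_deriv_rep_W21:
  assumes h: "ac_deriv a b h g" and eq: "AE t in leb a b. h t = f t"
    and f: "f \<in> borel_measurable (leb a b)" and ab: "a < b"
  shows "f \<in> W21 a b" "AE t in leb a b. weak_deriv a b f t = g t"
proof -
  note hs = ac_deriv_sq_int'[OF h]
  have fs: "sq_int (leb a b) f" by (rule sq_int_cong_AE[OF hs f eq])
  have w: "has_weak_deriv a b f g"
    by (rule has_weak_deriv_cong_AE[OF ac_deriv_imp_weak[OF h] _ f eq])
      (use ab hs in \<open>auto simp: sq_int_def\<close>)
  show W: "f \<in> W21 a b"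
    using fs w ac_deriv_sq_int[OF h] by (auto simp: W21_def L2_iff)
  show "AE t in leb a b. weak_deriv a b f t = g t"
    by (rule AE_weak_deriv_unique[OF fs weak_deriv_spec[OF W] ac_deriv_sq_int[OF h] w ab])
qed

lemma ac_deriv_W21:
  assumes "ac_deriv a b f g" "a < b"
  shows "f \<in> W21 a b" "AE t in leb a b. weak_deriv a b f t = g t"
  using ac_deriv_rep_W21[OF assms(1) _ _ assms(2), of f] ac_deriv_sq_int'[OF assms(1)]
  by (auto simp: sq_int_def)

text \<open>\<open>cont_rep\<close> is a choice, but continuous functions that agree almost
  everywhere agree on [a, b]. So any continuous representative computes it, also at the end points,
  where the Kirchhoff condition evaluates it.\<close>

lemma cont_rep_eq:
  assumes h: "continuous_on {a..b} h" "AE t in leb a b. h t = f t" "a < b" "t \<in> {a..b}"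
  shows "cont_rep a b f t = h t"
proof -
  let ?P = "\<lambda>h. continuous_on {a..b} h \<and> (AE t in leb a b. h t = f t)"
  have P: "?P (cont_rep a b f)"
    unfolding cont_rep_def by (rule someI[of ?P h]) (use h in simp)
  then have "AE t in leb a b. cont_rep a b f t = h t"
    using h(2) by (auto elim: eventually_elim2)
  then show ?thesis
    using continuous_AE_eq_leb[OF _ h(1) h(3) _ h(4)] P by blast
qed

section \<open>A priori estimates along a path of the graph\<close>

lemma nrm2_leb_mono:
  assumes "sq_int (leb a b) f" "a \<le> p" "r \<le> b"
  shows "nrm2 (leb p r) f \<le> nrm2 (leb a b) f"
  unfolding nrm2_def real_sqrt_le_iff
  by (rule integral_mono_lebesgue_on_AE) (use assms in \<open>auto simp: sq_int_def\<close>)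

lemma nrm2_leb_split:
  assumes "sq_int (leb a c) f" "a \<le> b" "b \<le> c"
  shows "(nrm2 (leb a c) f)\<^sup>2 = (nrm2 (leb a b) f)\<^sup>2 + (nrm2 (leb b c) f)\<^sup>2"
  unfolding nrm2_sq by (rule integral_leb_split) (use assms in \<open>auto simp: sq_int_def\<close>)

lemma sq_int_dilate:
  assumes "sq_int (leb 0 S) f" "q > 0"
  shows "sq_int (leb 0 (q * S)) (\<lambda>s. f (s / q))"
  using sq_int_leb_affine[of "1 / q" 0 0 "q * S" f] assms by simp

lemma nrm2_dilate:
  assumes "sq_int (leb 0 S) f" "q > 0"
  shows "nrm2 (leb 0 (q * S)) (\<lambda>s. f (s / q)) = sqrt q * nrm2 (leb 0 S) f"
proof -
  have "(\<lambda>s. (f (s / q))\<^sup>2) \<in> borel_measurable (leb 0 (q * S))"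
    using sq_int_integrable[OF sq_int_dilate[OF assms]] by (rule borel_measurable_integrable)
  then have "(LINT s|leb 0 (q * S). (f (s / q))\<^sup>2) = q * (LINT s|leb 0 S. (f s)\<^sup>2)"
    using leb_affine_subst(3)[of q "\<lambda>s. (f (s / q))\<^sup>2" 0 0 S] assms by simp
  then show ?thesis by (simp add: nrm2_def real_sqrt_mult)
qed

text \<open>Split U as exp (\<mu> * x) times exp (- \<mu> * x) * U x; the square of the first factor
  is integrated explicitly. The sign of \<mu> is free: the forward estimate takes \<mu> = l, the
  backward one \<mu> = - l. The weighted norm is taken over the whole of (a, b), so that one number
  bounds the integrals for all p and r.\<close>

lemma weighted_Cauchy_Schwarz:
  assumes U: "sq_int (leb a b) U" and pr: "a \<le> p" "p \<le> r" "r \<le> b" and \<mu>: "\<mu> \<noteq> 0"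
  shows "(LINT x|leb p r. U x)\<^sup>2
    \<le> (exp (2 * \<mu> * r) - exp (2 * \<mu> * p)) / (2 * \<mu>) * (nrm2 (leb a b) (\<lambda>x. exp (- \<mu> * x) * U x))\<^sup>2"
proof -
  let ?e = "\<lambda>x. exp (\<mu> * x)" and ?u = "\<lambda>x. exp (- \<mu> * x) * U x"
  have e: "sq_int (leb p r) ?e" by (intro continuous_sq_int_leb continuous_intros)
  have ec: "continuous_on {a..b} (\<lambda>x. exp (- \<mu> * x))" by (intro continuous_intros)
  obtain K where K: "\<forall>t\<in>{a..b}. \<bar>exp (- \<mu> * t)\<bar> \<le> K" using continuous_bounded_leb[OF ec] .
  have u: "sq_int (leb a b) ?u"
    by (rule sq_int_mult_bounded[OF U continuous_measurable_leb[OF ec], of K])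
      (use K in \<open>auto intro: AE_leb_I\<close>)
  have u': "sq_int (leb p r) ?u" by (rule sq_int_leb_mono[OF u]) (use pr in auto)
  have "(LINT x|leb p r. U x) = (LINT x|leb p r. ?e x * ?u x)"
    by (simp add: exp_minus mult.assoc[symmetric])
  then have "\<bar>LINT x|leb p r. U x\<bar> \<le> nrm2 (leb p r) ?e * nrm2 (leb p r) ?u"
    using LINT_Cauchy_Schwarz[OF e u'] by simp
  also have "\<dots> \<le> nrm2 (leb p r) ?e * nrm2 (leb a b) ?u"
    by (intro mult_left_mono nrm2_leb_mono u) (use pr in auto)
  finally have "\<bar>LINT x|leb p r. U x\<bar>\<^sup>2 \<le> (nrm2 (leb p r) ?e * nrm2 (leb a b) ?u)\<^sup>2"
    by (rule power_mono) simp
  moreover have "(nrm2 (leb p r) ?e)\<^sup>2 = (exp (2 * \<mu> * r) - exp (2 * \<mu> * p)) / (2 * \<mu>)"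
  proof -
    have "(LINT x|leb p r. (?e x)\<^sup>2) = (LINT x|leb p r. exp (2 * \<mu> * x))"
      by (simp add: exp_double[symmetric] mult.assoc)
    also have "\<dots> = exp (2 * \<mu> * r) / (2 * \<mu>) - exp (2 * \<mu> * p) / (2 * \<mu>)"
      by (rule leb_FTC) (use pr \<mu> in \<open>auto intro!: derivative_eq_intros continuous_intros\<close>)
    finally show ?thesis by (simp add: nrm2_sq diff_divide_distrib)
  qed
  ultimately show ?thesis by (simp add: power_mult_distrib)
qed

definition jump :: "real \<Rightarrow> real \<Rightarrow> real \<Rightarrow> real \<Rightarrow> real" where
  "jump r x y s = (if s < r then x else y)"

lemma jump_measurable [measurable]: "jump r x y \<in> borel_measurable (leb a b)"
proof -
  have [measurable]: "(\<lambda>x. x) \<in> borel_measurable (leb a b)"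
    by (intro continuous_measurable_leb continuous_intros)
  show ?thesis unfolding jump_def by measurable
qed

lemma abs_jump_le: "\<bar>jump r x y s\<bar> \<le> max \<bar>x\<bar> \<bar>y\<bar>"
  by (simp add: jump_def)

lemma sq_int_jump_mult: "sq_int (leb a b) f \<Longrightarrow> sq_int (leb a b) (\<lambda>s. jump r x y s * f s)"
  by (rule sq_int_mult_bounded[where K = "max \<bar>x\<bar> \<bar>y\<bar>"]) (auto intro!: AE_I2 abs_jump_le)

text \<open>On the concatenation \<open>(0, R)\<close> of the first edge \<open>(0, r)\<close> with another one, in the variable
  \<open>s = t + T 1\<close> on the latter, both expressions \<open>ell\<close> become this one.\<close>

definition pant :: "real \<Rightarrow> real \<Rightarrow> real \<times> real \<times> real \<Rightarrow> real \<times> real \<times> real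
    \<Rightarrow> (real \<Rightarrow> real) \<Rightarrow> (real \<Rightarrow> real) \<Rightarrow> real \<Rightarrow> real" where
  "pant r q = (\<lambda>(a1, b1, c1) (a2, b2, c2) U Y s. U s + jump r a1 a2 s * U (s / q)
     + jump r b1 b2 s * Y s + jump r c1 c2 s * Y (s / q))"

lemma sq_int_dilate':
  assumes "sq_int (leb 0 R) f" "q > 1" "R \<ge> 0"
  shows "sq_int (leb 0 R) (\<lambda>s. f (s / q))"
proof -
  have "R / q \<le> R" using assms by (simp add: divide_le_eq mult_le_cancel_left1)
  then have "sq_int (leb 0 (R / q)) f" by (intro sq_int_leb_mono[OF assms(1)]) auto
  from sq_int_dilate[OF this, of q] show ?thesis using assms by simp
qed

lemma sq_int_pant:
  assumes "sq_int (leb 0 R) U" "sq_int (leb 0 R) Y" "q > 1" "R \<ge> 0"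
  shows "sq_int (leb 0 R) (pant r q A B U Y)"
proof (cases A, cases B)
  fix a1 b1 c1 a2 b2 c2 assume "A = (a1, b1, c1)" "B = (a2, b2, c2)"
  then show ?thesis
    unfolding pant_def using assms by (auto intro!: sq_int_add sq_int_jump_mult sq_int_dilate')
qed

text \<open>Two demands on the weight, met at once: l is the sum of one threshold for each and 1.
  The first uses exp x \<ge> 1 + x, the second is compared after squaring. In the applications k is
  the smallest delay beyond the vertex.\<close>

lemma ex_large_weight:
  fixes A B k \<epsilon> \<delta> :: real
  assumes "A \<ge> 0" "B \<ge> 0" "k > 0" "\<epsilon> > 0" "\<delta> > 0" "R \<ge> 0"
  shows "\<exists>l>0. A * exp (- (l * k)) \<le> \<epsilon> \<and> B * sqrt (R / (2 * l)) \<le> \<delta>"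
proof -
  define l where "l = A / (k * \<epsilon>) + B\<^sup>2 * R / (2 * \<delta>\<^sup>2) + 1"
  have nn: "A / (k * \<epsilon>) \<ge> 0" "B\<^sup>2 * R / (2 * \<delta>\<^sup>2) \<ge> 0" using assms by auto
  then have l: "l > 0" by (simp add: l_def)
  have "A * exp (- (l * k)) \<le> \<epsilon>"
  proof -
    have "A \<le> l * k * \<epsilon>"
    proof -
      have "A / (k * \<epsilon>) \<le> l" using nn by (simp add: l_def)
      then show ?thesis using assms by (simp add: field_simps)
    qed
    also have "\<dots> \<le> exp (l * k) * \<epsilon>"
      using exp_ge_add_one_self[of "l * k"] assms by (intro mult_right_mono) linarith+
    finally show ?thesis by (simp add: exp_minus field_simps)
  qed
  moreover have "B * sqrt (R / (2 * l)) \<le> \<delta>"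
  proof (rule power2_le_imp_le)
    have "B\<^sup>2 * R / (2 * \<delta>\<^sup>2) \<le> l" using nn by (simp add: l_def)
    then have "B\<^sup>2 * R \<le> l * (2 * \<delta>\<^sup>2)" using assms by (simp add: divide_le_eq)
    then have "B\<^sup>2 * (R / (2 * l)) \<le> \<delta>\<^sup>2" using l by (simp add: divide_le_eq algebra_simps)
    then show "(B * sqrt (R / (2 * l)))\<^sup>2 \<le> \<delta>\<^sup>2" using assms l by (simp add: power_mult_distrib)
  qed (use assms in simp)
  ultimately show ?thesis using l by blast
qed

lemma sq_int_exp_mult:
  assumes "sq_int (leb a b) f" shows "sq_int (leb a b) (\<lambda>s. exp (x * s) * f s)"
proof -
  have ec: "continuous_on {a..b} (\<lambda>s. exp (x * s))" by (intro continuous_intros)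
  obtain K where K: "\<forall>t\<in>{a..b}. \<bar>exp (x * t)\<bar> \<le> K" using continuous_bounded_leb[OF ec] .
  show ?thesis
    by (rule sq_int_mult_bounded[OF assms continuous_measurable_leb[OF ec], of K])
      (use K in \<open>auto intro: AE_leb_I\<close>)
qed

lemma nrm2_leb_bounded:
  assumes "sq_int (leb 0 R) f" "\<And>s. 0 < s \<Longrightarrow> s < R \<Longrightarrow> \<bar>f s\<bar> \<le> K" "0 \<le> K" "0 \<le> R"
  shows "nrm2 (leb 0 R) f \<le> K * sqrt R"
  using leb.nrm2_bounded[of f 0 R K] assms measure_leb[of 0 R]
  by (auto simp: sq_int_def intro: AE_leb_I)

lemma nrm2_diff4_le:
  assumes "sq_int M f" "sq_int M g" "sq_int M h" "sq_int M k"
  shows "nrm2 M (\<lambda>s. f s - g s - h s - k s) \<le> nrm2 M f + nrm2 M g + nrm2 M h + nrm2 M k"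
proof -
  have tr: "nrm2 M (\<lambda>s. u s - v s) \<le> nrm2 M u + nrm2 M v" if "sq_int M u" "sq_int M v" for u v
    using nrm2_triangle[OF that(1) sq_int_cmult[OF that(2), of "-1"]] by simp
  have "nrm2 M (\<lambda>s. f s - g s - h s - k s) \<le> nrm2 M (\<lambda>s. f s - g s - h s) + nrm2 M k"
    by (intro tr sq_int_diff assms)
  also have "nrm2 M (\<lambda>s. f s - g s - h s) \<le> nrm2 M (\<lambda>s. f s - g s) + nrm2 M h"
    by (intro tr sq_int_diff assms)
  also have "nrm2 M (\<lambda>s. f s - g s) \<le> nrm2 M f + nrm2 M g"
    by (intro tr assms)
  finally show ?thesis by simp
qed

text \<open>With the weight \<open>exp (- l * s)\<close> and \<open>l\<close> large, only the term with the coefficient of the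
  delayed derivative near \<open>0\<close> is not small compared with \<open>U\<close>.\<close>

lemma pantograph_forward_estimate:
  fixes a1 b1 c1 a2 b2 c2 :: real
  assumes r: "0 < r" "r \<le> R" and q: "1 < q" and a1: "\<bar>a1\<bar> * sqrt q < 1"
  shows "\<exists>C\<ge>0. \<forall>U Y. ac_deriv 0 R Y U \<longrightarrow> Y 0 = 0 \<longrightarrow>
    nrm2 (leb 0 R) U \<le> C * nrm2 (leb 0 R) (pant r q (a1, b1, c1) (a2, b2, c2) U Y)"
proof -
  \<comment> \<open>The midpoint of |a1| * sqrt q and 1. The delayed derivative will cost the
    fraction \<rho> of the weighted norm N of U, the two lower order terms (1 - \<rho>) / 4 each, so
    that (1 - \<rho>) / 2 of N survives absorption.\<close>
  define \<rho> where "\<rho> = (1 + \<bar>a1\<bar> * sqrt q) / 2"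
  have "0 \<le> \<bar>a1\<bar> * sqrt q" using q by simp
  with a1 have \<rho>: "0 < \<rho>" "\<rho> < 1" "\<bar>a1\<bar> * sqrt q \<le> \<rho>" by (auto simp: \<rho>_def)
  have sq: "sqrt q > 0" using q by simp
  have R: "R > 0" using r by simp
  define K where "K = max (max \<bar>b1\<bar> \<bar>b2\<bar>) (max \<bar>c1\<bar> \<bar>c2\<bar>)"
  have K: "K \<ge> 0" "\<bar>jump r b1 b2 s\<bar> \<le> K" "\<bar>jump r c1 c2 s\<bar> \<le> K" for s
    by (simp add: K_def le_max_iff_disj, (rule order_trans[OF abs_jump_le], simp only: K_def max.cobounded1 max.cobounded2)+)
  \<comment> \<open>\<open>r * (1 - 1 / q)\<close> is the delay at s = r, the smallest one where
    \<open>a2\<close> acts. The exponential factor gained there brings |a2| down to \<rho> / sqrt q,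
    the bound that |a1| satisfies by assumption.\<close>
  obtain l where l: "l > 0" "\<bar>a2\<bar> * exp (- (l * (r * (1 - 1 / q)))) \<le> \<rho> / sqrt q"
      "K * sqrt (R / (2 * l)) \<le> (1 - \<rho>) / 4"
    using ex_large_weight[of "\<bar>a2\<bar>" K "r * (1 - 1 / q)" "\<rho> / sqrt q" "(1 - \<rho>) / 4" R]
      K(1) r q \<rho> sq R by auto
  \<comment> \<open>exp (l * R) undoes the weight on (0, R); 2 / (1 - \<rho>) comes from the
    absorption.\<close>
  define C where "C = exp (l * R) * (2 / (1 - \<rho>))"
  have "nrm2 (leb 0 R) U \<le> C * nrm2 (leb 0 R) (pant r q (a1, b1, c1) (a2, b2, c2) U Y)"
    if Y: "ac_deriv 0 R Y U" and Y0: "Y 0 = 0" for U Y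
  proof -
    let ?M = "leb 0 R" and ?w = "\<lambda>s. exp (- l * s)"
    let ?g = "pant r q (a1, b1, c1) (a2, b2, c2) U Y"
    note Us = ac_deriv_sq_int[OF Y] and Ys = ac_deriv_sq_int'[OF Y]
    define N where "N = nrm2 ?M (\<lambda>s. ?w s * U s)"
    have N0: "N \<ge> 0" by (simp add: N_def)
    have gs: "sq_int ?M ?g" using R q by (intro sq_int_pant Us Ys) auto
    have Uq: "sq_int ?M (\<lambda>s. U (s / q))" and Yq: "sq_int ?M (\<lambda>s. Y (s / q))"
      using R q by (auto intro!: sq_int_dilate' Us Ys)
    let ?f1 = "\<lambda>s. ?w s * ?g s" and ?f2 = "\<lambda>s. ?w s * (jump r a1 a2 s * U (s / q))"
      and ?f3 = "\<lambda>s. ?w s * (jump r b1 b2 s * Y s)" and ?f4 = "\<lambda>s. ?w s * (jump r c1 c2 s * Y (s / q))"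
    have s1: "sq_int ?M ?f1" and s2: "sq_int ?M ?f2" and s3: "sq_int ?M ?f3" and s4: "sq_int ?M ?f4"
      by (intro sq_int_exp_mult sq_int_jump_mult gs Us Ys Uq Yq)+
    \<comment> \<open>\<open>Y 0 = 0\<close> makes Y s the integral of U over (0, s). The weighted
      Cauchy-Schwarz inequality then gives the factor 1 / sqrt (2 * l), the source of smallness for
      all terms in Y.\<close>
    have Ybound: "?w s * \<bar>Y s\<bar> \<le> N / sqrt (2 * l)" if s: "0 \<le> s" "s \<le> R" for s
    proof (rule power2_le_imp_le)
      have "Y s = (LINT x|leb 0 s. U x)" using ac_deriv_eq[OF Y s] Y0 by simp
      then have "(Y s)\<^sup>2 \<le> (exp (2 * l * s) - exp (2 * l * 0)) / (2 * l) * N\<^sup>2"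
        using weighted_Cauchy_Schwarz[OF Us, of 0 s l] s l by (simp add: N_def)
      also have "\<dots> \<le> exp (2 * l * s) / (2 * l) * N\<^sup>2"
        using l by (intro mult_right_mono divide_right_mono) auto
      finally have "(?w s)\<^sup>2 * (Y s)\<^sup>2 \<le> (?w s)\<^sup>2 * (exp (2 * l * s) / (2 * l) * N\<^sup>2)"
        by (intro mult_left_mono) auto
      also have "(?w s)\<^sup>2 * (exp (2 * l * s) / (2 * l) * N\<^sup>2) = ((?w s)\<^sup>2 * exp (2 * l * s)) * (N\<^sup>2 / (2 * l))"
        by simp
      also have "(?w s)\<^sup>2 * exp (2 * l * s) = 1"
        by (simp add: power2_eq_square exp_add[symmetric])
      finally show "(?w s * \<bar>Y s\<bar>)\<^sup>2 \<le> (N / sqrt (2 * l))\<^sup>2"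
        using l by (simp add: power_mult_distrib power_divide)
    qed (use N0 l in simp)
    have Yqbound: "?w s * \<bar>Y (s / q)\<bar> \<le> N / sqrt (2 * l)" if s: "0 \<le> s" "s \<le> R" for s
    proof -
      have sq: "s / q \<le> s" using s q by (simp add: divide_le_eq mult_le_cancel_left1)
      have "?w s * \<bar>Y (s / q)\<bar> \<le> ?w (s / q) * \<bar>Y (s / q)\<bar>"
        using mult_left_mono[OF sq, of l] l by (intro mult_right_mono) auto
      also have "\<dots> \<le> N / sqrt (2 * l)" using s sq q by (intro Ybound) auto
      finally show ?thesis .
    qed
    have low: "K * (N / sqrt (2 * l)) * sqrt R \<le> (1 - \<rho>) / 4 * N"
    proof -
      have "K * (N / sqrt (2 * l)) * sqrt R = K * sqrt (R / (2 * l)) * N"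
        by (simp add: real_sqrt_divide)
      also have "\<dots> \<le> (1 - \<rho>) / 4 * N" using l(3) N0 by (rule mult_right_mono)
      finally show ?thesis .
    qed
    have KN: "0 \<le> K * (N / sqrt (2 * l))" using K(1) N0 l by simp
    have n3: "nrm2 ?M ?f3 \<le> (1 - \<rho>) / 4 * N"
    proof -
      have "nrm2 ?M ?f3 \<le> K * (N / sqrt (2 * l)) * sqrt R"
      proof (rule nrm2_leb_bounded[OF s3 _ KN])
        fix s assume s: "0 < s" "s < R"
        have "\<bar>?f3 s\<bar> = \<bar>jump r b1 b2 s\<bar> * (?w s * \<bar>Y s\<bar>)" by (simp add: abs_mult)
        also have "\<dots> \<le> K * (N / sqrt (2 * l))"
          using K(1,2) Ybound[of s] s by (intro mult_mono) auto
        finally show "\<bar>?f3 s\<bar> \<le> K * (N / sqrt (2 * l))" .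
      qed (use R in simp)
      with low show ?thesis by linarith
    qed
    have n4: "nrm2 ?M ?f4 \<le> (1 - \<rho>) / 4 * N"
    proof -
      have "nrm2 ?M ?f4 \<le> K * (N / sqrt (2 * l)) * sqrt R"
      proof (rule nrm2_leb_bounded[OF s4 _ KN])
        fix s assume s: "0 < s" "s < R"
        have "\<bar>?f4 s\<bar> = \<bar>jump r c1 c2 s\<bar> * (?w s * \<bar>Y (s / q)\<bar>)" by (simp add: abs_mult)
        also have "\<dots> \<le> K * (N / sqrt (2 * l))"
          using K(1,3) Yqbound[of s] s by (intro mult_mono) auto
        finally show "\<bar>?f4 s\<bar> \<le> K * (N / sqrt (2 * l))" .
      qed (use R in simp)
      with low show ?thesis by linarith
    qed
    have n2: "nrm2 ?M ?f2 \<le> \<rho> * N"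
    proof -
      let ?u = "\<lambda>s. ?w s * U s"
      have us: "sq_int ?M ?u" by (intro sq_int_exp_mult Us)
      have Rq: "R / q \<le> R" using R q by (simp add: divide_le_eq mult_le_cancel_left1)
      have us': "sq_int (leb 0 (R / q)) ?u" by (rule sq_int_leb_mono[OF us]) (use Rq in auto)
      have "nrm2 ?M ?f2 \<le> nrm2 ?M (\<lambda>s. \<rho> / sqrt q * ?u (s / q))"
      proof (rule nrm2_mono_AE[OF s2], rule sq_int_cmult, rule sq_int_dilate'[OF us q])
        have "\<bar>?f2 s\<bar> \<le> \<bar>\<rho> / sqrt q * ?u (s / q)\<bar>" if s: "0 < s" "s < R" for s
        proof -
          \<comment> \<open>Before the vertex, moving the decreasing weight from s to s / q costs
            nothing and |a1| is small enough by itself. After the vertex the move gains an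
            exponential factor that beats |a2|. The denominator sqrt q cancels the norm of the
            dilation in the next steps.\<close>
          have "?w s * \<bar>jump r a1 a2 s\<bar> \<le> \<rho> / sqrt q * ?w (s / q)"
          proof (cases "s < r")
            case True
            have "s / q \<le> s" using s q by (simp add: divide_le_eq mult_le_cancel_left1)
            then have "?w s \<le> ?w (s / q)" using mult_left_mono[of "s / q" s l] l by simp
            moreover have "\<bar>a1\<bar> \<le> \<rho> / sqrt q" using \<rho>(3) sq by (simp add: pos_le_divide_eq)
            ultimately have "?w s * \<bar>a1\<bar> \<le> ?w (s / q) * (\<rho> / sqrt q)" by (intro mult_mono) auto
            then show ?thesis using True by (simp add: jump_def mult.commute)
          next
            case False
            have "r * (1 - 1 / q) \<le> s * (1 - 1 / q)" using False q by (intro mult_right_mono) auto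
            then have "l * (r * (1 - 1 / q)) \<le> l * (s * (1 - 1 / q))"
              using l by (intro mult_left_mono) auto
            then have e: "exp (- (l * (s * (1 - 1 / q)))) \<le> exp (- (l * (r * (1 - 1 / q))))" by simp
            have "?w s = ?w (s / q) * exp (- (l * (s * (1 - 1 / q))))"
              by (simp add: exp_add[symmetric] algebra_simps)
            also have "\<dots> \<le> ?w (s / q) * exp (- (l * (r * (1 - 1 / q))))"
              using e by (intro mult_left_mono) auto
            finally have "?w s * \<bar>a2\<bar> \<le> ?w (s / q) * exp (- (l * (r * (1 - 1 / q)))) * \<bar>a2\<bar>"
              by (intro mult_right_mono) auto
            also have "\<dots> = ?w (s / q) * (\<bar>a2\<bar> * exp (- (l * (r * (1 - 1 / q)))))" by simp
            also have "\<dots> \<le> ?w (s / q) * (\<rho> / sqrt q)" using l(2) by (intro mult_left_mono) auto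
            finally show ?thesis using False by (simp add: jump_def mult.commute)
          qed
          then have "?w s * \<bar>jump r a1 a2 s\<bar> * \<bar>U (s / q)\<bar> \<le> \<rho> / sqrt q * ?w (s / q) * \<bar>U (s / q)\<bar>"
            by (rule mult_right_mono) simp
          then show ?thesis using \<rho> sq by (simp add: abs_mult mult.assoc)
        qed
        then show "AE s in ?M. \<bar>?f2 s\<bar> \<le> \<bar>\<rho> / sqrt q * ?u (s / q)\<bar>" by (rule AE_leb_I)
      qed (use R in simp)
      also have "\<dots> = \<rho> / sqrt q * nrm2 ?M (\<lambda>s. ?u (s / q))"
        using \<rho> sq by (subst nrm2_cmult) simp
      also have "nrm2 ?M (\<lambda>s. ?u (s / q)) = sqrt q * nrm2 (leb 0 (R / q)) ?u"
        using nrm2_dilate[OF us', of q] q by simp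
      also have "\<rho> / sqrt q * \<dots> = \<rho> * nrm2 (leb 0 (R / q)) ?u" using sq by simp
      also have "\<dots> \<le> \<rho> * N"
        unfolding N_def using \<rho> Rq by (intro mult_left_mono nrm2_leb_mono us) auto
      finally show ?thesis .
    qed
    have n1: "nrm2 ?M ?f1 \<le> nrm2 ?M ?g"
    proof (rule nrm2_mono_AE[OF s1 gs])
      have "\<bar>?f1 s\<bar> \<le> \<bar>?g s\<bar>" if "0 < s" "s < R" for s
        using that l by (simp add: abs_mult mult_left_le_one_le)
      then show "AE s in ?M. \<bar>?f1 s\<bar> \<le> \<bar>?g s\<bar>" by (rule AE_leb_I)
    qed
    \<comment> \<open>The definition of \<open>pant\<close> solved for U and multiplied by the
      weight.\<close>
    have "(\<lambda>s. ?w s * U s) = (\<lambda>s. ?f1 s - ?f2 s - ?f3 s - ?f4 s)"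
      by (simp add: pant_def algebra_simps)
    then have "N = nrm2 ?M (\<lambda>s. ?f1 s - ?f2 s - ?f3 s - ?f4 s)" by (simp only: N_def)
    also have "\<dots> \<le> nrm2 ?M ?f1 + nrm2 ?M ?f2 + nrm2 ?M ?f3 + nrm2 ?M ?f4"
      by (rule nrm2_diff4_le[OF s1 s2 s3 s4])
    also have "\<dots> \<le> nrm2 ?M ?g + \<rho> * N + (1 - \<rho>) / 4 * N + (1 - \<rho>) / 4 * N"
      using n1 n2 n3 n4 by linarith
    finally have "(1 - \<rho>) / 2 * N \<le> nrm2 ?M ?g" by (simp add: field_simps)
    then have N: "N \<le> 2 / (1 - \<rho>) * nrm2 ?M ?g" using \<rho> by (simp add: field_simps)
    have "nrm2 ?M U \<le> nrm2 ?M (\<lambda>s. exp (l * R) * (?w s * U s))"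
    proof (rule nrm2_mono_AE[OF Us sq_int_cmult[OF sq_int_exp_mult[OF Us]]])
      have "\<bar>U s\<bar> \<le> \<bar>exp (l * R) * (?w s * U s)\<bar>" if "0 < s" "s < R" for s
      proof -
        have "l * s \<le> l * R" using that l by (intro mult_left_mono) auto
        then have "1 \<le> exp (l * R) * ?w s" by (simp add: exp_add[symmetric])
        then have "1 * \<bar>U s\<bar> \<le> exp (l * R) * ?w s * \<bar>U s\<bar>" by (intro mult_right_mono) auto
        then show ?thesis by (simp add: abs_mult mult.assoc)
      qed
      then show "AE s in ?M. \<bar>U s\<bar> \<le> \<bar>exp (l * R) * (?w s * U s)\<bar>" by (rule AE_leb_I)
    qed
    also have "\<dots> = exp (l * R) * N" by (subst nrm2_cmult) (simp add: N_def)
    also have "\<dots> \<le> exp (l * R) * (2 / (1 - \<rho>) * nrm2 ?M ?g)" using N by (intro mult_left_mono) auto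
    finally show ?thesis by (simp add: C_def mult.assoc)
  qed
  moreover have "C \<ge> 0" using \<rho> by (simp add: C_def)
  ultimately show ?thesis by blast
qed

text \<open>With the weight \<open>exp (l * s / q)\<close> and \<open>l\<close> large, the delayed derivative dominates.\<close>

lemma pantograph_backward_estimate:
  fixes a1 b1 c1 a2 b2 c2 :: real
  assumes r: "0 < r" "r < S" and q: "1 < q" and a1: "\<bar>a1\<bar> * sqrt q > 1" and a2: "a2 \<noteq> 0"
  shows "\<exists>C\<ge>0. \<forall>U Y. ac_deriv 0 (q * S) Y U \<longrightarrow> (\<forall>t\<in>{S..q * S}. Y t = 0) \<longrightarrow>
    nrm2 (leb 0 (q * S)) U \<le> C * nrm2 (leb 0 (q * S)) (pant r q (a1, b1, c1) (a2, b2, c2) U Y)"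
proof -
  define R where "R = q * S"
  have a1': "\<bar>a1\<bar> > 0" using a1 by (cases "a1 = 0") auto
  \<comment> \<open>Now the midpoint of 1 / (|a1| * sqrt q) and 1, because the expression will be
    divided by the coefficient of the delayed derivative.\<close>
  define \<rho> where "\<rho> = (1 + 1 / (\<bar>a1\<bar> * sqrt q)) / 2"
  define x where "x = 1 / (\<bar>a1\<bar> * sqrt q)"
  have "x < 1" "0 < x" using a1 by (auto simp: x_def)
  moreover have "\<rho> = (1 + x) / 2" by (simp add: \<rho>_def x_def)
  ultimately have "0 < \<rho>" "\<rho> < 1" "x \<le> \<rho>" by auto
  then have \<rho>: "0 < \<rho>" "\<rho> < 1" "1 / (\<bar>a1\<bar> * sqrt q) \<le> \<rho>" by (auto simp: x_def)
  have sq: "sqrt q > 0" using q by simp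
  have R: "R > 0" "S < R" using r q by (auto simp: R_def)
  define K where "K = max (max \<bar>b1 / a1\<bar> \<bar>b2 / a2\<bar>) (max \<bar>c1 / a1\<bar> \<bar>c2 / a2\<bar>)"
  have K: "K \<ge> 0" "\<bar>jump r (b1 / a1) (b2 / a2) s\<bar> \<le> K" "\<bar>jump r (c1 / a1) (c2 / a2) s\<bar> \<le> K" for s
    by (simp add: K_def le_max_iff_disj, (rule order_trans[OF abs_jump_le], simp only: K_def max.cobounded1 max.cobounded2)+)
  define A where "A = max \<bar>1 / a1\<bar> \<bar>1 / a2\<bar>"
  have A: "A \<ge> 0" "\<bar>jump r (1 / a1) (1 / a2) s\<bar> \<le> A" for s
    by (simp add: A_def le_max_iff_disj, simp only: A_def abs_jump_le)
  \<comment> \<open>Again the weight gains on delays of at least \<open>r * (1 - 1 / q)\<close>,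
    here to offset the size of 1 / |a2|. The bounds carry sqrt q because the final inequality has
    sqrt q * N on its left.\<close>
  obtain l where l: "l > 0" "1 / \<bar>a2\<bar> * exp (- (l * (r * (1 - 1 / q)))) \<le> \<rho> * sqrt q"
      "K * sqrt (R / (2 * l)) \<le> sqrt q * (1 - \<rho>) / 4"
    using ex_large_weight[of "1 / \<bar>a2\<bar>" K "r * (1 - 1 / q)" "\<rho> * sqrt q" "sqrt q * (1 - \<rho>) / 4" R]
      K(1) r q \<rho> sq R by auto
  define C where "C = 2 / (sqrt q * (1 - \<rho>)) * (exp (l * S) * A)"
  have "nrm2 (leb 0 R) U \<le> C * nrm2 (leb 0 R) (pant r q (a1, b1, c1) (a2, b2, c2) U Y)"
    if Y: "ac_deriv 0 R Y U" and Y0: "\<forall>t\<in>{S..R}. Y t = 0" for U Y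
  proof -
    let ?M = "leb 0 R" and ?w = "\<lambda>s. exp (l * s)" and ?v = "\<lambda>s. exp (l / q * s)"
    let ?g = "pant r q (a1, b1, c1) (a2, b2, c2) U Y"
    note Us = ac_deriv_sq_int[OF Y] and Ys = ac_deriv_sq_int'[OF Y]
    have vw: "?v s = ?w (s / q)" for s by simp
    have v_le: "?v s \<le> ?w s" if "0 \<le> s" for s
    proof -
      have "s / q \<le> s" using that q by (simp add: divide_le_eq mult_le_cancel_left1)
      then show ?thesis using mult_left_mono[of "s / q" s l] l by simp
    qed
    define N where "N = nrm2 ?M (\<lambda>s. ?w s * U s)"
    have N0: "N \<ge> 0" by (simp add: N_def)
    have gs: "sq_int ?M ?g" using R q by (intro sq_int_pant Us Ys) auto
    have Uq: "sq_int ?M (\<lambda>s. U (s / q))" and Yq: "sq_int ?M (\<lambda>s. Y (s / q))"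
      using R q by (auto intro!: sq_int_dilate' Us Ys)
    \<comment> \<open>Y vanishes on [S, R], hence so does U almost everywhere there, and all of N
      comes from (0, S). The dilation by q maps (0, S) exactly onto (0, R), so the delayed
      derivative on (0, R) sees the whole of U; this is why the interval has length q * S.\<close>
    have U0: "AE s in leb S R. U s = 0"
    proof (rule ac_deriv_0_imp_AE_0)
      have "ac_deriv S R Y U" by (rule ac_deriv_mono[OF Y]) (use r in auto)
      then show "ac_deriv S R (\<lambda>t. 0) U" by (rule ac_deriv_cong) (use Y0 in auto)
    qed (use R in simp)
    let ?f1 = "\<lambda>s. ?v s * (jump r (1 / a1) (1 / a2) s * ?g s)" and ?f2 = "\<lambda>s. ?v s * (jump r (1 / a1) (1 / a2) s * U s)"
      and ?f3 = "\<lambda>s. ?v s * (jump r (b1 / a1) (b2 / a2) s * Y s)"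
      and ?f4 = "\<lambda>s. ?v s * (jump r (c1 / a1) (c2 / a2) s * Y (s / q))"
    have s1: "sq_int ?M ?f1" and s2: "sq_int ?M ?f2" and s3: "sq_int ?M ?f3" and s4: "sq_int ?M ?f4"
      by (intro sq_int_exp_mult sq_int_jump_mult gs Us Ys Uq Yq)+
    have Ybound: "?w s * \<bar>Y s\<bar> \<le> N / sqrt (2 * l)" if s: "0 \<le> s" "s \<le> R" for s
    proof (cases "s \<le> S")
      case True
      show ?thesis
      proof (rule power2_le_imp_le)
        \<comment> \<open>Here Y is integrated backwards from \<open>Y S = 0\<close>, hence \<mu> =
          - l in the weighted inequality.\<close>
        have "- Y s = (LINT x|leb s S. U x)"
          using ac_deriv_diff_eq[OF Y, of s S] Y0 s True R by simp
        then have "(- Y s)\<^sup>2 \<le> (exp (2 * (- l) * S) - exp (2 * (- l) * s)) / (2 * (- l)) * N\<^sup>2"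
          using weighted_Cauchy_Schwarz[OF Us, of s S "- l"] s l True R by (simp add: N_def)
        also have "(exp (2 * (- l) * S) - exp (2 * (- l) * s)) / (2 * (- l)) \<le> exp (- (2 * l * s)) / (2 * l)"
          using l by (simp add: field_simps)
        finally have "(Y s)\<^sup>2 \<le> exp (- (2 * l * s)) / (2 * l) * N\<^sup>2"
          by (simp add: mult_right_mono)
        then have "(?w s)\<^sup>2 * (Y s)\<^sup>2 \<le> (?w s)\<^sup>2 * (exp (- (2 * l * s)) / (2 * l) * N\<^sup>2)"
          by (intro mult_left_mono) auto
        also have "\<dots> = ((?w s)\<^sup>2 * exp (- (2 * l * s))) * (N\<^sup>2 / (2 * l))"
          by simp
        also have "(?w s)\<^sup>2 * exp (- (2 * l * s)) = 1"
          by (simp add: power2_eq_square exp_add[symmetric])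
        finally show "(?w s * \<bar>Y s\<bar>)\<^sup>2 \<le> (N / sqrt (2 * l))\<^sup>2"
          using l by (simp add: power_mult_distrib power_divide)
      qed (use N0 l in simp)
    qed (use Y0 s N0 l in simp)
    have low: "K * (N / sqrt (2 * l)) * sqrt R \<le> sqrt q * (1 - \<rho>) / 4 * N"
    proof -
      have "K * (N / sqrt (2 * l)) * sqrt R = K * sqrt (R / (2 * l)) * N"
        by (simp add: real_sqrt_divide)
      also have "\<dots> \<le> sqrt q * (1 - \<rho>) / 4 * N" using l(3) N0 by (rule mult_right_mono)
      finally show ?thesis .
    qed
    have KN: "0 \<le> K * (N / sqrt (2 * l))" using K(1) N0 l by simp
    have n3: "nrm2 ?M ?f3 \<le> sqrt q * (1 - \<rho>) / 4 * N"
    proof -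
      have "nrm2 ?M ?f3 \<le> K * (N / sqrt (2 * l)) * sqrt R"
      proof (rule nrm2_leb_bounded[OF s3 _ KN])
        fix s assume s: "0 < s" "s < R"
        have "?v s * \<bar>Y s\<bar> \<le> ?w s * \<bar>Y s\<bar>" using v_le[of s] s by (intro mult_right_mono) auto
        also have "\<dots> \<le> N / sqrt (2 * l)" using s by (intro Ybound) auto
        finally have Yv: "?v s * \<bar>Y s\<bar> \<le> N / sqrt (2 * l)" .
        have "\<bar>?f3 s\<bar> = \<bar>jump r (b1 / a1) (b2 / a2) s\<bar> * (?v s * \<bar>Y s\<bar>)" by (simp add: abs_mult)
        also have "\<dots> \<le> K * (N / sqrt (2 * l))"
          using K(1,2) Yv by (intro mult_mono) auto
        finally show "\<bar>?f3 s\<bar> \<le> K * (N / sqrt (2 * l))" .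
      qed (use R in simp)
      with low show ?thesis by linarith
    qed
    have n4: "nrm2 ?M ?f4 \<le> sqrt q * (1 - \<rho>) / 4 * N"
    proof -
      have "nrm2 ?M ?f4 \<le> K * (N / sqrt (2 * l)) * sqrt R"
      proof (rule nrm2_leb_bounded[OF s4 _ KN])
        fix s assume s: "0 < s" "s < R"
        have "s / q \<le> s" using s q by (simp add: divide_le_eq mult_le_cancel_left1)
        then have "?w (s / q) * \<bar>Y (s / q)\<bar> \<le> N / sqrt (2 * l)" using s q by (intro Ybound) auto
        then have Yv: "?v s * \<bar>Y (s / q)\<bar> \<le> N / sqrt (2 * l)" unfolding vw .
        have "\<bar>?f4 s\<bar> = \<bar>jump r (c1 / a1) (c2 / a2) s\<bar> * (?v s * \<bar>Y (s / q)\<bar>)" by (simp add: abs_mult)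
        also have "\<dots> \<le> K * (N / sqrt (2 * l))"
          using K(1,3) Yv by (intro mult_mono) auto
        finally show "\<bar>?f4 s\<bar> \<le> K * (N / sqrt (2 * l))" .
      qed (use R in simp)
      with low show ?thesis by linarith
    qed
    have us: "sq_int ?M (\<lambda>s. ?w s * U s)" by (intro sq_int_exp_mult Us)
    have n2: "nrm2 ?M ?f2 \<le> \<rho> * sqrt q * N"
    proof -
      have "nrm2 ?M ?f2 \<le> nrm2 ?M (\<lambda>s. \<rho> * sqrt q * (?w s * U s))"
      proof (rule nrm2_mono_AE[OF s2 sq_int_cmult[OF us]])
        have "\<bar>?f2 s\<bar> \<le> \<bar>\<rho> * sqrt q * (?w s * U s)\<bar>" if s: "0 < s" "s < R" for s
        proof -
          have "?v s * \<bar>jump r (1 / a1) (1 / a2) s\<bar> \<le> \<rho> * sqrt q * ?w s"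
          proof (cases "s < r")
            case True
            have "1 / \<bar>a1\<bar> = 1 / (\<bar>a1\<bar> * sqrt q) * sqrt q" using sq by simp
            also have "\<dots> \<le> \<rho> * sqrt q" using \<rho>(3) sq by (intro mult_right_mono) auto
            finally have "?v s * (1 / \<bar>a1\<bar>) \<le> ?w s * (\<rho> * sqrt q)"
              using v_le[of s] s by (intro mult_mono) auto
            then show ?thesis using True by (simp add: jump_def mult.commute abs_divide)
          next
            case False
            have "r * (1 - 1 / q) \<le> s * (1 - 1 / q)" using False q by (intro mult_right_mono) auto
            then have "l * (r * (1 - 1 / q)) \<le> l * (s * (1 - 1 / q))"
              using l by (intro mult_left_mono) auto
            then have e: "exp (- (l * (s * (1 - 1 / q)))) \<le> exp (- (l * (r * (1 - 1 / q))))" by simp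
            have "?v s = ?w s * exp (- (l * (s * (1 - 1 / q))))"
              by (simp add: exp_add[symmetric] algebra_simps)
            also have "\<dots> \<le> ?w s * exp (- (l * (r * (1 - 1 / q))))"
              using e by (intro mult_left_mono) auto
            finally have "?v s * (1 / \<bar>a2\<bar>) \<le> ?w s * exp (- (l * (r * (1 - 1 / q)))) * (1 / \<bar>a2\<bar>)"
              by (intro mult_right_mono) auto
            also have "\<dots> = ?w s * (1 / \<bar>a2\<bar> * exp (- (l * (r * (1 - 1 / q)))))" by simp
            also have "\<dots> \<le> ?w s * (\<rho> * sqrt q)" using l(2) by (intro mult_left_mono) auto
            finally show ?thesis using False by (simp add: jump_def mult.commute abs_divide)
          qed
          then have "?v s * \<bar>jump r (1 / a1) (1 / a2) s\<bar> * \<bar>U s\<bar> \<le> \<rho> * sqrt q * ?w s * \<bar>U s\<bar>"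
            by (rule mult_right_mono) simp
          then show ?thesis using \<rho> sq by (simp add: abs_mult mult.assoc)
        qed
        then show "AE s in ?M. \<bar>?f2 s\<bar> \<le> \<bar>\<rho> * sqrt q * (?w s * U s)\<bar>" by (rule AE_leb_I)
      qed
      also have "\<dots> = \<rho> * sqrt q * N" using \<rho> sq by (subst nrm2_cmult) (simp add: N_def abs_mult)
      finally show ?thesis .
    qed
    have n1: "nrm2 ?M ?f1 \<le> exp (l * S) * A * nrm2 ?M ?g"
    proof -
      have "nrm2 ?M ?f1 \<le> nrm2 ?M (\<lambda>s. exp (l * S) * A * ?g s)"
      proof (rule nrm2_mono_AE[OF s1 sq_int_cmult[OF gs]])
        have "\<bar>?f1 s\<bar> \<le> \<bar>exp (l * S) * A * ?g s\<bar>" if s: "0 < s" "s < R" for s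
        proof -
          \<comment> \<open>The increasing weight stays bounded on the data because it is evaluated
            at s / q, which does not exceed S.\<close>
          have "s / q \<le> S" using s q by (simp add: R_def divide_le_eq mult.commute)
          then have "?v s \<le> exp (l * S)" using mult_left_mono[of "s / q" S l] l by simp
          then have "?v s * (\<bar>jump r (1 / a1) (1 / a2) s\<bar> * \<bar>?g s\<bar>) \<le> exp (l * S) * (A * \<bar>?g s\<bar>)"
            using A by (intro mult_mono) auto
          then show ?thesis using A(1) by (simp add: abs_mult mult.assoc)
        qed
        then show "AE s in ?M. \<bar>?f1 s\<bar> \<le> \<bar>exp (l * S) * A * ?g s\<bar>" by (rule AE_leb_I)
      qed
      then show ?thesis using A(1) by (subst (asm) nrm2_cmult) (simp add: abs_mult)
    qed
    have "sqrt q * N = nrm2 ?M (\<lambda>s. ?v s * U (s / q))"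
    proof -
      have S_us: "sq_int (leb 0 S) (\<lambda>s. ?w s * U s)" by (rule sq_int_leb_mono[OF us]) (use R in auto)
      have "nrm2 (leb S R) (\<lambda>s. ?w s * U s) = 0"
      proof -
        have "(LINT s|leb S R. (?w s * U s)\<^sup>2) = (LINT s|leb S R. 0)"
        proof (rule integral_cong_AE)
          have "sq_int (leb S R) (\<lambda>s. ?w s * U s)" by (rule sq_int_leb_mono[OF us]) (use r in auto)
          then show "(\<lambda>s. (?w s * U s)\<^sup>2) \<in> borel_measurable (leb S R)"
            by (rule borel_measurable_integrable[OF sq_int_integrable])
          show "AE s in leb S R. (?w s * U s)\<^sup>2 = 0" using U0 by eventually_elim simp
        qed simp
        then show ?thesis by (simp add: nrm2_def)
      qed
      then have "N\<^sup>2 = (nrm2 (leb 0 S) (\<lambda>s. ?w s * U s))\<^sup>2"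
        unfolding N_def by (subst nrm2_leb_split[OF us, of S]) (use r R in auto)
      then have "N = nrm2 (leb 0 S) (\<lambda>s. ?w s * U s)" using N0 by (simp add: power2_eq_iff_nonneg)
      then show ?thesis
        using nrm2_dilate[OF S_us, of q] q by (simp add: R_def)
    qed
    \<comment> \<open>The definition of \<open>pant\<close> divided by the coefficient of the
      delayed derivative and solved for that derivative; this is where both a1 and a2 have to be
      nonzero.\<close>
    also have "(\<lambda>s. ?v s * U (s / q)) = (\<lambda>s. ?f1 s - ?f2 s - ?f3 s - ?f4 s)"
      using a1' a2 by (auto simp: fun_eq_iff pant_def jump_def field_simps)
    also have "nrm2 ?M \<dots> \<le> nrm2 ?M ?f1 + nrm2 ?M ?f2 + nrm2 ?M ?f3 + nrm2 ?M ?f4"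
      by (rule nrm2_diff4_le[OF s1 s2 s3 s4])
    also have "\<dots> \<le> exp (l * S) * A * nrm2 ?M ?g + \<rho> * sqrt q * N
        + sqrt q * (1 - \<rho>) / 4 * N + sqrt q * (1 - \<rho>) / 4 * N"
      using n1 n2 n3 n4 by linarith
    finally have "sqrt q * (1 - \<rho>) / 2 * N \<le> exp (l * S) * A * nrm2 ?M ?g" by (simp add: field_simps)
    then have N: "N \<le> C * nrm2 ?M ?g"
      using \<rho> sq by (simp add: C_def field_simps)
    have "nrm2 ?M U \<le> N"
      unfolding N_def
    proof (rule nrm2_mono_AE[OF Us us])
      have "\<bar>U s\<bar> \<le> \<bar>?w s * U s\<bar>" if "0 < s" "s < R" for s
        using that l mult_right_mono[of 1 "?w s" "\<bar>U s\<bar>"] by (simp add: abs_mult)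
      then show "AE s in ?M. \<bar>U s\<bar> \<le> \<bar>?w s * U s\<bar>" by (rule AE_leb_I)
    qed
    with N show ?thesis by linarith
  qed
  moreover have "C \<ge> 0" using \<rho> sq A(1) by (simp add: C_def)
  ultimately show ?thesis unfolding R_def by blast
qed

section \<open>The star graph\<close>

lemma sq_int_shift:
  assumes "sq_int (leb 0 S) f" shows "sq_int (leb d (d + S)) (\<lambda>s. f (s - d))"
  using sq_int_leb_affine[of 1 d "- d" "d + S" f] assms by simp

lemma nrm2_shift:
  assumes "sq_int (leb 0 S) f"
  shows "nrm2 (leb d (d + S)) (\<lambda>s. f (s - d)) = nrm2 (leb 0 S) f"
  using leb_affine_subst(3)[of 1 "\<lambda>t. (f t)\<^sup>2" d "- d" "d + S"]
    borel_measurable_integrable[OF sq_int_integrable[OF assms]]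
  by (simp add: nrm2_def)

locale star_graph =
  fixes m :: nat and q :: real and T a b c \<alpha> :: "nat \<Rightarrow> real"
  assumes m: "m \<ge> 2" and q: "q > 1" and T1: "T 1 > 0"
    and Tj: "\<And>j. j \<in> {2..m} \<Longrightarrow> T j > (q - 1) * T 1"
    and \<alpha>: "\<And>j. j \<in> {1..m} \<Longrightarrow> \<alpha> j > 0"
    and a1: "\<bar>a 1\<bar> \<noteq> q powr (- 1 / 2)"
    and a_sum: "(\<Sum>j=2..m. \<bar>a j\<bar>) > 0"
begin

declare One_nat_def [simp del]

lemma sum_edges: "(\<Sum>j=1..m. f j) = f 1 + (\<Sum>j=2..m. f j)" for f :: "nat \<Rightarrow> real"
  using m by (simp add: sum.atLeast_Suc_atMost numeral_2_eq_2 One_nat_def)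

lemma edge_cases:
  assumes "j \<in> {1..m}" obtains "j = 1" | "j \<in> {2..m}" "j \<noteq> 1"
  using assms by fastforce

lemma edge_1: "1 \<in> {1..m}"
  using m by auto

lemma edge_2: "j \<in> {2..m} \<Longrightarrow> j \<in> {1..m}" "j \<in> {2..m} \<Longrightarrow> j \<noteq> 1"
  by auto

lemma T_pos: "j \<in> {1..m} \<Longrightarrow> T j > 0"
proof (erule edge_cases)
  assume "j \<in> {2..m}"
  then have "T j > (q - 1) * T 1" by (rule Tj)
  moreover have "(q - 1) * T 1 > 0" using q T1 by simp
  ultimately show "T j > 0" by linarith
qed (use T1 in simp)

abbreviation l :: "nat \<Rightarrow> real" where "l \<equiv> edge_l q T"

lemma l_1 [simp]: "l 1 = T 1"
  by (simp add: edge_l_def)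

text \<open>By the last identity, dilation by q carries the part of the path where y may be nonzero,
  of length T 1 + l j, onto the whole path of length T 1 + T j. It matches the backward estimate
  with S = T 1 + l j and gives the range of the substitution in the delayed terms.\<close>

lemma l_2:
  assumes j: "j \<in> {2..m}"
  shows "q * l j = T j - (q - 1) * T 1" "0 < l j" "l j < T j" "q * (T 1 + l j) = T 1 + T j"
proof -
  show 1: "q * l j = T j - (q - 1) * T 1" using j q by (simp add: edge_l_def)
  then have "0 < q * l j" using Tj[OF j] by simp
  then show 0: "0 < l j" using q by (simp add: zero_less_mult_iff)
  then have "1 * l j < q * l j" using q by (intro mult_strict_right_mono) auto
  moreover have "(q - 1) * T 1 > 0" using q T1 by simp
  ultimately show "l j < T j" using 1 by linarith
  show "q * (T 1 + l j) = T 1 + T j" using 1 by (simp add: algebra_simps)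
qed

lemma l_bounds:
  assumes "j \<in> {1..m}" shows "0 < l j" "l j \<le> T j"
  using assms by (cases rule: edge_cases; use l_2[of j] T1 in simp)+

section \<open>The expressions on a path of two edges\<close>

text \<open>\<open>ell\<close> with the derivative u as an independent argument. In this form the
  expression is linear pointwise, whereas \<open>ell\<close> goes through the chosen
  \<open>weak_deriv\<close>.\<close>

definition lop :: "(nat \<Rightarrow> real \<Rightarrow> real) \<Rightarrow> (nat \<Rightarrow> real \<Rightarrow> real) \<Rightarrow> nat \<Rightarrow> real \<Rightarrow> real" where
  "lop u y j t = u j t + a j * delay_ext T u j (delayed_arg q T j t)
     + b j * y j t + c j * delay_ext T y j (delayed_arg q T j t)"

lemma ell_eq_lop: "ell q T a b c y = lop (star_deriv T y) y"
  by (simp add: fun_eq_iff ell_def lop_def)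

text \<open>The vertex s = T 1 is assigned to edge j, in accordance with \<open>delay_ext\<close>,
  which passes to edge 1 only for t < 0; thus \<open>delay_path\<close> holds at every
  point.\<close>

definition path :: "(nat \<Rightarrow> real \<Rightarrow> real) \<Rightarrow> nat \<Rightarrow> real \<Rightarrow> real" where
  "path f j s = (if s < T 1 then f 1 s else f j (s - T 1))"

text \<open>In the variable s = t + T 1 the delayed argument on edge j is s / q - T 1, so the global
  delay convention is just evaluation of the concatenation at s / q.\<close>

lemma delay_path:
  assumes "j \<in> {2..m}"
  shows "delay_ext T f j (delayed_arg q T j t) = path f j ((t + T 1) / q)"
proof -
  have "(t - (q - 1) * T 1) / q = (t + T 1) / q - T 1" using q by (simp add: field_simps)
  then show ?thesis using assms by (auto simp: delay_ext_def delayed_arg_def path_def)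
qed

lemma delay_1: "delay_ext T f 1 (delayed_arg q T 1 t) = f 1 (t / q)"
  by (simp add: delay_ext_def delayed_arg_def)

text \<open>For s < T 1 the delayed point s / q stays on the first edge because s is positive.
  Beyond the vertex it may lie on either edge, and \<open>path\<close> makes the
  distinction.\<close>

lemma path_lop:
  assumes j: "j \<in> {2..m}" and s: "0 < s"
  shows "path (lop u y) j s
    = pant (T 1) q (a 1, b 1, c 1) (a j, b j, c j) (path u j) (path y j) s"
proof (cases "s < T 1")
  case True
  have "s / q \<le> s" using s q by (simp add: divide_le_eq mult_le_cancel_left1)
  then show ?thesis using True
    unfolding pant_def path_def lop_def delay_1 by (simp add: jump_def)
next
  case False
  then show ?thesis
    unfolding pant_def lop_def path_def[of "lop u y"]
    by (simp add: lop_def delay_path[OF j] jump_def path_def[of _ j s])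
qed

definition sqs :: "(nat \<Rightarrow> real \<Rightarrow> real) \<Rightarrow> bool" where
  "sqs f \<longleftrightarrow> (\<forall>j\<in>{1..m}. sq_int (leb 0 (T j)) (f j))"

lemma sqsD: "sqs f \<Longrightarrow> j \<in> {1..m} \<Longrightarrow> sq_int (leb 0 (T j)) (f j)"
  by (simp add: sqs_def)

lemma sq_int_path:
  assumes "sqs f" "j \<in> {2..m}"
  shows "sq_int (leb 0 (T 1 + T j)) (path f j)"
    "(nrm2 (leb 0 (T 1 + T j)) (path f j))\<^sup>2 = (nrm2 (leb 0 (T 1)) (f 1))\<^sup>2 + (nrm2 (leb 0 (T j)) (f j))\<^sup>2"
proof -
  have j: "j \<in> {1..m}" using assms by (simp add: edge_2)
  note f1 = sqsD[OF assms(1) edge_1] and fj = sqsD[OF assms(1) j]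
  have 1: "sq_int (leb 0 (T 1)) (path f j)"
    using f1 by (subst sq_int_leb_cong[where g = "f 1"]) (auto simp: path_def)
  have 2: "sq_int (leb (T 1) (T 1 + T j)) (path f j)"
    using sq_int_shift[OF fj, of "T 1"]
    by (subst sq_int_leb_cong[where g = "\<lambda>s. f j (s - T 1)"]) (auto simp: path_def)
  show 3: "sq_int (leb 0 (T 1 + T j)) (path f j)"
    by (rule sq_int_leb_glue[OF 1 2]) (use T1 T_pos[OF j] in auto)
  have "nrm2 (leb 0 (T 1)) (path f j) = nrm2 (leb 0 (T 1)) (f 1)"
    unfolding nrm2_def by (subst leb_cong(3)[where g = "\<lambda>s. (f 1 s)\<^sup>2"]) (auto simp: path_def)
  moreover have "nrm2 (leb (T 1) (T 1 + T j)) (path f j) = nrm2 (leb 0 (T j)) (f j)"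
    unfolding nrm2_shift[OF fj, of "T 1", symmetric] unfolding nrm2_def
    by (subst leb_cong(3)[where g = "\<lambda>s. (f j (s - T 1))\<^sup>2"]) (auto simp: path_def)
  ultimately show "(nrm2 (leb 0 (T 1 + T j)) (path f j))\<^sup>2 = (nrm2 (leb 0 (T 1)) (f 1))\<^sup>2 + (nrm2 (leb 0 (T j)) (f j))\<^sup>2"
    using nrm2_leb_split[OF 3, of "T 1"] T1 T_pos[OF j] by simp
qed

lemma nrm2_path_le:
  assumes "sqs f" "j \<in> {2..m}"
  shows "nrm2 (leb 0 (T 1 + T j)) (path f j) \<le> nrm2 (leb 0 (T 1)) (f 1) + nrm2 (leb 0 (T j)) (f j)"
proof (rule power2_le_imp_le)
  show "(nrm2 (leb 0 (T 1 + T j)) (path f j))\<^sup>2 \<le> (nrm2 (leb 0 (T 1)) (f 1) + nrm2 (leb 0 (T j)) (f j))\<^sup>2"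
    unfolding sq_int_path(2)[OF assms] power2_sum by simp
qed simp

lemma nrm2_le_path:
  assumes "sqs f" "j \<in> {2..m}"
  shows "nrm2 (leb 0 (T 1)) (f 1) \<le> nrm2 (leb 0 (T 1 + T j)) (path f j)"
    "nrm2 (leb 0 (T j)) (f j) \<le> nrm2 (leb 0 (T 1 + T j)) (path f j)"
  by (rule power2_le_imp_le; simp add: sq_int_path(2)[OF assms])+

lemma nrm2_dilate_le:
  assumes f: "sq_int (leb 0 R) f" and R: "0 \<le> R"
  shows "nrm2 (leb 0 R) (\<lambda>s. f (s / q)) \<le> sqrt q * nrm2 (leb 0 R) f"
proof -
  have Rq: "R / q \<le> R" using R q by (simp add: divide_le_eq mult_le_cancel_left1)
  have "sq_int (leb 0 (R / q)) f" by (rule sq_int_leb_mono[OF f]) (use Rq in auto)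
  then have "nrm2 (leb 0 R) (\<lambda>s. f (s / q)) = sqrt q * nrm2 (leb 0 (R / q)) f"
    using nrm2_dilate[of "R / q" f q] q by simp
  also have "\<dots> \<le> sqrt q * nrm2 (leb 0 R) f"
    using q by (intro mult_left_mono nrm2_leb_mono f) (use Rq in auto)
  finally show ?thesis .
qed

text \<open>On edge j the delayed function is, up to the shift by T 1, the dilated concatenation on
  (T 1, T 1 + T j). Enlarging this interval to the whole path bounds it by sqrt q times the norms on
  both edges.\<close>

lemma delay_bound:
  assumes f: "sqs f" and j: "j \<in> {1..m}"
  shows "sq_int (leb 0 (T j)) (\<lambda>t. delay_ext T f j (delayed_arg q T j t))"
    "nrm2 (leb 0 (T j)) (\<lambda>t. delay_ext T f j (delayed_arg q T j t))
      \<le> sqrt q * (nrm2 (leb 0 (T 1)) (f 1) + nrm2 (leb 0 (T j)) (f j))"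
  using j
proof (atomize (full), cases rule: edge_cases)
  case 1
  have "sq_int (leb 0 (T 1)) (\<lambda>t. f 1 (t / q))"
    using sqsD[OF f edge_1] q T1 by (intro sq_int_dilate') auto
  moreover have "nrm2 (leb 0 (T 1)) (\<lambda>t. f 1 (t / q)) \<le> sqrt q * (nrm2 (leb 0 (T 1)) (f 1) + nrm2 (leb 0 (T 1)) (f 1))"
    by (rule order_trans[OF nrm2_dilate_le[OF sqsD[OF f edge_1]]]) (use T1 q in auto)
  ultimately show "sq_int (leb 0 (T j)) (\<lambda>t. delay_ext T f j (delayed_arg q T j t)) \<and>
    nrm2 (leb 0 (T j)) (\<lambda>t. delay_ext T f j (delayed_arg q T j t))
      \<le> sqrt q * (nrm2 (leb 0 (T 1)) (f 1) + nrm2 (leb 0 (T j)) (f j))"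
    unfolding 1 delay_1 by simp
next
  case 2
  let ?R = "T 1 + T j" and ?g = "\<lambda>s. path f j (s / q)"
  have R: "0 \<le> ?R" using T1 T_pos[OF j] by simp
  note p = sq_int_path(1)[OF f 2(1)]
  have gR: "sq_int (leb 0 ?R) ?g" by (rule sq_int_dilate'[OF p q R])
  have g: "sq_int (leb (T 1) ?R) ?g" by (rule sq_int_leb_mono[OF gR]) (use T1 in auto)
  have s: "sq_int (leb 0 (T j)) (\<lambda>t. ?g (t + T 1))"
    using sq_int_leb_affine[of 1 0 "T 1" "T j" ?g] g by (simp add: add.commute)
  have "nrm2 (leb 0 (T j)) (\<lambda>t. ?g (t + T 1)) = nrm2 (leb (T 1) ?R) ?g"
    using nrm2_shift[OF s, of "T 1"] by simp
  also have "\<dots> \<le> nrm2 (leb 0 ?R) ?g" by (rule nrm2_leb_mono[OF gR]) (use T1 in auto)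
  also have "\<dots> \<le> sqrt q * nrm2 (leb 0 ?R) (path f j)" by (rule nrm2_dilate_le[OF p R])
  also have "\<dots> \<le> sqrt q * (nrm2 (leb 0 (T 1)) (f 1) + nrm2 (leb 0 (T j)) (f j))"
    using q by (intro mult_left_mono nrm2_path_le f 2) auto
  finally show "sq_int (leb 0 (T j)) (\<lambda>t. delay_ext T f j (delayed_arg q T j t)) \<and>
    nrm2 (leb 0 (T j)) (\<lambda>t. delay_ext T f j (delayed_arg q T j t))
      \<le> sqrt q * (nrm2 (leb 0 (T 1)) (f 1) + nrm2 (leb 0 (T j)) (f j))"
    using s by (simp add: delay_path[OF 2(1)])
qed

lemma sqs_lop:
  assumes "sqs u" "sqs y" shows "sqs (lop u y)"
  unfolding sqs_def lop_def
  by (intro ballI sq_int_add sq_int_cmult delay_bound assms sqsD[OF assms(1)] sqsD[OF assms(2)])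

lemma nrm2_lop_le:
  assumes u: "sqs u" and y: "sqs y" and j: "j \<in> {1..m}"
  shows "nrm2 (leb 0 (T j)) (lop u y j)
    \<le> (1 + \<bar>a j\<bar> * sqrt q) * (nrm2 (leb 0 (T 1)) (u 1) + nrm2 (leb 0 (T j)) (u j))
      + (\<bar>b j\<bar> + \<bar>c j\<bar> * sqrt q) * (nrm2 (leb 0 (T 1)) (y 1) + nrm2 (leb 0 (T j)) (y j))"
proof -
  let ?N = "nrm2 (leb 0 (T j))" and ?d = "\<lambda>f t. delay_ext T f j (delayed_arg q T j t)"
  have s: "sq_int (leb 0 (T j)) (u j)" "sq_int (leb 0 (T j)) (\<lambda>t. a j * ?d u t)"
    "sq_int (leb 0 (T j)) (\<lambda>t. b j * y j t)" "sq_int (leb 0 (T j)) (\<lambda>t. c j * ?d y t)"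
    by (intro sq_int_cmult delay_bound u y j sqsD[OF u] sqsD[OF y])+
  have "?N (lop u y j) \<le> ?N (\<lambda>t. u j t + a j * ?d u t + b j * y j t) + ?N (\<lambda>t. c j * ?d y t)"
    unfolding lop_def by (intro nrm2_triangle sq_int_add s)
  also have "?N (\<lambda>t. u j t + a j * ?d u t + b j * y j t) \<le> ?N (\<lambda>t. u j t + a j * ?d u t) + ?N (\<lambda>t. b j * y j t)"
    by (intro nrm2_triangle sq_int_add s)
  also have "?N (\<lambda>t. u j t + a j * ?d u t) \<le> ?N (u j) + ?N (\<lambda>t. a j * ?d u t)"
    by (intro nrm2_triangle s)
  finally have "?N (lop u y j) \<le> ?N (u j) + \<bar>a j\<bar> * ?N (?d u) + \<bar>b j\<bar> * ?N (y j) + \<bar>c j\<bar> * ?N (?d y)"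
    by (simp add: nrm2_cmult)
  moreover have "\<bar>a j\<bar> * ?N (?d u) \<le> \<bar>a j\<bar> * (sqrt q * (nrm2 (leb 0 (T 1)) (u 1) + ?N (u j)))"
    by (intro mult_left_mono delay_bound u j) simp
  moreover have "\<bar>c j\<bar> * ?N (?d y) \<le> \<bar>c j\<bar> * (sqrt q * (nrm2 (leb 0 (T 1)) (y 1) + ?N (y j)))"
    by (intro mult_left_mono delay_bound y j) simp
  moreover have "\<bar>b j\<bar> * ?N (y j) \<le> \<bar>b j\<bar> * (nrm2 (leb 0 (T 1)) (y 1) + ?N (y j))"
    by (intro mult_left_mono) auto
  moreover have "0 \<le> nrm2 (leb 0 (T 1)) (u 1)" by simp
  ultimately show ?thesis by (simp only: distrib_right mult.assoc mult_1_left)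
qed

lemma lop_lincomb:
  "lop (\<lambda>j t. x * u j t + z * v j t) (\<lambda>j t. x * y j t + z * w j t)
    = (\<lambda>j t. x * lop u y j t + z * lop v w j t)"
  by (auto simp: fun_eq_iff lop_def delay_ext_def algebra_simps)

section \<open>Admissible functions and coercivity of the quadratic form\<close>

text \<open>Conditions (I) with value k, (C) and (E), for a function y with derivative u.
  \<open>adm 1\<close> holds the competitors of the normalized minimization, \<open>adm 0\<close> is
  the linear space of variations.\<close>

definition adm :: "real \<Rightarrow> (nat \<Rightarrow> real \<Rightarrow> real) \<Rightarrow> (nat \<Rightarrow> real \<Rightarrow> real) \<Rightarrow> bool" where
  "adm k u y \<longleftrightarrow> (\<forall>j\<in>{1..m}. ac_deriv 0 (T j) (y j) (u j)) \<and> y 1 0 = k \<and>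
     (\<forall>j\<in>{2..m}. y j 0 = y 1 (T 1)) \<and> (\<forall>j\<in>{2..m}. \<forall>t\<in>{l j..T j}. y j t = 0)"

lemma admD:
  assumes "adm k u y"
  shows "j \<in> {1..m} \<Longrightarrow> ac_deriv 0 (T j) (y j) (u j)" "y 1 0 = k"
    "j \<in> {2..m} \<Longrightarrow> y j 0 = y 1 (T 1)" "j \<in> {2..m} \<Longrightarrow> l j \<le> t \<Longrightarrow> t \<le> T j \<Longrightarrow> y j t = 0"
  using assms by (auto simp: adm_def)

lemma adm_sqs: "adm k u y \<Longrightarrow> sqs u" "adm k u y \<Longrightarrow> sqs y"
  by (auto simp: sqs_def intro: ac_deriv_sq_int ac_deriv_sq_int' dest: admD(1))

lemma adm_lincomb:
  assumes y: "adm k u y" and w: "adm k' v w"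
  shows "adm (x * k + z * k') (\<lambda>j t. x * u j t + z * v j t) (\<lambda>j t. x * y j t + z * w j t)"
  unfolding adm_def using admD(2-)[OF y] admD(2-)[OF w]
  by (auto intro!: ac_deriv_lincomb admD(1)[OF y] admD(1)[OF w])

lemma path_ac_deriv:
  assumes y: "adm k u y" and j: "j \<in> {2..m}"
  shows "ac_deriv 0 (T 1 + T j) (path y j) (path u j)"
proof (rule ac_deriv_glue)
  show "ac_deriv 0 (T 1) (path y j) (path u j)"
    by (rule ac_deriv_cong[OF admD(1)[OF y edge_1]])
      (use admD(3)[OF y j] in \<open>auto simp: path_def\<close>)
  have "ac_deriv (T 1) (T 1 + T j) (\<lambda>s. y j (s - T 1)) (\<lambda>s. u j (s - T 1))"
    using ac_deriv_shift[OF admD(1)[OF y edge_2(1)[OF j]], of "- T 1"] by (simp add: add.commute)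
  then show "ac_deriv (T 1) (T 1 + T j) (path y j) (path u j)"
    by (rule ac_deriv_cong) (auto simp: path_def)
qed (use T1 T_pos[OF edge_2(1)[OF j]] in auto)

text \<open>The polarized functional: J y is \<open>form (ell y) (ell y)\<close>, and its first
  variation in the direction (v, w) is twice \<open>form (ell y) (lop v w)\<close>.\<close>

definition form :: "(nat \<Rightarrow> real \<Rightarrow> real) \<Rightarrow> (nat \<Rightarrow> real \<Rightarrow> real) \<Rightarrow> real" where
  "form f g = (\<Sum>j=1..m. \<alpha> j * (LINT t|leb 0 (T j). f j t * g j t))"

lemma form_sym: "form f g = form g f"
  by (simp add: form_def mult.commute)

lemma form_lincomb:
  assumes "sqs f" "sqs g" "sqs h"
  shows "form (\<lambda>j t. x * f j t + z * g j t) h = x * form f h + z * form g h"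
proof -
  have "(LINT t|leb 0 (T j). (x * f j t + z * g j t) * h j t)
      = x * (LINT t|leb 0 (T j). f j t * h j t) + z * (LINT t|leb 0 (T j). g j t * h j t)"
    if "j \<in> {1..m}" for j
  proof -
    have "(LINT t|leb 0 (T j). (x * f j t + z * g j t) * h j t)
      = (LINT t|leb 0 (T j). x * (f j t * h j t) + z * (g j t * h j t))"
      by (simp add: algebra_simps)
    then show ?thesis using assms that by (simp add: sq_int_mult sqsD)
  qed
  then show ?thesis
    by (simp add: form_def sum_distrib_left sum.distrib[symmetric] algebra_simps)
qed

lemma nrm2_le_form:
  assumes "j \<in> {1..m}" shows "nrm2 (leb 0 (T j)) (f j) \<le> 1 / sqrt (\<alpha> j) * sqrt (form f f)"
proof -
  have eq: "form f f = (\<Sum>j=1..m. \<alpha> j * (nrm2 (leb 0 (T j)) (f j))\<^sup>2)"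
    unfolding form_def nrm2_sq by (simp add: power2_eq_square)
  have "\<alpha> j * (nrm2 (leb 0 (T j)) (f j))\<^sup>2 \<le> form f f"
    unfolding eq using assms \<alpha> by (intro member_le_sum) (auto simp: less_imp_le)
  then have "sqrt (\<alpha> j * (nrm2 (leb 0 (T j)) (f j))\<^sup>2) \<le> sqrt (form f f)" by simp
  then show ?thesis using \<alpha>[OF assms] by (simp add: real_sqrt_mult pos_le_divide_eq mult.commute)
qed

lemma form_nonneg: "0 \<le> form f f"
  unfolding form_def by (intro sum_nonneg mult_nonneg_nonneg) (auto simp: less_imp_le[OF \<alpha>])

lemma nrm2_path_lop_le:
  assumes "adm k u y" "j \<in> {2..m}"
  shows "nrm2 (leb 0 (T 1 + T j)) (pant (T 1) q (a 1, b 1, c 1) (a j, b j, c j) (path u j) (path y j))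
    \<le> (1 / sqrt (\<alpha> 1) + 1 / sqrt (\<alpha> j)) * sqrt (form (lop u y) (lop u y))"
proof -
  note s = sqs_lop[OF adm_sqs[OF assms(1)]]
  have "nrm2 (leb 0 (T 1 + T j)) (pant (T 1) q (a 1, b 1, c 1) (a j, b j, c j) (path u j) (path y j))
    = nrm2 (leb 0 (T 1 + T j)) (path (lop u y) j)"
    unfolding nrm2_def by (subst leb_cong(3)[where g = "\<lambda>s. (path (lop u y) j s)\<^sup>2"])
      (simp_all add: path_lop[OF assms(2)])
  also have "\<dots> \<le> nrm2 (leb 0 (T 1)) (lop u y 1) + nrm2 (leb 0 (T j)) (lop u y j)"
    by (rule nrm2_path_le[OF s assms(2)])
  also have "\<dots> \<le> 1 / sqrt (\<alpha> 1) * sqrt (form (lop u y) (lop u y)) + 1 / sqrt (\<alpha> j) * sqrt (form (lop u y) (lop u y))"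
    by (intro add_mono nrm2_le_form edge_1 edge_2 assms)
  finally show ?thesis by (simp only: distrib_right)
qed

text \<open>For |a 1| * sqrt q > 1 the path through edge j may fail to admit the backward estimate,
  since a j may be 0. A path through some edge i with a i nonzero then supplies the derivative on
  the first edge, and the derivative on edge j follows from a forward estimate in which the first
  edge carries known data.\<close>

lemma path_coercive:
  assumes j: "j \<in> {2..m}"
  shows "\<exists>C\<ge>0. \<forall>u y. adm 0 u y \<longrightarrow>
    nrm2 (leb 0 (T 1 + T j)) (path u j) \<le> C * sqrt (form (lop u y) (lop u y))"
proof -
  have R: "T 1 \<le> T 1 + T j" if "j \<in> {2..m}" for j using T_pos[OF edge_2(1)[OF that]] by simp
  have p0: "path y j 0 = 0" if "adm 0 u y" for u y j
    using admD(2)[OF that] T1 by (simp add: path_def)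
  have comb: "x \<le> C * y \<Longrightarrow> y \<le> D * z \<Longrightarrow> 0 \<le> C \<Longrightarrow> x \<le> (C * D) * z" for x y z C D :: real
    by (metis mult.assoc mult_left_mono order_trans)
  have sqrt_q: "q powr (- 1 / 2) = 1 / sqrt q"
    using q by (simp add: powr_minus powr_half_sqrt inverse_eq_divide)
  have cases: "\<bar>a 1\<bar> * sqrt q < 1 \<or> \<bar>a 1\<bar> * sqrt q > 1"
  proof -
    have "\<bar>a 1\<bar> \<noteq> 1 / sqrt q" using a1 sqrt_q by simp
    then have "\<bar>a 1\<bar> * sqrt q \<noteq> 1" using q by (simp add: field_simps)
    then show ?thesis by linarith
  qed
  have \<alpha>p: "0 \<le> 1 / sqrt (\<alpha> 1) + 1 / sqrt (\<alpha> j)" if "j \<in> {2..m}" for j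
    using \<alpha>[OF edge_1] \<alpha>[OF edge_2(1)[OF that]] by simp
  show ?thesis
  proof (cases "\<bar>a 1\<bar> * sqrt q < 1")
    case True
    obtain C where C: "C \<ge> 0" "\<And>U Y. ac_deriv 0 (T 1 + T j) Y U \<Longrightarrow> Y 0 = 0 \<Longrightarrow>
      nrm2 (leb 0 (T 1 + T j)) U \<le> C * nrm2 (leb 0 (T 1 + T j)) (pant (T 1) q (a 1, b 1, c 1) (a j, b j, c j) U Y)"
      using pantograph_forward_estimate[OF T1 R[OF j] q True] by blast
    show ?thesis
    proof (intro exI[of _ "C * (1 / sqrt (\<alpha> 1) + 1 / sqrt (\<alpha> j))"] conjI allI impI)
      fix u y assume y: "adm 0 u y"
      show "nrm2 (leb 0 (T 1 + T j)) (path u j)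
          \<le> C * (1 / sqrt (\<alpha> 1) + 1 / sqrt (\<alpha> j)) * sqrt (form (lop u y) (lop u y))"
        by (rule comb[OF C(2)[OF path_ac_deriv[OF y j] p0[OF y]] nrm2_path_lop_le[OF y j] C(1)])
    qed (use C(1) \<alpha>p[OF j] in simp)
  next
    case False
    then have big: "\<bar>a 1\<bar> * sqrt q > 1" using cases by simp
    obtain i where i: "i \<in> {2..m}" "a i \<noteq> 0"
    proof -
      have "\<not> (\<forall>i\<in>{2..m}. a i = 0)"
      proof
        assume "\<forall>i\<in>{2..m}. a i = 0"
        then have "(\<Sum>j=2..m. \<bar>a j\<bar>) = 0" by simp
        then show False using a_sum by simp
      qed
      then show thesis using that by blast
    qed
    have Rq: "q * (T 1 + l i) = T 1 + T i" by (rule l_2(4)[OF i(1)])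
    have "T 1 < T 1 + l i" using l_2(2)[OF i(1)] by simp
    from pantograph_backward_estimate[OF T1 this q big i(2), of "b 1" "c 1" "b i" "c i"]
    obtain C where C: "C \<ge> 0" "\<And>U Y. ac_deriv 0 (T 1 + T i) Y U \<Longrightarrow> (\<forall>t\<in>{T 1 + l i..T 1 + T i}. Y t = 0) \<Longrightarrow>
      nrm2 (leb 0 (T 1 + T i)) U \<le> C * nrm2 (leb 0 (T 1 + T i)) (pant (T 1) q (a 1, b 1, c 1) (a i, b i, c i) U Y)"
      unfolding Rq by blast
    define C1 where "C1 = C * (1 / sqrt (\<alpha> 1) + 1 / sqrt (\<alpha> i))"
    have C1: "nrm2 (leb 0 (T 1)) (u 1) \<le> C1 * sqrt (form (lop u y) (lop u y))" if y: "adm 0 u y" for u y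
    proof -
      have z: "\<forall>t\<in>{T 1 + l i..T 1 + T i}. path y i t = 0"
        using admD(4)[OF y i(1)] l_2(2)[OF i(1)] by (auto simp: path_def)
      have "nrm2 (leb 0 (T 1)) (u 1) \<le> nrm2 (leb 0 (T 1 + T i)) (path u i)"
        by (rule nrm2_le_path[OF adm_sqs(1)[OF y] i(1)])
      also have "\<dots> \<le> C1 * sqrt (form (lop u y) (lop u y))"
        unfolding C1_def
        by (rule comb[OF C(2)[OF path_ac_deriv[OF y i(1)] z] nrm2_path_lop_le[OF y i(1)] C(1)])
      finally show ?thesis .
    qed
    have C1_0: "C1 \<ge> 0" using C(1) \<alpha>p[OF i(1)] by (simp add: C1_def)
    \<comment> \<open>With coefficients 0 on the first edge \<open>pant\<close> reduces there to U,
      which \<open>C1\<close> already controls, and the smallness condition of the forward estimate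
      holds whatever the size of a 1.\<close>
    have "\<bar>0 :: real\<bar> * sqrt q < 1" by simp
    from pantograph_forward_estimate[OF T1 R[OF j] q this, of 0 0 "a j" "b j" "c j"]
    obtain D where D: "D \<ge> 0" "\<And>U Y. ac_deriv 0 (T 1 + T j) Y U \<Longrightarrow> Y 0 = 0 \<Longrightarrow>
      nrm2 (leb 0 (T 1 + T j)) U \<le> D * nrm2 (leb 0 (T 1 + T j)) (pant (T 1) q (0, 0, 0) (a j, b j, c j) U Y)"
      by blast
    show ?thesis
    proof (intro exI[of _ "D * (C1 + 1 / sqrt (\<alpha> j))"] conjI allI impI)
      fix u y assume y: "adm 0 u y"
      \<comment> \<open>The right side belonging to the modified coefficients: the derivative itself
        on edge 1, the expression on the other edges.\<close>
      define h where "h i = (if i = 1 then u 1 else lop u y i)" for i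
      have hs: "sqs h"
        using adm_sqs(1)[OF y] sqs_lop[OF adm_sqs[OF y]] by (auto simp: sqs_def h_def)
      have "nrm2 (leb 0 (T 1 + T j)) (pant (T 1) q (0, 0, 0) (a j, b j, c j) (path u j) (path y j))
        = nrm2 (leb 0 (T 1 + T j)) (path h j)"
        unfolding nrm2_def
      proof (subst leb_cong(3)[where g = "\<lambda>s. (path h j s)\<^sup>2"])
        fix s assume s: "0 < s" "s < T 1 + T j"
        have "pant (T 1) q (0, 0, 0) (a j, b j, c j) (path u j) (path y j) s = path h j s"
        proof (cases "s < T 1")
          case True
          then show ?thesis by (simp add: pant_def jump_def path_def h_def)
        next
          case False
          then have "path h j s = path (lop u y) j s" using edge_2(2)[OF j] by (simp add: path_def h_def)
          then show ?thesis using False by (simp add: path_lop[OF j s(1)] pant_def jump_def)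
        qed
        then show "(pant (T 1) q (0, 0, 0) (a j, b j, c j) (path u j) (path y j) s)\<^sup>2 = (path h j s)\<^sup>2"
          by simp
      qed simp
      also have "\<dots> \<le> nrm2 (leb 0 (T 1)) (h 1) + nrm2 (leb 0 (T j)) (h j)"
        by (rule nrm2_path_le[OF hs j])
      also have "\<dots> \<le> C1 * sqrt (form (lop u y) (lop u y)) + 1 / sqrt (\<alpha> j) * sqrt (form (lop u y) (lop u y))"
        using C1[OF y] nrm2_le_form[OF edge_2(1)[OF j], of "lop u y"] edge_2(2)[OF j] by (simp add: h_def)
      also have "\<dots> = (C1 + 1 / sqrt (\<alpha> j)) * sqrt (form (lop u y) (lop u y))" by (simp only: distrib_right)
      finally show "nrm2 (leb 0 (T 1 + T j)) (path u j)
          \<le> D * (C1 + 1 / sqrt (\<alpha> j)) * sqrt (form (lop u y) (lop u y))"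
        by (rule comb[OF D(2)[OF path_ac_deriv[OF y j] p0[OF y]] _ D(1)])
    qed (use D(1) C1_0 \<alpha>[OF edge_2(1)[OF j]] in simp)
  qed
qed

text \<open>Edge 1 lies on every path, and m \<ge> 2 provides the path through edge 2 for it. The
  sum of the nonnegative constants of the paths serves as a common constant.\<close>

lemma coercive:
  "\<exists>C\<ge>0. \<forall>u y. \<forall>j\<in>{1..m}. adm 0 u y \<longrightarrow>
    nrm2 (leb 0 (T j)) (u j) \<le> C * sqrt (form (lop u y) (lop u y))"
proof -
  obtain C where C: "\<And>j. j \<in> {2..m} \<Longrightarrow> C j \<ge> 0"
    "\<And>j u y. j \<in> {2..m} \<Longrightarrow> adm 0 u y \<Longrightarrow>
      nrm2 (leb 0 (T 1 + T j)) (path u j) \<le> C j * sqrt (form (lop u y) (lop u y))"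
    using path_coercive by metis
  have m2: "2 \<in> {2..m}" using m by simp
  define D where "D = (\<Sum>j=2..m. C j)"
  have CD: "C j \<le> D" if "j \<in> {2..m}" for j
    unfolding D_def using that C(1) by (intro member_le_sum) auto
  have p: "nrm2 (leb 0 (T 1 + T j)) (path u j) \<le> D * sqrt (form (lop u y) (lop u y))"
    if "j \<in> {2..m}" "adm 0 u y" for j u y
    using C(2)[OF that] mult_right_mono[OF CD[OF that(1)], of "sqrt (form (lop u y) (lop u y))"]
      form_nonneg[of "lop u y"] by simp
  have "nrm2 (leb 0 (T j)) (u j) \<le> D * sqrt (form (lop u y) (lop u y))"
    if "j \<in> {1..m}" "adm 0 u y" for j u y
    using that(1)
  proof (cases rule: edge_cases)
    case 1
    then show ?thesis
      using order_trans[OF nrm2_le_path(1)[OF adm_sqs(1)[OF that(2)] m2] p[OF m2 that(2)]] by simp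
  next
    case 2
    show ?thesis
      by (rule order_trans[OF nrm2_le_path(2)[OF adm_sqs(1)[OF that(2)] 2(1)] p[OF 2(1) that(2)]])
  qed
  moreover have "D \<ge> 0" unfolding D_def using C(1) by (intro sum_nonneg) auto
  ultimately show ?thesis by blast
qed

subsection \<open>Weak form of the boundary value problem\<close>


text \<open>\<open>ell_tilde\<close> with an arbitrary family e in place of \<open>ell y\<close>. By
  \<open>delay_adjoint\<close> below it is the adjoint of the delay operator with its coefficient
  and weight, which explains the formula.\<close>

definition tild :: "nat \<Rightarrow> (nat \<Rightarrow> real \<Rightarrow> real) \<Rightarrow> nat \<Rightarrow> real \<Rightarrow> real" where
  "tild \<nu> e j t =
     (if j = 1 then
        if t < T 1 / q then q * \<alpha> 1 * theta a c \<nu> 1 * e 1 (q * t)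
        else q * (\<Sum>k=2..m. \<alpha> k * theta a c \<nu> k * e k (q * t - T 1))
      else
        if t < l j then q * \<alpha> j * theta a c \<nu> j * e j (q * t + (q - 1) * T 1)
        else 0)"

definition hat :: "(nat \<Rightarrow> real \<Rightarrow> real) \<Rightarrow> nat \<Rightarrow> real \<Rightarrow> real" where
  "hat e j t = \<alpha> j * e j t + tild 1 e j t"

text \<open>The part of \<open>op_L\<close> that does not differentiate \<open>hat\<close>: the
  equations of the problem say that \<open>low (ell y) j\<close> is the weak derivative of
  \<open>hat (ell y) j\<close> on (0, l j).\<close>

definition low :: "(nat \<Rightarrow> real \<Rightarrow> real) \<Rightarrow> nat \<Rightarrow> real \<Rightarrow> real" where
  "low e j t = \<alpha> j * b j * e j t + tild 0 e j t"

lemma ell_tilde_eq: "ell_tilde m q T a b c \<alpha> \<nu> y = tild \<nu> (ell q T a b c y)"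
  by (simp add: fun_eq_iff ell_tilde_def tild_def)

lemma ell_hat_eq: "ell_hat m q T a b c \<alpha> y = hat (ell q T a b c y)"
  by (simp add: fun_eq_iff ell_hat_def hat_def ell_tilde_eq)

lemma op_L_eq: "op_L m q T a b c \<alpha> y j t
    = low (ell q T a b c y) j t - weak_deriv 0 (l j) (hat (ell q T a b c y) j) t"
  by (simp add: op_L_def low_def ell_tilde_eq ell_hat_eq)

lemma T1q: "0 < T 1 / q" "T 1 / q < T 1" "T 1 / q \<le> T 1"
proof -
  show "0 < T 1 / q" using T1 q by simp
  show "T 1 / q < T 1" using T1 q by (simp add: divide_less_eq)
  then show "T 1 / q \<le> T 1" by simp
qed

text \<open>The arguments of e range over (0, T 1), over (0, (q - 1) * T 1) and over ((q - 1) * T 1,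
  T j). The second range lies in edge k because T k > (q - 1) * T 1.\<close>

lemma sq_int_pieces:
  assumes e: "sqs e"
  shows "sq_int (leb 0 (T 1 / q)) (\<lambda>t. e 1 (q * t))"
    and "k \<in> {2..m} \<Longrightarrow> sq_int (leb (T 1 / q) (T 1)) (\<lambda>t. e k (q * t - T 1))"
    and "j \<in> {2..m} \<Longrightarrow> sq_int (leb 0 (l j)) (\<lambda>t. e j (q * t + (q - 1) * T 1))"
proof -
  show "sq_int (leb 0 (T 1 / q)) (\<lambda>t. e 1 (q * t))"
    using sq_int_leb_affine[of q 0 0 "T 1 / q" "e 1"] sqsD[OF e edge_1] q by simp
  show "sq_int (leb (T 1 / q) (T 1)) (\<lambda>t. e k (q * t - T 1))" if k: "k \<in> {2..m}"
  proof -
    have "sq_int (leb 0 (q * T 1 - T 1)) (e k)"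
      by (rule sq_int_leb_mono[OF sqsD[OF e edge_2(1)[OF k]]]) (use Tj[OF k] in \<open>auto simp: algebra_simps\<close>)
    then show ?thesis using sq_int_leb_affine[of q "T 1 / q" "- T 1" "T 1" "e k"] q by simp
  qed
  show "sq_int (leb 0 (l j)) (\<lambda>t. e j (q * t + (q - 1) * T 1))" if j: "j \<in> {2..m}"
  proof -
    have "sq_int (leb ((q - 1) * T 1) (T j)) (e j)"
      by (rule sq_int_leb_mono[OF sqsD[OF e edge_2(1)[OF j]]]) (use q T1 in auto)
    then show ?thesis
      using sq_int_leb_affine[of q 0 "(q - 1) * T 1" "l j" "e j"] q l_2(1)[OF j] by simp
  qed
qed

lemma sq_int_tild:
  assumes e: "sqs e" and j: "j \<in> {1..m}"
  shows "sq_int (leb 0 (l j)) (tild \<nu> e j)"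
  using j
proof (cases rule: edge_cases)
  case 1
  have "sq_int (leb 0 (T 1)) (tild \<nu> e 1)"
  proof (rule sq_int_leb_glue)
    have "sq_int (leb 0 (T 1 / q)) (\<lambda>t. q * \<alpha> 1 * theta a c \<nu> 1 * e 1 (q * t))"
      by (rule sq_int_cmult[OF sq_int_pieces(1)[OF e]])
    then show "sq_int (leb 0 (T 1 / q)) (tild \<nu> e 1)"
      by (rule sq_int_leb_cong[THEN iffD1, rotated]) (simp add: tild_def)
    have "sq_int (leb (T 1 / q) (T 1)) (\<lambda>t. q * (\<Sum>k=2..m. \<alpha> k * theta a c \<nu> k * e k (q * t - T 1)))"
      by (intro sq_int_cmult sq_int_sum sq_int_pieces(2)[OF e])
    then show "sq_int (leb (T 1 / q) (T 1)) (tild \<nu> e 1)"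
      by (rule sq_int_leb_cong[THEN iffD1, rotated]) (simp add: tild_def)
  qed (use T1q in auto)
  then show ?thesis using 1 by simp
next
  case 2
  have "sq_int (leb 0 (l j)) (\<lambda>t. q * \<alpha> j * theta a c \<nu> j * e j (q * t + (q - 1) * T 1))"
    by (rule sq_int_cmult[OF sq_int_pieces(3)[OF e 2(1)]])
  then show ?thesis
    by (rule sq_int_leb_cong[THEN iffD1, rotated]) (use 2 in \<open>simp add: tild_def\<close>)
qed

lemma sq_int_edge_l: "sqs e \<Longrightarrow> j \<in> {1..m} \<Longrightarrow> sq_int (leb 0 (l j)) (e j)"
  by (rule sq_int_leb_mono[OF sqsD]) (use l_bounds in auto)

lemma sq_int_hat: "sqs e \<Longrightarrow> j \<in> {1..m} \<Longrightarrow> sq_int (leb 0 (l j)) (hat e j)"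
  unfolding hat_def by (intro sq_int_add sq_int_cmult sq_int_tild sq_int_edge_l)

lemma sq_int_low: "sqs e \<Longrightarrow> j \<in> {1..m} \<Longrightarrow> sq_int (leb 0 (l j)) (low e j)"
  unfolding low_def by (intro sq_int_add sq_int_cmult sq_int_tild sq_int_edge_l)

lemma delay_integral_1:
  assumes e: "sqs e" and f: "sqs f"
  shows "(LINT t|leb 0 (T 1). e 1 t * delay_ext T f 1 (delayed_arg q T 1 t))
    = q * (LINT s|leb 0 (T 1 / q). e 1 (q * s) * f 1 s)"
proof -
  let ?F = "\<lambda>t. e 1 t * f 1 (t / q)"
  have "integrable (leb 0 (T 1)) ?F"
    using sq_int_mult[OF sqsD[OF e edge_1] delay_bound(1)[OF f edge_1]] by (simp only: delay_1)
  then have "?F \<in> borel_measurable (leb (q * 0 + 0) (q * (T 1 / q) + 0))" using q by simp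
  from leb_affine_subst(3)[OF _ this] show ?thesis using q by (simp add: delay_1)
qed

text \<open>The substitution s = (t + T 1) / q maps (0, T j) onto (T 1 / q, T 1 + l j). Cut this at
  the vertex s = T 1: the first piece pairs e on edge j with f on edge 1, and is the origin of the
  sum over all outgoing edges in \<open>tild\<close> on edge 1; the second piece stays on edge
  j.\<close>

lemma delay_integral_2:
  assumes e: "sqs e" and f: "sqs f" and j: "j \<in> {2..m}"
  shows "(LINT t|leb 0 (T j). e j t * delay_ext T f j (delayed_arg q T j t))
    = q * ((LINT s|leb (T 1 / q) (T 1). e j (q * s - T 1) * f 1 s)
      + (LINT s|leb 0 (l j). e j (q * s + (q - 1) * T 1) * f j s))"
proof -
  let ?F = "\<lambda>t. e j t * path f j ((t + T 1) / q)"
  let ?G = "\<lambda>s. e j (q * s - T 1) * path f j s"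
  note j1 = edge_2(1)[OF j]
  have Fi: "integrable (leb 0 (T j)) ?F"
    using sq_int_mult[OF sqsD[OF e j1] delay_bound(1)[OF f j1]] by (simp only: delay_path[OF j])
  have ends: "q * (T 1 / q) + - T 1 = 0" "q * (T 1 + l j) + - T 1 = T j"
    using q l_2(4)[OF j] by auto
  have qp: "q > 0" using q by simp
  have m: "?F \<in> borel_measurable (leb (q * (T 1 / q) + - T 1) (q * (T 1 + l j) + - T 1))"
    unfolding ends using Fi by simp
  have FG: "?F (q * s + - T 1) = ?G s" for s using q by simp
  note S = leb_affine_subst(2,3)[OF qp m, unfolded ends FG]
  have Gi: "integrable (leb (T 1 / q) (T 1 + l j)) ?G" using S(1) Fi by blast
  have "(LINT t|leb 0 (T j). ?F t) = q * (LINT s|leb (T 1 / q) (T 1 + l j). ?G s)" by (rule S(2))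
  also have "(LINT s|leb (T 1 / q) (T 1 + l j). ?G s)
    = (LINT s|leb (T 1 / q) (T 1). ?G s) + (LINT s|leb (T 1) (T 1 + l j). ?G s)"
    by (rule integral_leb_split[OF Gi]) (use T1q l_2(2)[OF j] in auto)
  also have "(LINT s|leb (T 1 / q) (T 1). ?G s) = (LINT s|leb (T 1 / q) (T 1). e j (q * s - T 1) * f 1 s)"
    by (rule leb_cong(3)) (simp add: path_def)
  also have "(LINT s|leb (T 1) (T 1 + l j). ?G s)
    = (LINT s|leb 0 (l j). e j (q * s + (q - 1) * T 1) * f j s)"
  proof -
    have "integrable (leb (T 1) (T 1 + l j)) ?G"
      by (rule integrable_leb_mono[OF Gi]) (use T1q in auto)
    then have "?G \<in> borel_measurable (leb (1 * 0 + T 1) (1 * l j + T 1))" by (simp add: add.commute)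
    from leb_affine_subst(3)[OF _ this]
    have "(LINT s|leb (T 1) (T 1 + l j). ?G s) = (LINT s|leb 0 (l j). ?G (s + T 1))"
      by (simp add: add.commute)
    also have "\<dots> = (LINT s|leb 0 (l j). e j (q * s + (q - 1) * T 1) * f j s)"
      by (rule leb_cong(3)) (simp add: path_def algebra_simps)
    finally show ?thesis .
  qed
  finally show ?thesis by (simp only: delay_path[OF j])
qed

text \<open>Summing the substitutions over the edges collects all terms that fall on f 1. The case
  \<nu> = 1 is applied to the delayed derivative, the case \<nu> = 0 to the delayed
  function.\<close>

lemma delay_adjoint:
  assumes e: "sqs e" and f: "sqs f"
  shows "(\<Sum>j=1..m. \<alpha> j * theta a c \<nu> j * (LINT t|leb 0 (T j). e j t * delay_ext T f j (delayed_arg q T j t)))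
    = (\<Sum>j=1..m. LINT t|leb 0 (l j). tild \<nu> e j t * f j t)"
proof -
  let ?P = "\<lambda>j. LINT s|leb (T 1 / q) (T 1). e j (q * s - T 1) * f 1 s"
  let ?Q = "\<lambda>j. LINT s|leb 0 (l j). e j (q * s + (q - 1) * T 1) * f j s"
  let ?O = "LINT s|leb 0 (T 1 / q). e 1 (q * s) * f 1 s"
  let ?k = "\<lambda>j. \<alpha> j * theta a c \<nu> j"
  have Q: "(LINT t|leb 0 (l j). tild \<nu> e j t * f j t) = ?k j * (q * ?Q j)" if j: "j \<in> {2..m}" for j
  proof -
    have "(LINT t|leb 0 (l j). tild \<nu> e j t * f j t)
      = (LINT t|leb 0 (l j). (?k j * q) * (e j (q * t + (q - 1) * T 1) * f j t))"
      by (rule leb_cong(3)) (use edge_2(2)[OF j] in \<open>simp add: tild_def\<close>)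
    then show ?thesis by simp
  qed
  have "(LINT t|leb 0 (l 1). tild \<nu> e 1 t * f 1 t)
    = (LINT t|leb 0 (T 1 / q). tild \<nu> e 1 t * f 1 t) + (LINT t|leb (T 1 / q) (T 1). tild \<nu> e 1 t * f 1 t)"
    unfolding l_1
    by (rule integral_leb_split)
      (use sq_int_mult[OF sq_int_tild[OF e edge_1] sq_int_edge_l[OF f edge_1]] T1q in auto)
  also have "(LINT t|leb 0 (T 1 / q). tild \<nu> e 1 t * f 1 t)
    = (LINT t|leb 0 (T 1 / q). (?k 1 * q) * (e 1 (q * t) * f 1 t))"
    by (rule leb_cong(3)) (simp add: tild_def)
  also have "\<dots> = ?k 1 * (q * ?O)" by simp
  also have "(LINT t|leb (T 1 / q) (T 1). tild \<nu> e 1 t * f 1 t)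
    = (LINT t|leb (T 1 / q) (T 1). (\<Sum>j=2..m. (?k j * q) * (e j (q * t - T 1) * f 1 t)))"
    by (rule leb_cong(3)) (simp add: tild_def sum_distrib_left sum_distrib_right mult_ac)
  also have "\<dots> = (\<Sum>j=2..m. LINT t|leb (T 1 / q) (T 1). (?k j * q) * (e j (q * t - T 1) * f 1 t))"
  proof (rule Bochner_Integration.integral_sum)
    fix j assume j: "j \<in> {2..m}"
    have "sq_int (leb (T 1 / q) (T 1)) (f 1)"
      by (rule sq_int_leb_mono[OF sqsD[OF f edge_1]]) (use T1q in auto)
    from sq_int_mult[OF sq_int_pieces(2)[OF e j] this]
    show "integrable (leb (T 1 / q) (T 1)) (\<lambda>t. (?k j * q) * (e j (q * t - T 1) * f 1 t))" by simp
  qed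
  also have "\<dots> = (\<Sum>j=2..m. ?k j * (q * ?P j))" by (simp add: mult.assoc)
  finally have "(\<Sum>j=1..m. LINT t|leb 0 (l j). tild \<nu> e j t * f j t)
      = ?k 1 * (q * ?O) + (\<Sum>j=2..m. ?k j * (q * ?P j)) + (\<Sum>j=2..m. ?k j * (q * ?Q j))"
    unfolding sum_edges using Q by simp
  also have "\<dots> = ?k 1 * (q * ?O) + (\<Sum>j=2..m. ?k j * (q * (?P j + ?Q j)))"
    by (simp add: sum.distrib[symmetric] distrib_left)
  also have "\<dots> = (\<Sum>j=1..m. ?k j * (LINT t|leb 0 (T j). e j t * delay_ext T f j (delayed_arg q T j t)))"
    unfolding sum_edges by (simp add: delay_integral_1[OF e f] delay_integral_2[OF e f])
  finally show ?thesis by simp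
qed

lemma integral_edge_l:
  assumes e: "sqs e" and f: "sqs f" and j: "j \<in> {1..m}" and z: "AE t in leb (l j) (T j). f j t = 0"
  shows "(LINT t|leb 0 (T j). e j t * f j t) = (LINT t|leb 0 (l j). e j t * f j t)"
proof -
  have i: "integrable (leb 0 (T j)) (\<lambda>t. e j t * f j t)"
    by (rule sq_int_mult[OF sqsD[OF e j] sqsD[OF f j]])
  have "integrable (leb (l j) (T j)) (\<lambda>t. e j t * f j t)"
    by (rule integrable_leb_mono[OF i]) (use l_bounds[OF j] in auto)
  then have "(LINT t|leb (l j) (T j). e j t * f j t) = (LINT t|leb (l j) (T j). 0)"
    by (intro integral_cong_AE) (use z in \<open>auto elim: eventually_mono\<close>)
  then show ?thesis
    using integral_leb_split[OF i, of "l j"] l_bounds[OF j] by simp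
qed

text \<open>By (E) the function is zero on [l j, T j], so its derivative vanishes there almost
  everywhere; for j = 1 the interval is empty. This confines the undelayed pairings to (0, l j),
  where the equations are posed.\<close>

lemma adm_AE_0:
  assumes w: "adm k v w" and j: "j \<in> {1..m}"
  shows "AE t in leb (l j) (T j). v j t = 0" "AE t in leb (l j) (T j). w j t = 0"
proof -
  have "(AE t in leb (l j) (T j). v j t = 0) \<and> (AE t in leb (l j) (T j). w j t = 0)"
    using j
  proof (cases rule: edge_cases)
    case 1
    then show ?thesis by (auto intro: AE_leb_I)
  next
    case 2
    have "ac_deriv (l j) (T j) (w j) (v j)"
      by (rule ac_deriv_mono[OF admD(1)[OF w j]]) (use l_bounds[OF j] in auto)
    then have "ac_deriv (l j) (T j) (\<lambda>t. 0) (v j)"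
      by (rule ac_deriv_cong) (use admD(4)[OF w 2(1)] in auto)
    then show ?thesis
      using ac_deriv_0_imp_AE_0 l_2(3)[OF 2(1)] admD(4)[OF w 2(1)] by (auto intro: AE_leb_I)
  qed
  then show "AE t in leb (l j) (T j). v j t = 0" "AE t in leb (l j) (T j). w j t = 0" by auto
qed

text \<open>Once the delays have been moved over to e, the factors of the derivative v collect in
  \<open>hat\<close> and those of w in \<open>low\<close>.\<close>

lemma form_lop_eq:
  assumes e: "sqs e" and w: "adm k v w"
  shows "form e (lop v w) = (\<Sum>j=1..m. LINT t|leb 0 (l j). hat e j t * v j t + low e j t * w j t)"
proof -
  note vs = adm_sqs(1)[OF w] and ws = adm_sqs(2)[OF w]
  let ?d = "\<lambda>f j t. delay_ext T f j (delayed_arg q T j t)"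
  have 1: "(LINT t|leb 0 (T j). e j t * lop v w j t)
    = (LINT t|leb 0 (l j). e j t * v j t) + a j * (LINT t|leb 0 (T j). e j t * ?d v j t)
      + b j * (LINT t|leb 0 (l j). e j t * w j t) + c j * (LINT t|leb 0 (T j). e j t * ?d w j t)"
    if j: "j \<in> {1..m}" for j
  proof -
    have i: "integrable (leb 0 (T j)) (\<lambda>t. e j t * v j t)" "integrable (leb 0 (T j)) (\<lambda>t. e j t * ?d v j t)"
      "integrable (leb 0 (T j)) (\<lambda>t. e j t * w j t)" "integrable (leb 0 (T j)) (\<lambda>t. e j t * ?d w j t)"
      by (intro sq_int_mult delay_bound vs ws j sqsD[OF e j] sqsD[OF vs j] sqsD[OF ws j])+
    have "(LINT t|leb 0 (T j). e j t * lop v w j t) = (LINT t|leb 0 (T j). e j t * v j t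
        + a j * (e j t * ?d v j t) + b j * (e j t * w j t) + c j * (e j t * ?d w j t))"
      by (simp add: lop_def algebra_simps)
    also have "\<dots> = (LINT t|leb 0 (T j). e j t * v j t) + a j * (LINT t|leb 0 (T j). e j t * ?d v j t)
      + b j * (LINT t|leb 0 (T j). e j t * w j t) + c j * (LINT t|leb 0 (T j). e j t * ?d w j t)"
      using i by simp
    finally show ?thesis
      unfolding integral_edge_l[OF e vs j adm_AE_0(1)[OF w j]] integral_edge_l[OF e ws j adm_AE_0(2)[OF w j]] .
  qed
  have 2: "(LINT t|leb 0 (l j). hat e j t * v j t + low e j t * w j t)
    = \<alpha> j * (LINT t|leb 0 (l j). e j t * v j t) + (LINT t|leb 0 (l j). tild 1 e j t * v j t)
      + \<alpha> j * b j * (LINT t|leb 0 (l j). e j t * w j t) + (LINT t|leb 0 (l j). tild 0 e j t * w j t)"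
    if j: "j \<in> {1..m}" for j
  proof -
    have i: "integrable (leb 0 (l j)) (\<lambda>t. e j t * v j t)" "integrable (leb 0 (l j)) (\<lambda>t. tild 1 e j t * v j t)"
      "integrable (leb 0 (l j)) (\<lambda>t. e j t * w j t)" "integrable (leb 0 (l j)) (\<lambda>t. tild 0 e j t * w j t)"
      by (intro sq_int_mult sq_int_tild sq_int_edge_l e vs ws j)+
    have "(LINT t|leb 0 (l j). hat e j t * v j t + low e j t * w j t) = (LINT t|leb 0 (l j).
      \<alpha> j * (e j t * v j t) + tild 1 e j t * v j t + \<alpha> j * b j * (e j t * w j t) + tild 0 e j t * w j t)"
      by (simp add: hat_def low_def algebra_simps)
    then show ?thesis using i by simp
  qed
  have "form e (lop v w) = (\<Sum>j=1..m. \<alpha> j * (LINT t|leb 0 (l j). e j t * v j t))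
      + (\<Sum>j=1..m. \<alpha> j * theta a c 1 j * (LINT t|leb 0 (T j). e j t * ?d v j t))
      + (\<Sum>j=1..m. \<alpha> j * b j * (LINT t|leb 0 (l j). e j t * w j t))
      + (\<Sum>j=1..m. \<alpha> j * theta a c 0 j * (LINT t|leb 0 (T j). e j t * ?d w j t))"
    unfolding form_def sum.distrib[symmetric]
    by (rule sum.cong[OF refl]) (simp add: 1 theta_def algebra_simps)
  also have "\<dots> = (\<Sum>j=1..m. LINT t|leb 0 (l j). hat e j t * v j t + low e j t * w j t)"
    unfolding delay_adjoint[OF e vs] delay_adjoint[OF e ws] sum.distrib[symmetric]
    by (rule sum.cong[OF refl]) (simp only: 2)
  finally show ?thesis .
qed

text \<open>Integrate by parts with h as the continuous representative of \<open>hat\<close>. At the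
  start of edge 1 and at l j on the other edges w vanishes; at the vertex all values of w equal w 1
  (T 1) by (C). What remains is the defect in the Kirchhoff condition times this value.\<close>

lemma form_lop_boundary:
  assumes e: "sqs e" and w: "adm 0 v w"
    and h: "\<And>j. j \<in> {1..m} \<Longrightarrow> ac_deriv 0 (l j) (h j) (low e j)"
      "\<And>j. j \<in> {1..m} \<Longrightarrow> AE t in leb 0 (l j). h j t = hat e j t"
  shows "form e (lop v w) = (h 1 (T 1) - (\<Sum>j=2..m. h j 0)) * w 1 (T 1)"
proof -
  have 1: "(LINT t|leb 0 (l j). hat e j t * v j t + low e j t * w j t) = h j (l j) * w j (l j) - h j 0 * w j 0"
    if j: "j \<in> {1..m}" for j
  proof -
    have wj: "ac_deriv 0 (l j) (w j) (v j)"
      by (rule ac_deriv_mono[OF admD(1)[OF w j]]) (use l_bounds[OF j] in auto)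
    have "(LINT t|leb 0 (l j). hat e j t * v j t + low e j t * w j t)
      = (LINT t|leb 0 (l j). hat e j t * v j t) + (LINT t|leb 0 (l j). low e j t * w j t)"
      by (intro Bochner_Integration.integral_add sq_int_mult sq_int_hat sq_int_low e j
        ac_deriv_sq_int[OF wj] ac_deriv_sq_int'[OF wj])
    also have "(LINT t|leb 0 (l j). hat e j t * v j t) = (LINT t|leb 0 (l j). h j t * v j t)"
    proof (rule integral_cong_AE)
      show "AE t in leb 0 (l j). hat e j t * v j t = h j t * v j t"
        using h(2)[OF j] by eventually_elim simp
      show "(\<lambda>t. hat e j t * v j t) \<in> borel_measurable (leb 0 (l j))"
        by (intro borel_measurable_integrable sq_int_mult sq_int_hat e j ac_deriv_sq_int[OF wj])
      show "(\<lambda>t. h j t * v j t) \<in> borel_measurable (leb 0 (l j))"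
        by (intro borel_measurable_integrable sq_int_mult ac_deriv_sq_int'[OF h(1)[OF j]] ac_deriv_sq_int[OF wj])
    qed
    finally show ?thesis
      using ac_deriv_by_parts[OF h(1)[OF j] wj] l_bounds[OF j] by simp
  qed
  have 2: "h j (l j) * w j (l j) - h j 0 * w j 0 = - (h j 0 * w 1 (T 1))" if j: "j \<in> {2..m}" for j
    using admD(3)[OF w j] admD(4)[OF w j, of "l j"] l_2[OF j] by simp
  have "form e (lop v w) = (\<Sum>j=1..m. h j (l j) * w j (l j) - h j 0 * w j 0)"
    unfolding form_lop_eq[OF e w] by (rule sum.cong[OF refl 1])
  also have "\<dots> = h 1 (T 1) * w 1 (T 1) - h 1 0 * w 1 0 + (\<Sum>j=2..m. - (h j 0 * w 1 (T 1)))"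
    unfolding sum_edges l_1 by (intro arg_cong2[where f = "(+)"] sum.cong refl 2)
  finally show ?thesis
    using admD(2)[OF w] by (simp add: sum_negf sum_distrib_right[symmetric] left_diff_distrib)
qed

end

lemma nrm2_AE_0:
  assumes "f \<in> borel_measurable M" "AE x in M. f x = 0" shows "nrm2 M f = 0"
proof -
  have "(LINT x|M. (f x)\<^sup>2) = (LINT x|M. 0)"
    by (rule integral_cong_AE) (use assms in \<open>auto elim: eventually_mono\<close>)
  then show ?thesis by (simp add: nrm2_def)
qed

lemma abs_leb_integral_le:
  assumes f: "sq_int (leb 0 R) f" and t: "0 \<le> t" "t \<le> R"
  shows "\<bar>LINT s|leb 0 t. f s\<bar> \<le> sqrt R * nrm2 (leb 0 R) f"
proof -
  have ft: "sq_int (leb 0 t) f" by (rule sq_int_leb_mono[OF f]) (use t in auto)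
  have "\<bar>LINT s|leb 0 t. f s\<bar> \<le> (LINT s|leb 0 t. \<bar>f s\<bar>)" by (rule integral_abs_bound)
  also have "\<dots> \<le> nrm2 (leb 0 t) f * sqrt (measure (leb 0 t) (space (leb 0 t)))"
    by (rule leb.integral_abs_le_nrm2[OF ft])
  also have "\<dots> = sqrt t * nrm2 (leb 0 t) f" using measure_leb[of 0 t] t by (simp add: mult.commute)
  also have "\<dots> \<le> sqrt R * nrm2 (leb 0 R) f"
    using t by (intro mult_mono nrm2_leb_mono[OF f]) auto
  finally show ?thesis .
qed

context star_graph
begin

section \<open>Weak solutions and generalized solutions\<close>

text \<open>Vanishing of the first variation. The derivative is fixed as
  \<open>star_deriv T y\<close>, which makes this a property of y alone, while the variations range
  over all admissible pairs.\<close>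

definition wsol :: "real \<Rightarrow> (nat \<Rightarrow> real \<Rightarrow> real) \<Rightarrow> bool" where
  "wsol k y \<longleftrightarrow> adm k (star_deriv T y) y \<and>
     (\<forall>v w. adm 0 v w \<longrightarrow> form (ell q T a b c y) (lop v w) = 0)"

lemma adm_star_deriv:
  assumes y: "adm k u y"
  shows "adm k (star_deriv T y) y" "j \<in> {1..m} \<Longrightarrow> AE t in leb 0 (T j). star_deriv T y j t = u j t"
proof -
  have AE: "AE t in leb 0 (T j). star_deriv T y j t = u j t" if "j \<in> {1..m}" for j
    unfolding star_deriv_def by (rule ac_deriv_W21(2)[OF admD(1)[OF y that] T_pos[OF that]])
  show "AE t in leb 0 (T j). star_deriv T y j t = u j t" if "j \<in> {1..m}" using AE[OF that] .
  have "ac_deriv 0 (T j) (y j) (star_deriv T y j)" if j: "j \<in> {1..m}" for j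
  proof (rule ac_deriv_cong_AE[OF admD(1)[OF y j]])
    have "y j \<in> W21 0 (T j)" by (rule ac_deriv_W21(1)[OF admD(1)[OF y j] T_pos[OF j]])
    from weak_deriv_spec(1)[OF this] show "star_deriv T y j \<in> borel_measurable (leb 0 (T j))"
      unfolding star_deriv_def by (rule sq_int_measurable)
    show "AE t in leb 0 (T j). u j t = star_deriv T y j t" using AE[OF j] by eventually_elim simp
  qed
  then show "adm k (star_deriv T y) y" using y unfolding adm_def by blast
qed

text \<open>Two derivatives of the same y differ by a pair whose norms are 0, so the bound for
  \<open>lop\<close> makes the difference of the expressions 0 in L2. The norm estimate takes care
  of null sets under the delayed argument.\<close>

lemma lop_cong_AE:
  assumes y: "adm k u y" and z: "adm k u' y" and eq: "\<And>j. j \<in> {1..m} \<Longrightarrow> AE t in leb 0 (T j). u j t = u' j t"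
    and j: "j \<in> {1..m}"
  shows "AE t in leb 0 (T j). lop u y j t = lop u' y j t"
proof -
  let ?v = "\<lambda>j t. 1 * u j t + (-1) * u' j t" and ?w = "\<lambda>j t. 1 * y j t + (-1) * y j t"
  have "adm (1 * k + (-1) * k) ?v ?w" by (rule adm_lincomb[OF y z])
  then have vw: "sqs ?v" "sqs ?w" by (auto dest: adm_sqs)
  have v0: "nrm2 (leb 0 (T i)) (?v i) = 0" if i: "i \<in> {1..m}" for i
  proof (rule nrm2_AE_0)
    show "?v i \<in> borel_measurable (leb 0 (T i))" using sqsD[OF vw(1) i] by (rule sq_int_measurable)
    show "AE t in leb 0 (T i). ?v i t = 0" using eq[OF i] by eventually_elim simp
  qed
  have w0: "nrm2 (leb 0 (T i)) (?w i) = 0" for i by (simp add: nrm2_def)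
  have "nrm2 (leb 0 (T j)) (lop ?v ?w j) \<le> 0"
    using nrm2_lop_le[OF vw j] v0[OF j] v0[OF edge_1] w0[of j] w0[of 1] by simp
  then have "nrm2 (leb 0 (T j)) (lop ?v ?w j) = 0" by (simp add: order_antisym)
  from nrm2_eq_0_imp[OF sqsD[OF sqs_lop[OF vw] j] this] show ?thesis
    unfolding lop_lincomb by eventually_elim simp
qed

lemma form_cong_AE:
  assumes "\<And>j. j \<in> {1..m} \<Longrightarrow> AE t in leb 0 (T j). f j t = g j t" "sqs f" "sqs g" "sqs h"
  shows "form f h = form g h"
  unfolding form_def
proof (rule sum.cong[OF refl])
  fix j assume j: "j \<in> {1..m}"
  have "(LINT t|leb 0 (T j). f j t * h j t) = (LINT t|leb 0 (T j). g j t * h j t)"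
  proof (rule integral_cong_AE)
    show "AE t in leb 0 (T j). f j t * h j t = g j t * h j t"
      using assms(1)[OF j] by eventually_elim simp
  qed (intro borel_measurable_integrable sq_int_mult sqsD[OF _ j] assms)+
  then show "\<alpha> j * (LINT t|leb 0 (T j). f j t * h j t) = \<alpha> j * (LINT t|leb 0 (T j). g j t * h j t)"
    by simp
qed

text \<open>Lets a solution be verified with whatever derivative u is at hand; passing to
  \<open>star_deriv\<close> changes the expression only on a null set.\<close>

lemma wsolI:
  assumes y: "adm k u y" and orth: "\<And>v w. adm 0 v w \<Longrightarrow> form (lop u y) (lop v w) = 0"
  shows "wsol k y"
  unfolding wsol_def
proof (intro conjI allI impI)
  show s: "adm k (star_deriv T y) y" by (rule adm_star_deriv(1)[OF y])
  fix v w assume w: "adm 0 v w"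
  have "form (ell q T a b c y) (lop v w) = form (lop u y) (lop v w)"
    unfolding ell_eq_lop
  proof (rule form_cong_AE)
    show "AE t in leb 0 (T j). lop (star_deriv T y) y j t = lop u y j t" if "j \<in> {1..m}" for j
      by (rule lop_cong_AE[OF s y adm_star_deriv(2)[OF y] that])
  qed (intro sqs_lop adm_sqs[OF s] adm_sqs[OF y] adm_sqs[OF w])+
  then show "form (ell q T a b c y) (lop v w) = 0" using orth[OF w] by simp
qed

lemma sqs_ell: "adm k (star_deriv T y) y \<Longrightarrow> sqs (ell q T a b c y)"
  unfolding ell_eq_lop by (intro sqs_lop adm_sqs)

lemma wsol_scale:
  assumes y: "wsol k y" shows "wsol (x * k) (\<lambda>j t. x * y j t)"
proof -
  have Y: "adm k (star_deriv T y) y" using y by (simp add: wsol_def)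
  \<comment> \<open>The zero multiple brings scaling under the rule for linear combinations of
    pairs.\<close>
  have A: "adm (x * k + 0 * k) (\<lambda>j t. x * star_deriv T y j t + 0 * star_deriv T y j t)
      (\<lambda>j t. x * y j t + 0 * y j t)"
    by (rule adm_lincomb[OF Y Y])
  have "wsol (x * k + 0 * k) (\<lambda>j t. x * y j t + 0 * y j t)"
  proof (rule wsolI[OF A])
    fix v w assume w: "adm 0 v w"
    have "form (\<lambda>j t. x * ell q T a b c y j t + 0 * ell q T a b c y j t) (lop v w) = 0"
      using y w form_lincomb[OF sqs_ell[OF Y] sqs_ell[OF Y] sqs_lop[OF adm_sqs[OF w]]]
      by (simp only: wsol_def)
    then show "form (lop (\<lambda>j t. x * star_deriv T y j t + 0 * star_deriv T y j t)
        (\<lambda>j t. x * y j t + 0 * y j t)) (lop v w) = 0"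
      unfolding lop_lincomb ell_eq_lop .
  qed
  then show ?thesis by simp
qed

text \<open>The difference w of two solutions is a variation. Testing both with w shows that its
  quadratic form is 0, so its derivative vanishes by coercivity. Then w is constant on each edge,
  namely 0 on the first by (I) and on the others by (C).\<close>

lemma wsol_unique:
  assumes y: "wsol k y" and z: "wsol k z" and j: "j \<in> {1..m}" and t: "t \<in> {0..T j}"
  shows "y j t = z j t"
proof -
  have Y: "adm k (star_deriv T y) y" and Z: "adm k (star_deriv T z) z"
    using y z by (auto simp: wsol_def)
  define v where "v = (\<lambda>j t. 1 * star_deriv T y j t + (-1) * star_deriv T z j t)"
  define w where "w = (\<lambda>j t. 1 * y j t + (-1) * z j t)"
  have "adm (1 * k + (-1) * k) v w" unfolding v_def w_def by (rule adm_lincomb[OF Y Z])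
  then have w: "adm 0 v w" by simp
  have L: "lop v w = (\<lambda>j t. 1 * ell q T a b c y j t + (-1) * ell q T a b c z j t)"
    unfolding v_def w_def lop_lincomb ell_eq_lop ..
  have "form (lop v w) (lop v w)
      = 1 * form (ell q T a b c y) (lop v w) + (-1) * form (ell q T a b c z) (lop v w)"
    using form_lincomb[OF sqs_ell[OF Y] sqs_ell[OF Z] sqs_lop[OF adm_sqs[OF w]], of 1 "-1"]
    by (simp only: L[symmetric])
  also have "\<dots> = 0" using y z w unfolding wsol_def by simp
  finally have F: "form (lop v w) (lop v w) = 0" .
  obtain C where C: "\<forall>u y. \<forall>j\<in>{1..m}. adm 0 u y \<longrightarrow>
    nrm2 (leb 0 (T j)) (u j) \<le> C * sqrt (form (lop u y) (lop u y))"
    using coercive by blast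
  have v0: "AE t in leb 0 (T i). v i t = 0" if i: "i \<in> {1..m}" for i
  proof (rule nrm2_eq_0_imp[OF sqsD[OF adm_sqs(1)[OF w] i]])
    have "nrm2 (leb 0 (T i)) (v i) \<le> C * sqrt (form (lop v w) (lop v w))" using C i w by blast
    then show "nrm2 (leb 0 (T i)) (v i) = 0" unfolding F by (simp add: order_antisym)
  qed
  have const: "w i s = w i 0" if i: "i \<in> {1..m}" and s: "0 \<le> s" "s \<le> T i" for i s
  proof -
    have "AE t in leb 0 s. v i t = 0" by (rule AE_leb_mono[OF v0[OF i]]) (use s in auto)
    then have "(LINT t|leb 0 s. v i t) = 0" by (rule integral_eq_zero_AE)
    then show ?thesis using ac_deriv_eq[OF admD(1)[OF w i] s] by simp
  qed
  have "w j t = 0"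
    using j
  proof (cases rule: edge_cases)
    case 1 then show ?thesis using const[OF j, of t] t admD(2)[OF w] by simp
  next
    case 2
    have "w j t = w j 0" using const[OF j, of t] t by simp
    also have "\<dots> = w 1 (T 1)" by (rule admD(3)[OF w 2(1)])
    also have "\<dots> = w 1 0" using const[OF edge_1, of "T 1"] T1 by simp
    finally show ?thesis using admD(2)[OF w] by simp
  qed
  then show ?thesis by (simp add: w_def)
qed

text \<open>The equations identify the weak derivative of \<open>hat\<close> with
  \<open>low\<close>, and the Kirchhoff condition cancels the single boundary term that
  \<open>form_lop_boundary\<close> leaves.\<close>

lemma generalized_solution_imp_wsol:
  assumes y: "generalized_solution m q T a b c \<alpha> k y"
  shows "wsol k y"
proof -
  let ?e = "ell q T a b c y"
  have W: "y \<in> W21_star m T"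
    and HW: "\<And>j. j \<in> {1..m} \<Longrightarrow> hat ?e j \<in> W21 0 (l j)"
    and eqn: "\<And>j. j \<in> {1..m} \<Longrightarrow> AE t in leb 0 (l j). op_L m q T a b c \<alpha> y j t = 0"
    and I: "y 1 0 = k" and C: "\<forall>j\<in>{2..m}. y j 0 = y 1 (T 1)"
    and E: "\<forall>j\<in>{2..m}. \<forall>t\<in>{l j..T j}. y j t = 0"
    and K: "cont_rep 0 (l 1) (hat ?e 1) (T 1) = (\<Sum>j=2..m. cont_rep 0 (l j) (hat ?e j) 0)"
    using y unfolding generalized_solution_def ell_hat_eq by blast+
  have "ac_deriv 0 (T j) (y j) (star_deriv T y j)" if "j \<in> {1..m}" for j
    unfolding star_deriv_def
    by (rule W21_continuous_ac_deriv) (use W that T_pos in \<open>auto simp: W21_star_def\<close>)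
  then have A: "adm k (star_deriv T y) y" using I C E by (simp add: adm_def)
  note es = sqs_ell[OF A]
  have "\<exists>h. ac_deriv 0 (l j) h (low ?e j) \<and> (AE t in leb 0 (l j). h t = hat ?e j t)" if j: "j \<in> {1..m}" for j
  proof -
    obtain h where h: "ac_deriv 0 (l j) h (weak_deriv 0 (l j) (hat ?e j))" "AE t in leb 0 (l j). h t = hat ?e j t"
      using W21_ac_deriv_rep[OF HW[OF j] l_bounds(1)[OF j]] .
    have "ac_deriv 0 (l j) h (low ?e j)"
    proof (rule ac_deriv_cong_AE[OF h(1)])
      show "low ?e j \<in> borel_measurable (leb 0 (l j))"
        by (rule sq_int_measurable[OF sq_int_low[OF es j]])
      show "AE t in leb 0 (l j). weak_deriv 0 (l j) (hat ?e j) t = low ?e j t"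
        using eqn[OF j] unfolding op_L_eq by eventually_elim simp
    qed
    then show ?thesis using h(2) by blast
  qed
  then obtain h where h: "\<And>j. j \<in> {1..m} \<Longrightarrow> ac_deriv 0 (l j) (h j) (low ?e j)"
    "\<And>j. j \<in> {1..m} \<Longrightarrow> AE t in leb 0 (l j). h j t = hat ?e j t" by metis
  have cr: "cont_rep 0 (l j) (hat ?e j) t = h j t" if "j \<in> {1..m}" "0 \<le> t" "t \<le> l j" for j t
    by (rule cont_rep_eq[OF ac_deriv_continuous[OF h(1)] h(2)]) (use that l_bounds in auto)
  have "h 1 (T 1) = cont_rep 0 (l 1) (hat ?e 1) (T 1)"
    using cr[OF edge_1, of "T 1"] T1 by simp
  also have "\<dots> = (\<Sum>j=2..m. h j 0)"
    unfolding K by (rule sum.cong[OF refl]) (use cr[OF edge_2(1)] l_2(2) in \<open>simp add: less_imp_le\<close>)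
  finally have "h 1 (T 1) - (\<Sum>j=2..m. h j 0) = 0" by simp
  then show ?thesis
    unfolding wsol_def using A form_lop_boundary[OF es _ h] by simp
qed

text \<open>Two kinds of variations are used: test functions on a single edge give the regularity of
  \<open>hat\<close> and the equations, and one piecewise linear function with value 1 at the vertex
  gives the Kirchhoff condition.\<close>

lemma wsol_imp_generalized_solution:
  assumes y: "wsol k y"
  shows "generalized_solution m q T a b c \<alpha> k y"
proof -
  let ?e = "ell q T a b c y"
  have A: "adm k (star_deriv T y) y" and orth: "\<And>v w. adm 0 v w \<Longrightarrow> form ?e (lop v w) = 0"
    using y by (auto simp: wsol_def)
  note es = sqs_ell[OF A]
  have "y \<in> W21_star m T"
    unfolding W21_star_def
    using ac_deriv_W21(1)[OF admD(1)[OF A] T_pos] ac_deriv_continuous[OF admD(1)[OF A]] by simp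
  have weak: "has_weak_deriv 0 (l i) (hat ?e i) (low ?e i)" if i: "i \<in> {1..m}" for i
    unfolding has_weak_deriv_def
  proof (intro allI impI)
    fix \<phi> \<phi>' assume t: "test_function 0 (l i) \<phi> \<phi>'"
    \<comment> \<open>A test function on (0, l i), extended by zero to the whole graph, is a
      variation: it vanishes at both ends of (0, l i) and beyond, so (I), (C) and (E) hold with all
      values 0.\<close>
    define w where "w = (\<lambda>j. if j = i then \<phi> else (\<lambda>t. 0))"
    define v where "v = (\<lambda>j. if j = i then \<phi>' else (\<lambda>t. 0))"
    obtain d d' where d: "0 < d" "d' < l i" "\<And>t. t \<notin> {d..d'} \<Longrightarrow> \<phi> t = 0"
      using t by (auto simp: test_function_def)
    have \<phi>: "ac_deriv 0 (T i) \<phi> \<phi>'"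
      using t by (intro ac_deriv_C1)
        (auto simp: test_function_def intro: has_field_derivative_at_within continuous_on_subset)
    have \<phi>0: "\<phi> 0 = 0" "\<And>t. l i \<le> t \<Longrightarrow> \<phi> t = 0" using d by auto
    have w1: "w 1 (T 1) = 0" using \<phi>0(2)[of "T 1"] by (auto simp: w_def)
    have w0: "w j 0 = 0" for j using \<phi>0(1) by (simp add: w_def)
    have "adm 0 v w"
      unfolding adm_def w1 w0 using \<phi> \<phi>0(2) by (auto simp: w_def v_def)
    then have "0 = (\<Sum>j=1..m. LINT t|leb 0 (l j). hat ?e j t * v j t + low ?e j t * w j t)"
      using orth form_lop_eq[OF es] by simp
    also have "\<dots> = (\<Sum>j=1..m. if j = i then LINT t|leb 0 (l i). hat ?e i t * \<phi>' t + low ?e i t * \<phi> t else 0)"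
      by (rule sum.cong) (auto simp: w_def v_def)
    also have "\<dots> = (LINT t|leb 0 (l i). hat ?e i t * \<phi>' t + low ?e i t * \<phi> t)"
      using i by (simp add: sum.delta)
    also have "\<dots> = (LINT t|leb 0 (l i). hat ?e i t * \<phi>' t) + (LINT t|leb 0 (l i). low ?e i t * \<phi> t)"
      using test_function_ac_deriv(1)[OF t]
      by (intro Bochner_Integration.integral_add sq_int_mult sq_int_hat sq_int_low es i)
        (auto intro: ac_deriv_sq_int ac_deriv_sq_int')
    finally show "(LINT t|leb 0 (l i). hat ?e i t * \<phi>' t) = - (LINT t|leb 0 (l i). low ?e i t * \<phi> t)"
      by simp
  qed
  have "\<exists>h. ac_deriv 0 (l j) h (low ?e j) \<and> (AE t in leb 0 (l j). h t = hat ?e j t)" if j: "j \<in> {1..m}" for j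
    using weak_deriv_imp_ac[OF sq_int_hat[OF es j] sq_int_low[OF es j] weak[OF j] l_bounds(1)[OF j]] by metis
  then obtain h where h: "\<And>j. j \<in> {1..m} \<Longrightarrow> ac_deriv 0 (l j) (h j) (low ?e j)"
    "\<And>j. j \<in> {1..m} \<Longrightarrow> AE t in leb 0 (l j). h j t = hat ?e j t" by metis
  note rep = ac_deriv_rep_W21[OF h sq_int_measurable[OF sq_int_hat[OF es]] l_bounds(1)]
  have eqn: "AE t in leb 0 (l j). op_L m q T a b c \<alpha> y j t = 0" if "j \<in> {1..m}" for j
    using rep(2)[OF that that that that] unfolding op_L_eq by eventually_elim simp
  \<comment> \<open>It rises linearly from 0 to 1 on edge 1 and falls back to 0 at l j on every
    other edge, so that the boundary formula returns the bare Kirchhoff defect.\<close>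
  define w where "w = (\<lambda>j t. if j = 1 then t / T 1 else if t < l j then 1 - t / l j else 0)"
  define v where "v = (\<lambda>j t. if j = 1 then 1 / T 1 else if t < l j then - 1 / l j else 0)"
  have w: "adm 0 v w"
    unfolding adm_def
  proof (intro conjI ballI)
    show "ac_deriv 0 (T j) (w j) (v j)" if j: "j \<in> {1..m}" for j
      using j
    proof (cases rule: edge_cases)
      case 1
      have "ac_deriv 0 (T 1) (\<lambda>t. t / T 1) (\<lambda>t. 1 / T 1)"
        by (rule ac_deriv_C1) (use T1 in \<open>auto intro!: derivative_eq_intros\<close>)
      then show ?thesis using 1 by (simp add: w_def v_def)
    next
      case 2
      show ?thesis
      proof (rule ac_deriv_glue)
        have "ac_deriv 0 (l j) (\<lambda>t. 1 - t / l j) (\<lambda>t. - 1 / l j)"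
          by (rule ac_deriv_C1) (use l_2(2)[OF 2(1)] in \<open>auto intro!: derivative_eq_intros\<close>)
        then show "ac_deriv 0 (l j) (w j) (v j)"
          by (rule ac_deriv_cong) (use 2 l_2(2)[OF 2(1)] in \<open>auto simp: w_def v_def\<close>)
        show "ac_deriv (l j) (T j) (w j) (v j)"
          by (rule ac_deriv_cong[OF ac_deriv_zero]) (use 2 in \<open>auto simp: w_def v_def\<close>)
      qed (use l_bounds[OF j] in auto)
    qed
  qed (use T1 l_2(2) in \<open>auto simp: w_def\<close>)
  have "w 1 (T 1) = 1" using T1 by (simp add: w_def)
  then have h0: "h 1 (T 1) = (\<Sum>j=2..m. h j 0)"
    using orth[OF w] form_lop_boundary[OF es w h] by simp
  have cr: "cont_rep 0 (l j) (hat ?e j) t = h j t" if "j \<in> {1..m}" "0 \<le> t" "t \<le> l j" for j t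
    by (rule cont_rep_eq[OF ac_deriv_continuous[OF h(1)] h(2)]) (use that l_bounds in auto)
  have "cont_rep 0 (l 1) (hat ?e 1) (T 1) = h 1 (T 1)"
    using cr[OF edge_1, of "T 1"] T1 by simp
  also have "\<dots> = (\<Sum>j=2..m. cont_rep 0 (l j) (hat ?e j) 0)"
    unfolding h0 by (rule sum.cong[OF refl]) (use cr[OF edge_2(1)] l_2(2) in \<open>simp add: less_imp_le\<close>)
  finally have K: "cont_rep 0 (l 1) (hat ?e 1) (T 1) = (\<Sum>j=2..m. cont_rep 0 (l j) (hat ?e j) 0)" .
  show ?thesis
    unfolding generalized_solution_def ell_hat_eq
    using \<open>y \<in> W21_star m T\<close> rep(1) eqn K admD(2-)[OF A] by auto
qed

subsection \<open>Minimisation\<close>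


lemma form_quadratic:
  assumes f: "sqs f" and g: "sqs g"
  shows "form (\<lambda>j t. x * f j t + z * g j t) (\<lambda>j t. x * f j t + z * g j t)
    = x\<^sup>2 * form f f + 2 * x * z * form f g + z\<^sup>2 * form g g"
proof -
  let ?h = "\<lambda>j t. x * f j t + z * g j t"
  have h: "sqs ?h" using f g unfolding sqs_def by (auto intro!: sq_int_add sq_int_cmult)
  have "form ?h ?h = x * form f ?h + z * form g ?h" by (rule form_lincomb[OF f g h])
  also have "form f ?h = x * form f f + z * form f g"
    by (subst form_sym, subst form_lincomb[OF f g f]) (simp add: form_sym)
  also have "form g ?h = x * form f g + z * form g g"
    by (subst form_sym, subst form_lincomb[OF f g g]) simp
  finally show ?thesis by (simp add: power2_eq_square algebra_simps)
qed

lemma abs_form_le: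
  assumes "sqs f" "sqs g"
  shows "\<bar>form f g\<bar> \<le> (\<Sum>j=1..m. \<alpha> j * (nrm2 (leb 0 (T j)) (f j) * nrm2 (leb 0 (T j)) (g j)))"
proof -
  have "\<bar>form f g\<bar> \<le> (\<Sum>j=1..m. \<bar>\<alpha> j * (LINT t|leb 0 (T j). f j t * g j t)\<bar>)"
    unfolding form_def by (rule sum_abs)
  also have "\<dots> \<le> (\<Sum>j=1..m. \<alpha> j * (nrm2 (leb 0 (T j)) (f j) * nrm2 (leb 0 (T j)) (g j)))"
    using \<alpha> LINT_Cauchy_Schwarz[OF sqsD[OF assms(1)] sqsD[OF assms(2)]]
    by (intro sum_mono) (simp add: abs_mult less_imp_le)
  finally show ?thesis .
qed

text \<open>A linear descent to 0 along the first edge fits zero functions on the others. It shows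
  that the infimum is taken over a nonempty set.\<close>

lemma adm_1_ex: "\<exists>u y. adm 1 u y"
proof -
  define y where "y = (\<lambda>(j::nat) (t::real). if j = 1 then 1 - t / T 1 else 0)"
  define u where "u = (\<lambda>(j::nat) (t::real). if j = 1 then - 1 / T 1 else 0)"
  have "ac_deriv 0 (T 1) (\<lambda>t. 1 - t / T 1) (\<lambda>t. - 1 / T 1)"
    by (rule ac_deriv_C1) (use T1 in \<open>auto intro!: derivative_eq_intros\<close>)
  then have "adm 1 u y" unfolding adm_def using T1 by (auto simp: y_def u_def)
  then show ?thesis by blast
qed

text \<open>By the parallelogram identity a minimizing sequence is Cauchy for the quadratic form, hence
  by coercivity its derivatives converge in \<open>L\<^sub>2\<close>.\<close>

lemma ex_minimizing_sequence:
  obtains U Y u where "\<And>n. adm 1 (U n) (Y n)"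
    "\<And>v w. adm 0 v w \<Longrightarrow> (\<lambda>n. form (lop (U n) (Y n)) (lop v w)) \<longlonglongrightarrow> 0"
    "sqs u" "\<And>j. j \<in> {1..m} \<Longrightarrow> (\<lambda>n. nrm2 (leb 0 (T j)) (\<lambda>t. U n j t - u j t)) \<longlonglongrightarrow> 0"
proof -
  define J where "J u y = form (lop u y) (lop u y)" for u y
  define I where "I = Inf {J u y | u y. adm 1 u y}"
  have bdd: "bdd_below {J u y | u y. adm 1 u y}"
    by (rule bdd_belowI[of _ 0]) (auto simp: J_def form_nonneg)
  have I_le: "I \<le> J u y" if "adm 1 u y" for u y
    unfolding I_def using that by (intro cInf_lower bdd) blast
  have "\<exists>u y. adm 1 u y \<and> J u y < I + 1 / real (Suc n)" for n
  proof -
    have "\<exists>x\<in>{J u y | u y. adm 1 u y}. x < I + 1 / real (Suc n)"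
      unfolding I_def by (rule cInf_lessD) (use adm_1_ex in auto)
    then show ?thesis by blast
  qed
  then obtain U Y where UY: "\<And>n. adm 1 (U n) (Y n)" "\<And>n. J (U n) (Y n) < I + 1 / real (Suc n)"
    by metis
  have s: "sqs (lop (U n) (Y n))" for n by (intro sqs_lop adm_sqs[OF UY(1)])
  have orth: "(\<lambda>n. form (lop (U n) (Y n)) (lop v w)) \<longlonglongrightarrow> 0" if w: "adm 0 v w" for v w
  proof -
    have sw: "sqs (lop v w)" by (intro sqs_lop adm_sqs[OF w])
    \<comment> \<open>J at the n-th element exceeds the infimum by less than 1 / (n + 1). Hence the
      values of J on the line through it in the direction (v, w), minus the infimum, are dominated
      by a quadratic polynomial in t with constant term 1 / (n + 1) that is nonnegative; its
      discriminant bounds the pairing.\<close>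
    have le: "(form (lop (U n) (Y n)) (lop v w))\<^sup>2 \<le> 1 / real (Suc n) * J v w" for n
    proof (rule quadratic_nonneg_discriminant)
      fix t :: real
      have "adm (1 * 1 + t * 0) (\<lambda>j s. 1 * U n j s + t * v j s) (\<lambda>j s. 1 * Y n j s + t * w j s)"
        by (rule adm_lincomb[OF UY(1) w])
      then have "I \<le> J (\<lambda>j s. 1 * U n j s + t * v j s) (\<lambda>j s. 1 * Y n j s + t * w j s)"
        by (intro I_le) simp
      also have "\<dots> = J (U n) (Y n) + 2 * t * form (lop (U n) (Y n)) (lop v w) + t\<^sup>2 * J v w"
        unfolding J_def lop_lincomb form_quadratic[OF s sw] by simp
      finally show "0 \<le> 1 / real (Suc n) + 2 * t * form (lop (U n) (Y n)) (lop v w) + t\<^sup>2 * J v w"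
        using UY(2)[of n] by linarith
    qed (auto simp: J_def form_nonneg)
    have "(\<lambda>n. 1 / real (Suc n) * J v w) \<longlonglongrightarrow> 0 * J v w"
      using LIMSEQ_inverse_real_of_nat by (intro tendsto_intros) (simp add: inverse_eq_divide)
    then have lim0: "(\<lambda>n. 1 / real (Suc n) * J v w) \<longlonglongrightarrow> 0" by simp
    have "(\<lambda>n. (form (lop (U n) (Y n)) (lop v w))\<^sup>2) \<longlonglongrightarrow> 0"
      by (rule tendsto_sandwich[OF _ _ tendsto_const lim0]) (use le in simp_all)
    then have "(\<lambda>n. sqrt ((form (lop (U n) (Y n)) (lop v w))\<^sup>2)) \<longlonglongrightarrow> sqrt 0"
      by (rule tendsto_real_sqrt)
    then show ?thesis by (simp add: tendsto_rabs_zero_iff)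
  qed
  obtain C where C: "C \<ge> 0" "\<And>u y j. j \<in> {1..m} \<Longrightarrow> adm 0 u y \<Longrightarrow>
      nrm2 (leb 0 (T j)) (u j) \<le> C * sqrt (J u y)"
    using coercive unfolding J_def by blast
  have diff: "nrm2 (leb 0 (T j)) (\<lambda>t. U n j t - U k j t) \<le> C * sqrt (2 / real (Suc n) + 2 / real (Suc k))"
    if j: "j \<in> {1..m}" for j n k
  proof -
    let ?f = "lop (U n) (Y n)" and ?g = "lop (U k) (Y k)"
    let ?d = "\<lambda>j t. 1 * U n j t + (-1) * U k j t" and ?D = "\<lambda>j t. 1 * Y n j t + (-1) * Y k j t"
    \<comment> \<open>The midpoint is again in \<open>adm 1\<close>, so its J is at least I; the
      difference lies in \<open>adm 0\<close>, where coercivity holds.\<close>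
    let ?h = "\<lambda>j t. 1 / 2 * U n j t + 1 / 2 * U k j t" and ?H = "\<lambda>j t. 1 / 2 * Y n j t + 1 / 2 * Y k j t"
    have "adm (1 / 2 * 1 + 1 / 2 * 1) ?h ?H" by (rule adm_lincomb[OF UY(1) UY(1)])
    then have "I \<le> J ?h ?H" by (intro I_le) simp
    also have "J ?h ?H = (1 / 2)\<^sup>2 * form ?f ?f + 2 * (1 / 2) * (1 / 2) * form ?f ?g + (1 / 2)\<^sup>2 * form ?g ?g"
      unfolding J_def lop_lincomb by (rule form_quadratic[OF s s])
    also have "\<dots> = (form ?f ?f + 2 * form ?f ?g + form ?g ?g) / 4" by (simp add: power2_eq_square)
    finally have mid: "4 * I \<le> form ?f ?f + 2 * form ?f ?g + form ?g ?g" by simp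
    have dd: "J ?d ?D = 1\<^sup>2 * form ?f ?f + 2 * 1 * (-1) * form ?f ?g + (-1)\<^sup>2 * form ?g ?g"
      unfolding J_def lop_lincomb by (rule form_quadratic[OF s s])
    have "form ?f ?f < I + 1 / real (Suc n)" "form ?g ?g < I + 1 / real (Suc k)"
      using UY(2)[of n] UY(2)[of k] by (auto simp: J_def)
    with dd mid have JD: "J ?d ?D \<le> 2 * (1 / real (Suc n)) + 2 * (1 / real (Suc k))" by simp
    have "adm (1 * 1 + (-1) * 1) ?d ?D" by (rule adm_lincomb[OF UY(1) UY(1)])
    then have "nrm2 (leb 0 (T j)) (?d j) \<le> C * sqrt (J ?d ?D)" by (intro C(2) j) simp
    also have "\<dots> \<le> C * sqrt (2 / real (Suc n) + 2 / real (Suc k))"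
      using JD C(1) by (intro mult_left_mono) auto
    finally show ?thesis by simp
  qed
  have ex: "\<exists>g. sq_int (leb 0 (T j)) g \<and> (\<lambda>n. nrm2 (leb 0 (T j)) (\<lambda>t. U n j t - g t)) \<longlonglongrightarrow> 0"
    if j: "j \<in> {1..m}" for j
  proof -
    have Us: "sq_int (leb 0 (T j)) (U n j)" for n by (rule sqsD[OF adm_sqs(1)[OF UY(1)] j])
    have Cauchy: "\<exists>N. \<forall>k\<ge>N. \<forall>n\<ge>N. nrm2 (leb 0 (T j)) (\<lambda>t. U k j t - U n j t) < e"
      if e: "e > 0" for e
    proof -
      have "(\<lambda>N. C * sqrt (4 * (1 / real (Suc N)))) \<longlonglongrightarrow> C * sqrt (4 * 0)"
        using LIMSEQ_inverse_real_of_nat by (intro tendsto_intros) (simp add: inverse_eq_divide)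
      then have "(\<lambda>N. C * sqrt (4 * (1 / real (Suc N)))) \<longlonglongrightarrow> 0" by simp
      from order_tendstoD(2)[OF this e] obtain N where N: "C * sqrt (4 * (1 / real (Suc N))) < e"
        by (auto simp: eventually_sequentially)
      have "nrm2 (leb 0 (T j)) (\<lambda>t. U k j t - U n j t) < e" if "k \<ge> N" "n \<ge> N" for k n
      proof -
        have "1 / real (Suc k) \<le> 1 / real (Suc N)" "1 / real (Suc n) \<le> 1 / real (Suc N)"
          using that by (auto intro!: divide_left_mono)
        then have "2 / real (Suc k) + 2 / real (Suc n) \<le> 4 * (1 / real (Suc N))" by simp
        then have "C * sqrt (2 / real (Suc k) + 2 / real (Suc n)) \<le> C * sqrt (4 * (1 / real (Suc N)))"
          using C(1) by (intro mult_left_mono) auto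
        then show ?thesis using diff[OF j, of k n] N by linarith
      qed
      then show ?thesis by blast
    qed
    obtain g where "sq_int (leb 0 (T j)) g" "(\<lambda>n. nrm2 (leb 0 (T j)) (\<lambda>t. U n j t - g t)) \<longlonglongrightarrow> 0"
      by (rule leb.sq_int_complete[where f = "\<lambda>n. U n j", OF Us Cauchy])
    then show ?thesis by blast
  qed
  have "\<exists>u. \<forall>j\<in>{1..m}. sq_int (leb 0 (T j)) (u j)
      \<and> (\<lambda>n. nrm2 (leb 0 (T j)) (\<lambda>t. U n j t - u j t)) \<longlonglongrightarrow> 0"
    by (rule bchoice) (use ex in blast)
  then obtain u where u: "\<And>j. j \<in> {1..m} \<Longrightarrow> sq_int (leb 0 (T j)) (u j)"
    "\<And>j. j \<in> {1..m} \<Longrightarrow> (\<lambda>n. nrm2 (leb 0 (T j)) (\<lambda>t. U n j t - u j t)) \<longlonglongrightarrow> 0"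
    by blast
  show thesis by (rule that[OF UY(1) orth _ u(2)]) (simp_all add: sqs_def u(1))
qed

text \<open>The solution is rebuilt by integration from the limit u of the derivatives, so that (I)
  and (C) hold by construction. Uniform convergence of \<open>Y n\<close> yields (E), and the bound
  for \<open>lop\<close> carries the asymptotic orthogonality over to the limit.\<close>

lemma ex_wsol_1: "\<exists>y. wsol 1 y"
proof -
  obtain U Y u where UY: "\<And>n. adm 1 (U n) (Y n)"
    and orth: "\<And>v w. adm 0 v w \<Longrightarrow> (\<lambda>n. form (lop (U n) (Y n)) (lop v w)) \<longlonglongrightarrow> 0"
    and u: "sqs u"
    and lim: "\<And>j. j \<in> {1..m} \<Longrightarrow> (\<lambda>n. nrm2 (leb 0 (T j)) (\<lambda>t. U n j t - u j t)) \<longlonglongrightarrow> 0"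
    by (rule ex_minimizing_sequence) blast
  \<comment> \<open>The initial constant on the outgoing edges is the value of \<open>y 1\<close> at
    T 1, as (C) requires.\<close>
  define y where "y j t = (if j = 1 then 1 else 1 + (LINT s|leb 0 (T 1). u 1 s)) + (LINT s|leb 0 t. u j s)" for j t
  have y_ac: "ac_deriv 0 (T j) (y j) (u j)" if "j \<in> {1..m}" for j
    using sqsD[OF u that] by (intro ac_derivI) (auto simp: y_def)
  have ys: "sqs y" using ac_deriv_sq_int'[OF y_ac] by (simp add: sqs_def)
  define D where "D n j = nrm2 (leb 0 (T j)) (\<lambda>t. U n j t - u j t)" for n j
  have D0: "D n j \<ge> 0" for n j by (simp add: D_def)
  \<comment> \<open>A bound for the uniform distance of \<open>Y n j\<close> and \<open>y j\<close>:
    the error at the vertex plus the error accumulated along edge j. For j = 1 it merely counts the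
    same error twice.\<close>
  define E where "E n j = sqrt (T 1) * D n 1 + sqrt (T j) * D n j" for n j
  have E_lim: "(\<lambda>n. E n j) \<longlonglongrightarrow> 0" if "j \<in> {1..m}" for j
  proof -
    have "(\<lambda>n. E n j) \<longlonglongrightarrow> sqrt (T 1) * 0 + sqrt (T j) * 0"
      unfolding E_def D_def by (intro tendsto_intros lim edge_1 that)
    then show ?thesis by simp
  qed
  have int: "\<bar>(LINT s|leb 0 t. U n j s) - (LINT s|leb 0 t. u j s)\<bar> \<le> sqrt (T j) * D n j"
    if j: "j \<in> {1..m}" and t: "0 \<le> t" "t \<le> T j" for n j t
  proof -
    have Us: "sq_int (leb 0 (T j)) (U n j)" by (rule sqsD[OF adm_sqs(1)[OF UY] j])
    have i: "integrable (leb 0 t) (U n j)" "integrable (leb 0 t) (u j)"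
      by (rule integrable_leb_mono[OF leb.sq_int_imp_integrable]; use Us sqsD[OF u j] t in auto)+
    have "\<bar>LINT s|leb 0 t. U n j s - u j s\<bar> \<le> sqrt (T j) * D n j"
      unfolding D_def by (intro abs_leb_integral_le sq_int_diff Us sqsD[OF u j] t)
    then show ?thesis using i by simp
  qed
  have Yy: "\<bar>Y n j t - y j t\<bar> \<le> E n j" if j: "j \<in> {1..m}" and t: "0 \<le> t" "t \<le> T j" for n j t
    using j
  proof (cases rule: edge_cases)
    case 1
    have "Y n 1 t = 1 + (LINT s|leb 0 t. U n 1 s)"
      using ac_deriv_eq[OF admD(1)[OF UY edge_1], of t n] admD(2)[OF UY, of n] t 1 by simp
    then have "\<bar>Y n 1 t - y 1 t\<bar> \<le> sqrt (T 1) * D n 1"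
      using int[OF edge_1, of t n] t 1 by (simp add: y_def)
    moreover have "0 \<le> sqrt (T 1) * D n 1" using D0 T1 by simp
    ultimately show ?thesis unfolding 1 E_def by linarith
  next
    case 2
    have "Y n j t = Y n 1 (T 1) + (LINT s|leb 0 t. U n j s)"
      using ac_deriv_eq[OF admD(1)[OF UY j], of t n] admD(3)[OF UY 2(1), of n] t by simp
    moreover have "Y n 1 (T 1) = 1 + (LINT s|leb 0 (T 1). U n 1 s)"
      using ac_deriv_eq[OF admD(1)[OF UY edge_1], of "T 1" n] admD(2)[OF UY, of n] T1 by simp
    moreover have "y j t = 1 + (LINT s|leb 0 (T 1). u 1 s) + (LINT s|leb 0 t. u j s)"
      using 2 by (simp add: y_def)
    ultimately show ?thesis
      using int[OF j t, of n] int[OF edge_1, of "T 1" n] T1 unfolding E_def by linarith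
  qed
  have Y_lim: "(\<lambda>n. Y n j t) \<longlonglongrightarrow> y j t" if "j \<in> {1..m}" "0 \<le> t" "t \<le> T j" for j t
  proof -
    have "(\<lambda>n. Y n j t - y j t) \<longlonglongrightarrow> 0"
      by (rule Lim_null_comparison[OF _ E_lim[OF that(1)]]) (use Yy[OF that] in simp)
    then show ?thesis by (simp add: LIM_zero_iff)
  qed
  have y: "adm 1 u y"
    unfolding adm_def
  proof (intro conjI ballI)
    show "y j t = 0" if j: "j \<in> {2..m}" and t: "t \<in> {l j..T j}" for j t
    proof (rule LIMSEQ_unique)
      show "(\<lambda>n. Y n j t) \<longlonglongrightarrow> y j t" using t l_2(2)[OF j] by (intro Y_lim edge_2(1) j) auto
      have "Y n j t = 0" for n using admD(4)[OF UY j] t by simp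
      then show "(\<lambda>n. Y n j t) \<longlonglongrightarrow> 0" by simp
    qed
  qed (auto simp: y_ac, auto simp: y_def)
  have "form (lop u y) (lop v w) = 0" if w: "adm 0 v w" for v w
  proof (rule LIMSEQ_unique)
    have sw: "sqs (lop v w)" by (intro sqs_lop adm_sqs[OF w])
    \<comment> \<open>The difference of the expressions, written as \<open>lop\<close> of an
      admissible pair so that the norm bound for \<open>lop\<close> applies to it.\<close>
    define f where "f n = lop (\<lambda>j t. 1 * U n j t + (-1) * u j t) (\<lambda>j t. 1 * Y n j t + (-1) * y j t)" for n
    have A: "adm (1 * 1 + (-1) * 1) (\<lambda>j t. 1 * U n j t + (-1) * u j t) (\<lambda>j t. 1 * Y n j t + (-1) * y j t)" for n
      by (rule adm_lincomb[OF UY y])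
    have fs: "sqs (f n)" for n unfolding f_def by (intro sqs_lop adm_sqs[OF A])
    have f_lim: "(\<lambda>n. nrm2 (leb 0 (T j)) (f n j)) \<longlonglongrightarrow> 0" if j: "j \<in> {1..m}" for j
    proof (rule Lim_null_comparison)
      have d: "nrm2 (leb 0 (T i)) (\<lambda>t. 1 * Y n i t + (-1) * y i t) \<le> E n i * sqrt (T i)" if i: "i \<in> {1..m}" for n i
      proof (rule nrm2_leb_bounded[OF sqsD[OF adm_sqs(2)[OF A] i]])
        show "0 \<le> E n i" using D0 T1 T_pos[OF i] by (simp add: E_def)
      qed (use Yy[OF i] T_pos[OF i] in auto)
      have "nrm2 (leb 0 (T j)) (f n j) \<le> (1 + \<bar>a j\<bar> * sqrt q) * (D n 1 + D n j)
        + (\<bar>b j\<bar> + \<bar>c j\<bar> * sqrt q) * (E n 1 * sqrt (T 1) + E n j * sqrt (T j))" for n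
      proof -
        have "(\<bar>b j\<bar> + \<bar>c j\<bar> * sqrt q) * (nrm2 (leb 0 (T 1)) (\<lambda>t. 1 * Y n 1 t + (-1) * y 1 t) + nrm2 (leb 0 (T j)) (\<lambda>t. 1 * Y n j t + (-1) * y j t))
          \<le> (\<bar>b j\<bar> + \<bar>c j\<bar> * sqrt q) * (E n 1 * sqrt (T 1) + E n j * sqrt (T j))"
          using q by (intro mult_left_mono add_mono d edge_1 j) auto
        moreover have "nrm2 (leb 0 (T i)) (\<lambda>t. 1 * U n i t + (-1) * u i t) = D n i" for i
          by (simp add: D_def)
        ultimately show ?thesis
          using nrm2_lop_le[OF adm_sqs[OF A[of n]] j] unfolding f_def by simp
      qed
      then show "\<forall>\<^sub>F n in sequentially. norm (nrm2 (leb 0 (T j)) (f n j)) \<le> (1 + \<bar>a j\<bar> * sqrt q) * (D n 1 + D n j)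
        + (\<bar>b j\<bar> + \<bar>c j\<bar> * sqrt q) * (E n 1 * sqrt (T 1) + E n j * sqrt (T j))"
        by simp
      have "(\<lambda>n. (1 + \<bar>a j\<bar> * sqrt q) * (D n 1 + D n j)
        + (\<bar>b j\<bar> + \<bar>c j\<bar> * sqrt q) * (E n 1 * sqrt (T 1) + E n j * sqrt (T j)))
        \<longlonglongrightarrow> (1 + \<bar>a j\<bar> * sqrt q) * (0 + 0) + (\<bar>b j\<bar> + \<bar>c j\<bar> * sqrt q) * (0 * sqrt (T 1) + 0 * sqrt (T j))"
        by (intro tendsto_intros E_lim edge_1 j lim[folded D_def])
      then show "(\<lambda>n. (1 + \<bar>a j\<bar> * sqrt q) * (D n 1 + D n j)
        + (\<bar>b j\<bar> + \<bar>c j\<bar> * sqrt q) * (E n 1 * sqrt (T 1) + E n j * sqrt (T j))) \<longlonglongrightarrow> 0"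
        by simp
    qed
    have "(\<lambda>n. form (f n) (lop v w)) \<longlonglongrightarrow> 0"
    proof (rule Lim_null_comparison)
      show "\<forall>\<^sub>F n in sequentially. norm (form (f n) (lop v w))
        \<le> (\<Sum>j=1..m. \<alpha> j * (nrm2 (leb 0 (T j)) (f n j) * nrm2 (leb 0 (T j)) (lop v w j)))"
        using abs_form_le[OF fs sw] by simp
      have "(\<lambda>n. \<Sum>j=1..m. \<alpha> j * (nrm2 (leb 0 (T j)) (f n j) * nrm2 (leb 0 (T j)) (lop v w j)))
        \<longlonglongrightarrow> (\<Sum>j=1..m. \<alpha> j * (0 * nrm2 (leb 0 (T j)) (lop v w j)))"
        by (intro tendsto_intros f_lim)
      then show "(\<lambda>n. \<Sum>j=1..m. \<alpha> j * (nrm2 (leb 0 (T j)) (f n j) * nrm2 (leb 0 (T j)) (lop v w j))) \<longlonglongrightarrow> 0"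
        by simp
    qed
    from tendsto_diff[OF orth[OF w] this]
    have "(\<lambda>n. form (lop (U n) (Y n)) (lop v w) - form (f n) (lop v w)) \<longlonglongrightarrow> 0" by simp
    moreover have "form (lop (U n) (Y n)) (lop v w) - form (f n) (lop v w) = form (lop u y) (lop v w)" for n
      unfolding f_def lop_lincomb
      using form_lincomb[OF sqs_lop[OF adm_sqs[OF UY[of n]]] sqs_lop[OF adm_sqs[OF y]] sw, of 1 "-1"] by simp
    ultimately show "(\<lambda>n :: nat. form (lop u y) (lop v w)) \<longlonglongrightarrow> 0" by simp
  qed (rule tendsto_const)
  then show ?thesis using wsolI[OF y] by blast
qed

section \<open>Dependence on the initial value\<close>

text \<open>By uniqueness and homogeneity y equals k times y1 on every edge, so the norms are
  exactly proportional. The weak derivatives are chosen separately for y and y1, so they agree up to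
  the factor k only almost everywhere, and the integrals are compared accordingly.\<close>

lemma wsol_scaled_norm:
  assumes y1: "wsol 1 y1" and y: "wsol k y"
  shows "W21_star_norm m T y = W21_star_norm m T y1 * \<bar>k\<bar>"
proof -
  have A1: "adm 1 (star_deriv T y1) y1" using y1 by (simp add: wsol_def)
  have eq: "y j t = k * y1 j t" if "j \<in> {1..m}" "0 \<le> t" "t \<le> T j" for j t
    using wsol_unique[OF y wsol_scale[OF y1, of k, simplified] that(1), of t] that by simp
  have "W21_inner 0 (T j) (y j) (y j) = k\<^sup>2 * W21_inner 0 (T j) (y1 j) (y1 j)" if j: "j \<in> {1..m}" for j
  proof -
    have ac1: "ac_deriv 0 (T j) (y1 j) (star_deriv T y1 j)" by (rule admD(1)[OF A1 j])
    have ac: "ac_deriv 0 (T j) (y j) (\<lambda>t. k * star_deriv T y1 j t)"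
      by (rule ac_deriv_cong[OF ac_deriv_lincomb[OF ac1 ac1, of k 0]]) (use eq[OF j] in auto)
    have "(LINT t|leb 0 (T j). weak_deriv 0 (T j) (y j) t * weak_deriv 0 (T j) (y j) t)
      = (LINT t|leb 0 (T j). k\<^sup>2 * (star_deriv T y1 j t * star_deriv T y1 j t))"
    proof (rule integral_cong_AE)
      show "AE t in leb 0 (T j). weak_deriv 0 (T j) (y j) t * weak_deriv 0 (T j) (y j) t
          = k\<^sup>2 * (star_deriv T y1 j t * star_deriv T y1 j t)"
        using ac_deriv_W21(2)[OF ac T_pos[OF j]] by eventually_elim (simp add: power2_eq_square)
      note wd = weak_deriv_spec(1)[OF ac_deriv_W21(1)[OF ac T_pos[OF j]]]
      show "(\<lambda>t. weak_deriv 0 (T j) (y j) t * weak_deriv 0 (T j) (y j) t) \<in> borel_measurable (leb 0 (T j))"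
        by (rule borel_measurable_integrable[OF sq_int_mult[OF wd wd]])
      have "integrable (leb 0 (T j)) (\<lambda>t. k\<^sup>2 * (star_deriv T y1 j t * star_deriv T y1 j t))"
        using sq_int_mult[OF ac_deriv_sq_int[OF ac1] ac_deriv_sq_int[OF ac1]] by simp
      then show "(\<lambda>t. k\<^sup>2 * (star_deriv T y1 j t * star_deriv T y1 j t)) \<in> borel_measurable (leb 0 (T j))"
        by (rule borel_measurable_integrable)
    qed
    moreover have "(LINT t|leb 0 (T j). y j t * y j t) = (LINT t|leb 0 (T j). k\<^sup>2 * (y1 j t * y1 j t))"
      by (rule leb_cong(3)) (simp add: eq[OF j] power2_eq_square)
    ultimately show ?thesis by (simp add: W21_inner_def star_deriv_def distrib_left)
  qed
  then have "W21_star_inner m T y y = k\<^sup>2 * W21_star_inner m T y1 y1"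
    by (simp add: W21_star_inner_def sum_distrib_left)
  then show ?thesis by (simp add: W21_star_norm_def real_sqrt_mult mult.commute)
qed

end

theorem mainTheorem2:
  fixes m :: nat and q :: real and T a b c \<alpha> :: "nat \<Rightarrow> real"
  assumes "m \<ge> 2" and "q > 1" and "T 1 > 0"
    and "\<And>j. j \<in> {2..m} \<Longrightarrow> T j > (q - 1) * T 1"
    and "\<And>j. j \<in> {1..m} \<Longrightarrow> \<alpha> j > 0"
    and "\<bar>a 1\<bar> \<noteq> q powr (- 1 / 2)"
    and "(\<Sum>j=2..m. \<bar>a j\<bar>) > 0"
  shows "(\<forall>y0. \<exists>y. generalized_solution m q T a b c \<alpha> y0 y \<and>
             (\<forall>z. generalized_solution m q T a b c \<alpha> y0 z \<longrightarrow>
                (\<forall>j\<in>{1..m}. \<forall>t\<in>{0..T j}. z j t = y j t))) \<and>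
         (\<exists>C. \<forall>y0 y. generalized_solution m q T a b c \<alpha> y0 y \<longrightarrow>
             W21_star_norm m T y \<le> C * \<bar>y0\<bar>)"
proof -
  interpret star_graph m q T a b c \<alpha>
    using assms by unfold_locales
  obtain y1 where y1: "wsol 1 y1" using ex_wsol_1 by blast
  \<comment> \<open>Every initial value is reached by scaling the single solution with initial value
    1.\<close>
  have "\<exists>y. generalized_solution m q T a b c \<alpha> y0 y \<and>
      (\<forall>z. generalized_solution m q T a b c \<alpha> y0 z \<longrightarrow>
        (\<forall>j\<in>{1..m}. \<forall>t\<in>{0..T j}. z j t = y j t))" for y0
  proof -
    have "wsol y0 (\<lambda>j t. y0 * y1 j t)" using wsol_scale[OF y1, of y0] by simp
    then show ?thesis
      using wsol_imp_generalized_solution generalized_solution_imp_wsol wsol_unique by metis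
  qed
  moreover have "W21_star_norm m T y \<le> W21_star_norm m T y1 * \<bar>y0\<bar>"
    if "generalized_solution m q T a b c \<alpha> y0 y" for y0 y
    using wsol_scaled_norm[OF y1 generalized_solution_imp_wsol[OF that]] by simp
  ultimately show ?thesis by blast
qed

end
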